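(* Let $\Omega\subset\mathbb{R}^N$ ($N\ge 1$) be an open bounded domain with Lipschitz boundary, let $0<s<1$ and $0<\gamma<1$, and let $\phi:(0,\infty)\to(0,\infty)$ satisfy: $t\mapsto t\phi(t)$ is increasing on $(0,\infty)$, $\lim_{t\to 0}t\phi(t)=0$ and $\lim_{t\to+\infty}t\phi(t)=+\infty$. Let $\Phi(t)=\int_0^{|t|}\tau\phi(\tau)\,d\tau$. Then the problem $$(-\Delta_\Phi)^s u=u^{-\gamma}\ \text{in }\Omega,\qquad u>0\ \text{in }\Omega,\qquad u=0\ \text{in }\mathbb{R}^N\setminus\Omega,$$ admits a unique positive weak solution $u=u_s\in W_0^sL^\Phi(\Omega)$.
   Context: $\Phi$ is an $N$-function with $\Phi'(t)=\phi(|t|)t$ for all $t\in\mathbb{R}$ (value $0$ at $t=0$); $\tilde\Phi(r)=\sup_{t>0}\{rt-\Phi(t)\}$ is its conjugate. No $\Delta_2$-condition is assumed on $\Phi$ or $\tilde\Phi$. $L^\Phi(\Omega)$ is the space of measurable $u:\Omega\to\mathbb{R}$ with $\int_\Omega\Phi(|u|/\lambda)\,dx<\infty$ for some $\lambda>0$, with norm $\|u\|_\Phi=\inf\{\lambda>0:\int_\Omega\Phi(|u|/\lambda)dx\le 1\}$; functions on $\Omega$ are extended by zero to $\mathbb{R}^N$. On $\mathbb{R}^N\times\mathbb{R}^N$ put $d\mu=\frac{dx\,dy}{|x-y|^N}$ and $D_su(x,y)=\frac{u(x)-u(y)}{|x-y|^s}$; $L^\Phi(d\mu)$ is the analogous Orlicz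 space on $(\mathbb{R}^N\times\mathbb{R}^N,\mu)$. $W^sL^\Phi(\Omega)=\{u\in L^\Phi(\Omega): D_su\in L^\Phi(d\mu)\}$, with norm $\|u\|_\Phi+[u]_{s,\Phi}$, where $[u]_{s,\Phi}=\inf\{\lambda>0:(1-s)\iint\Phi(|D_su|/\lambda)\,d\mu\le1\}$. Via $u\mapsto(u,D_su)$ it is a subspace of $L^\Phi(\Omega)\times L^\Phi(d\mu)$, which is the dual of $E^{\tilde\Phi}(\Omega)\times E^{\tilde\Phi}(d\mu)$ (where $E^{\tilde\Phi}$ consists of the functions $w$ for which the modular $\int\tilde\Phi(|w|/\lambda)$ is finite for every $\lambda>0$); $W_0^sL^\Phi(\Omega)$ is the weak$^*$ closure of $C_0^\infty(\Omega)$ in $W^sL^\Phi(\Omega)$ for this duality. A weak solution of the problem is a function $u\in W_0^sL^\Phi(\Omega)$ such that for all $v\in W_0^sL^\Phi(\Omega)$ $$\frac{1-s}{2}\iint_{\mathbb{R}^N\times\mathbb{R}^N}\phi(|D_su|)\,D_su\,D_sv\,d\mu=\int_\Omega u^{-\gamma}v\,dx;$$ positive means $u>0$ a.e. in $\Omega$. *)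

theory Defs
  imports "HOL-Analysis.Analysis"
begin

section \<open>Domains and test functions\<close>

text \<open>
  Near every boundary point the domain is the strict epigraph of a Lipschitz function over the
  hyperplane orthogonal to some unit vector \<open>e\<close>. In dimension one that hyperplane
  is \<open>{0}\<close>, and the condition says that the domain is locally a half-line.
\<close>

definition lipschitz_boundary :: "'a::euclidean_space set \<Rightarrow> bool" where
  "lipschitz_boundary \<Omega> \<longleftrightarrow>
    (\<forall>p\<in>frontier \<Omega>. \<exists>e r L g. norm e = 1 \<and> r > 0 \<and>
       L-lipschitz_on {z. z \<bullet> e = 0} (g :: 'a \<Rightarrow> real) \<and>
       \<Omega> \<inter> ball p r = {x \<in> ball p r. g (x - (x \<bullet> e) *\<^sub>R e) < x \<bullet> e})"

fun times_cont_diff :: "nat \<Rightarrow> ('a::euclidean_space \<Rightarrow> real) \<Rightarrow> bool" where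
  "times_cont_diff 0 f \<longleftrightarrow> continuous_on UNIV f"
| "times_cont_diff (Suc k) f \<longleftrightarrow>
     (\<forall>x. f differentiable (at x)) \<and>
     (\<forall>b\<in>Basis. times_cont_diff k (\<lambda>x. frechet_derivative f (at x) b))"

definition test_functions :: "'a::euclidean_space set \<Rightarrow> ('a \<Rightarrow> real) set" where
  "test_functions \<Omega> =
    {f. (\<forall>k. times_cont_diff k f) \<and>
        compact (closure {x. f x \<noteq> 0}) \<and> closure {x. f x \<noteq> 0} \<subseteq> \<Omega>}"


section \<open>Orlicz spaces\<close>

text \<open>Only the values of \<open>\<phi>\<close> on the positive reals matter here.\<close>

definition Phi_of :: "(real \<Rightarrow> real) \<Rightarrow> real \<Rightarrow> real" where
  "Phi_of \<phi> t = integral {0..\<bar>t\<bar>} (\<lambda>\<tau>. \<tau> * \<phi> \<tau>)"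

text \<open>
  The supremum is one of real numbers. It is the intended one when \<open>\<Phi>\<close> is superlinear,
  since the set is then bounded above.
\<close>

definition conjugate_fun :: "(real \<Rightarrow> real) \<Rightarrow> real \<Rightarrow> real" where
  "conjugate_fun \<Phi> r = (SUP t\<in>{0<..}. r * t - \<Phi> t)"

text \<open>
  Elements of the spaces below are functions rather than almost-everywhere classes.
\<close>

definition orlicz_L :: "(real \<Rightarrow> real) \<Rightarrow> 'b measure \<Rightarrow> ('b \<Rightarrow> real) set" where
  "orlicz_L \<Phi> M =
    {f \<in> borel_measurable M. \<exists>l>0. (\<integral>\<^sup>+x. ennreal (\<Phi> (\<bar>f x\<bar> / l)) \<partial>M) < \<infinity>}"

definition orlicz_E :: "(real \<Rightarrow> real) \<Rightarrow> 'b measure \<Rightarrow> ('b \<Rightarrow> real) set" where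
  "orlicz_E \<Psi> M =
    {w \<in> borel_measurable M. \<forall>l>0. (\<integral>\<^sup>+x. ennreal (\<Psi> (\<bar>w x\<bar> / l)) \<partial>M) < \<infinity>}"

text \<open>
  The weak* topology of \<open>L\<^sup>\<Phi>(M) \<times> L\<^sup>\<Phi>(K)\<close> as the dual of
  \<open>E\<^sup>\<Psi>(M) \<times> E\<^sup>\<Psi>(K)\<close>, where \<open>\<Psi>\<close> is the conjugate of \<open>\<Phi>\<close>: the coarsest topology
  making all pairings with elements of the predual continuous.
\<close>

definition orlicz_weak_star ::
  "(real \<Rightarrow> real) \<Rightarrow> 'b measure \<Rightarrow> 'c measure \<Rightarrow> (('b \<Rightarrow> real) \<times> ('c \<Rightarrow> real)) topology" where
  "orlicz_weak_star \<Phi> M K =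
    (let E = orlicz_E (conjugate_fun \<Phi>) M \<times> orlicz_E (conjugate_fun \<Phi>) K in
     pullback_topology (orlicz_L \<Phi> M \<times> orlicz_L \<Phi> K)
       (\<lambda>(f, g). \<lambda>(w, z)\<in>E. (\<integral>x. f x * w x \<partial>M) + (\<integral>p. g p * z p \<partial>K))
       (powertop_real E))"


section \<open>Fractional Orlicz-Sobolev spaces\<close>

text \<open>On the diagonal, which is a null set, the density and the quotient below are \<open>0\<close>.\<close>

definition frac_measure :: "('a::euclidean_space \<times> 'a) measure" where
  "frac_measure = density lebesgue (\<lambda>(x, y). ennreal (1 / norm (x - y) ^ DIM('a)))"

definition D_frac :: "real \<Rightarrow> ('a::euclidean_space \<Rightarrow> real) \<Rightarrow> 'a \<times> 'a \<Rightarrow> real" where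
  "D_frac s u = (\<lambda>(x, y). (u x - u y) / norm (x - y) powr s)"

text \<open>Functions on \<open>\<Omega>\<close> are represented by their extension by zero to the whole space.\<close>

definition frac_W :: "(real \<Rightarrow> real) \<Rightarrow> real \<Rightarrow> 'a::euclidean_space set \<Rightarrow> ('a \<Rightarrow> real) set" where
  "frac_W \<Phi> s \<Omega> =
    {u. (\<forall>x. x \<notin> \<Omega> \<longrightarrow> u x = 0) \<and> u \<in> orlicz_L \<Phi> (lebesgue_on \<Omega>) \<and>
        D_frac s u \<in> orlicz_L \<Phi> frac_measure}"

definition frac_W_weak_star ::
  "(real \<Rightarrow> real) \<Rightarrow> real \<Rightarrow> 'a::euclidean_space set \<Rightarrow> ('a \<Rightarrow> real) topology" where
  "frac_W_weak_star \<Phi> s \<Omega> =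
    pullback_topology (frac_W \<Phi> s \<Omega>) (\<lambda>u. (u, D_frac s u))
      (orlicz_weak_star \<Phi> (lebesgue_on \<Omega>) frac_measure)"

definition frac_W0 :: "(real \<Rightarrow> real) \<Rightarrow> real \<Rightarrow> 'a::euclidean_space set \<Rightarrow> ('a \<Rightarrow> real) set" where
  "frac_W0 \<Phi> s \<Omega> = frac_W_weak_star \<Phi> s \<Omega> closure_of test_functions \<Omega>"


section \<open>Weak solutions of the singular problem\<close>

text \<open>
  Integrability of both integrands is part of the notion: the Bochner integral of a
  non-integrable function is \<open>0\<close> by convention.
\<close>

definition weak_solution ::
  "(real \<Rightarrow> real) \<Rightarrow> real \<Rightarrow> real \<Rightarrow> 'a::euclidean_space set \<Rightarrow> ('a \<Rightarrow> real) \<Rightarrow> bool" where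
  "weak_solution \<phi> s \<gamma> \<Omega> u \<longleftrightarrow>
    u \<in> frac_W0 (Phi_of \<phi>) s \<Omega> \<and>
    (\<forall>v \<in> frac_W0 (Phi_of \<phi>) s \<Omega>.
       integrable frac_measure (\<lambda>p. \<phi> \<bar>D_frac s u p\<bar> * D_frac s u p * D_frac s v p) \<and>
       integrable (lebesgue_on \<Omega>) (\<lambda>x. u x powr (- \<gamma>) * v x) \<and>
       (1 - s) / 2 * (\<integral>p. \<phi> \<bar>D_frac s u p\<bar> * D_frac s u p * D_frac s v p \<partial>frac_measure) =
         (\<integral>x. u x powr (- \<gamma>) * v x \<partial>lebesgue_on \<Omega>))"

definition positive_weak_solution ::
  "(real \<Rightarrow> real) \<Rightarrow> real \<Rightarrow> real \<Rightarrow> 'a::euclidean_space set \<Rightarrow> ('a \<Rightarrow> real) \<Rightarrow> bool" where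
  "positive_weak_solution \<phi> s \<gamma> \<Omega> u \<longleftrightarrow>
    weak_solution \<phi> s \<gamma> \<Omega> u \<and> (AE x in lebesgue_on \<Omega>. u x > 0)"

end

theory Submission
  imports Defs
begin

text \<open>
  With \<open>q = 1 - \<gamma>\<close>, the solution minimises the convex functional
  \<open>(1 - s) / 2 * \<integral>\<integral> \<Phi> (D u) d\<mu> - 1 / q * \<integral> u powr q\<close> over the nonnegative functions of finite energy.
  Comparing the minimiser \<open>u\<close> with its convex combinations with a competitor \<open>v\<close> shows that the
  residual \<open>L v\<close> of the weak equation satisfies \<open>L u \<le> L v\<close>. On multiples of nonnegative test functions
  this gives \<open>L \<ge> 0\<close>, and the inequality passes to all nonnegative functions of the space because
  these are limits of test functions: cut off locally, shift into the domain across the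
  Lipschitz boundary and mollify; by Jensen's inequality the modulars do not increase, so the
  pairings converge. Hence \<open>L u = 0\<close>, and comparing \<open>v\<close> with \<open>k * u\<close> for large \<open>k\<close> gives \<open>L v = 0\<close>.
  The same approximation shows that the weak* closure of the test functions is the whole space.
  Uniqueness follows by testing with the difference of two solutions.
\<close>

section \<open>Convex functions with an odd derivative\<close>

text \<open>Without a \<open>\<Delta>\<^sub>2\<close>-condition the functions of finite energy form
  a convex set rather than a vector space, so the energy cannot be differentiated in an arbitrary
  direction. Variations are taken only along segments inside that set, where convexity of the energy
  and concavity of the power produce quantities of one sign; Fatou's lemma then delivers
  integrability of the flux and of the singular term as part of the conclusion. Lipschitz functions
  supported in \<Omega> are special in that all their multiples have finite energy, which is why
  test functions may be scaled freely. As \<open>p\<close> is only nondecreasing, \<open>P\<close>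
  may fail to be strictly convex. Strictness comes from the power \<open>t powr q\<close>, both for
  the convergence of minimising sequences and for uniqueness, and the infinite slope of this power
  at 0 forces the minimiser to be positive. The analysis takes place with Borel functions and
  \<open>lborel\<close>, where Tonelli's theorem applies to the product; Lebesgue measurable
  functions enter at the end through Borel representatives.\<close>

lemma fatou_real:
  fixes f :: "nat \<Rightarrow> 'b \<Rightarrow> real"
  assumes f: "\<And>n. integrable M (f n)" and nonneg: "\<And>n. AE x in M. 0 \<le> f n x"
    and lim: "AE x in M. (\<lambda>n. f n x) \<longlonglongrightarrow> g x" and [measurable]: "g \<in> borel_measurable M"
    and bound: "\<exists>\<^sub>F n in sequentially. (\<integral>x. f n x \<partial>M) \<le> C"
  shows "integrable M g" "(\<integral>x. g x \<partial>M) \<le> C"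
proof -
  have [measurable]: "f n \<in> borel_measurable M" for n using f by auto
  have gn: "AE x in M. 0 \<le> g x"
  proof -
    have "AE x in M. \<forall>n. 0 \<le> f n x" using nonneg by (simp add: AE_all_countable)
    with lim show ?thesis
      by eventually_elim (auto intro: LIMSEQ_le_const)
  qed
  obtain n where n: "(\<integral>x. f n x \<partial>M) \<le> C" using frequently_ex[OF bound] by blast
  have C: "0 \<le> C" using integral_nonneg_AE[OF nonneg[of n]] n by linarith
  have "(\<integral>\<^sup>+x. ennreal (g x) \<partial>M) = (\<integral>\<^sup>+x. liminf (\<lambda>n. ennreal (f n x)) \<partial>M)"
    by (rule nn_integral_cong_AE)
      (use lim in \<open>eventually_elim, auto intro!: lim_imp_Liminf[symmetric] tendsto_ennrealI\<close>)
  also have "\<dots> \<le> liminf (\<lambda>n. \<integral>\<^sup>+x. ennreal (f n x) \<partial>M)"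
    by (rule nn_integral_liminf) auto
  also have "\<dots> = liminf (\<lambda>n. ennreal (\<integral>x. f n x \<partial>M))"
    using nn_integral_eq_integral[OF f nonneg] by simp
  also have "\<dots> \<le> ennreal C"
  \<comment> \<open>A bound for infinitely many indices suffices: if the liminf exceeded
    \<open>C\<close>, the integrals would exceed \<open>C\<close> from some index on. This form
    suits the later arguments by contradiction.\<close>
  proof (rule ccontr)
    assume "\<not> ?thesis"
    then have "eventually (\<lambda>n. ennreal C < ennreal (\<integral>x. f n x \<partial>M)) sequentially"
      by (auto simp: not_le intro: less_LiminfD)
    then have "eventually (\<lambda>n. \<not> (\<integral>x. f n x \<partial>M) \<le> C) sequentially"
      by eventually_elim (metis ennreal_leI not_le)
    with bound show False by (simp add: frequently_def)
  qed
  finally have le: "(\<integral>\<^sup>+x. ennreal (g x) \<partial>M) \<le> ennreal C" .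
  show ig: "integrable M g"
    using gn le by (intro integrableI_nonneg) (auto simp: order_le_less_trans)
  show "(\<integral>x. g x \<partial>M) \<le> C"
    using le C nn_integral_eq_integral[OF ig gn] by (simp add: integral_nonneg_AE)
qed

text \<open>Here \<open>P\<close> stands for \<Phi> and \<open>p\<close> for its derivative
  \<open>\<phi> \<bar>t\<bar> * t\<close>. Monotonicity of \<open>p\<close> is not strict, so
  \<open>P\<close> may be affine on intervals; \<open>p_top\<close> is the source of
  superlinearity.\<close>

locale convex_pair =
  fixes P p :: "real \<Rightarrow> real"
  assumes P_deriv: "\<And>t. (P has_real_derivative p t) (at t)"
    and p_mono: "mono p" and p_odd: "\<And>t. p (- t) = - p t"
    and P_0 [simp]: "P 0 = 0" and P_even: "\<And>t. P (- t) = P t"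
    and p_top: "filterlim p at_top at_top"
begin

lemma p_0 [simp]: "p 0 = 0" using p_odd[of 0] by simp

lemma p_nonneg: "0 \<le> t \<Longrightarrow> 0 \<le> p t" using monoD[OF p_mono, of 0 t] by simp

lemma p_mult_self_nonneg: "0 \<le> p t * t"
  using p_nonneg[of t] p_nonneg[of "-t"] by (cases "0 \<le> t") (auto simp: p_odd intro: mult_nonpos_nonpos)

lemma P_abs [simp]: "P \<bar>t\<bar> = P t" by (simp add: abs_if P_even)

lemma P_convex: "convex_on UNIV P"
  by (rule convex_on_realI[where f' = p]) (auto simp: P_deriv monoD[OF p_mono])

lemma P_subgradient: "P a + p a * (b - a) \<le> P b"
  using convex_on_imp_above_tangent[OF P_convex, of a b "p a"] P_deriv[of a] by simp

lemma P_nonneg [simp]: "0 \<le> P t"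
  using P_subgradient[of 0 t] by simp

lemma P_mono: "\<bar>a\<bar> \<le> \<bar>b\<bar> \<Longrightarrow> P a \<le> P b"
proof -
  assume "\<bar>a\<bar> \<le> \<bar>b\<bar>"
  then have "0 \<le> p \<bar>a\<bar> * (\<bar>b\<bar> - \<bar>a\<bar>)" by (simp add: p_nonneg)
  with P_subgradient[of "\<bar>a\<bar>" "\<bar>b\<bar>"] show ?thesis by simp
qed

lemma P_continuous: "continuous_on A P"
  by (rule DERIV_continuous_on[where D = p]) (use P_deriv has_field_derivative_at_within in blast)

lemma P_measurable [measurable]: "P \<in> borel_measurable borel"
  by (rule borel_measurable_continuous_onI[OF P_continuous])

lemma p_measurable [measurable]: "p \<in> borel_measurable borel"
  by (rule borel_measurable_mono[OF p_mono])

lemma P_tendsto: "(f \<longlongrightarrow> a) F \<Longrightarrow> ((\<lambda>x. P (f x)) \<longlongrightarrow> P a) F"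
  by (rule isCont_tendsto_compose[OF DERIV_isCont[OF P_deriv]])

lemma P_convex_comb:
  assumes "0 \<le> l" "l \<le> 1"
  shows "P ((1 - l) * a + l * b) \<le> (1 - l) * P a + l * P b"
  using convex_onD[OF P_convex assms, of a b] by simp

lemma P_scale: "0 \<le> l \<Longrightarrow> l \<le> 1 \<Longrightarrow> P (l * b) \<le> l * P b"
  using P_convex_comb[of l 0 b] by simp

text \<open>The tangent of \<open>P\<close> at a point \<open>a\<close> with
  \<open>p a \<ge> A\<close> is at least \<open>A * t - p a * a\<close> for
  \<open>t \<ge> 0\<close>, so \<open>B = p a * a\<close> works.\<close>

lemma P_superlinear:
  obtains B where "0 \<le> B" "\<And>t. 0 \<le> t \<Longrightarrow> A * t \<le> P t + B"
proof -
  from p_top have "eventually (\<lambda>a. A \<le> p a) at_top" by (simp add: filterlim_at_top)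
  then obtain a where a: "0 \<le> a" "A \<le> p a"
    by (metis eventually_at_top_linorder nle_le)
  have "A * t \<le> P t + p a * a" if "0 \<le> t" for t
  proof -
    have "A * t \<le> p a * t" using a that by (simp add: mult_right_mono)
    also have "\<dots> \<le> P t + p a * a"
      using P_subgradient[of a t] P_nonneg[of a] unfolding right_diff_distrib by linarith
    finally show ?thesis .
  qed
  with p_mult_self_nonneg[of a] show ?thesis using that by blast
qed

text \<open>Young's inequality at the slope \<open>p a\<close>: the conjugate of \<open>P\<close>
  there is \<open>p a * a - P a\<close>, and \<open>P a \<ge> 0\<close> is dropped. It makes the
  flux pair with every function of finite modular once \<open>p a * a\<close> is known to be
  integrable.\<close>

lemma p_young: "\<bar>p a * b\<bar> \<le> p a * a + P b"
proof -
  have 1: "p a * b \<le> p a * a + P b" for a b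
    using P_subgradient[of a b] P_nonneg[of a] unfolding right_diff_distrib by linarith
  show ?thesis using 1[of a b] 1[of a "-b"] by (auto simp: P_even abs_if)
qed

lemma P_difference_quotient:
  assumes "0 < e" "e \<le> 1"
  shows "(P (a + e * d) - P a) / e \<le> P (a + d) - P a"
  using P_convex_comb[of e a "a + d"] assms by (simp add: field_simps)

lemma P_difference_quotient_tendsto:
  "(\<lambda>n. (P (a + inverse (real (Suc n)) * d) - P a) / inverse (real (Suc n))) \<longlonglongrightarrow> p a * d"
proof -
  have "((\<lambda>e. P (a + e * d)) has_real_derivative p (a + 0 * d) * d) (at 0)"
    by (rule DERIV_chain2[where f = P and g = "\<lambda>e. a + e * d"]) (auto intro!: P_deriv derivative_eq_intros)
  then have "((\<lambda>e. (P (a + e * d) - P a) / e) \<longlongrightarrow> p a * d) (at 0)"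
    by (simp add: DERIV_def)
  moreover have "filterlim (\<lambda>n. inverse (real (Suc n))) (at 0) sequentially"
    using LIMSEQ_inverse_real_of_nat by (auto simp: filterlim_at)
  ultimately show ?thesis by (rule filterlim_compose)
qed

text \<open>The triangle inequality of the Luxemburg norm on the level of modulars:
  \<open>(x + y) / (a + b)\<close> is a convex combination of \<open>x / a\<close> and
  \<open>y / b\<close>, and the weights are then bounded by 1.\<close>

lemma P_sum_scale:
  assumes "0 < a" "0 < b"
  shows "P ((x + y) / (a + b)) \<le> P (x / a) + P (y / b)"
proof -
  have "P ((x + y) / (a + b)) = P ((1 - b / (a + b)) * (x / a) + b / (a + b) * (y / b))"
  proof -
    have "1 - b / (a + b) = a / (a + b)" using assms by (simp add: field_simps)
    then show ?thesis using assms by (simp add: add_divide_distrib)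
  qed
  also have "\<dots> \<le> (1 - b / (a + b)) * P (x / a) + b / (a + b) * P (y / b)"
    using assms by (intro P_convex_comb) (auto simp: field_simps)
  also have "\<dots> \<le> P (x / a) + P (y / b)"
    using assms by (intro add_mono mult_left_le_one_le) (auto simp: field_simps)
  finally show ?thesis .
qed

text \<open>Without a \<open>\<Delta>\<^sub>2\<close>-condition, a bound on the modulars replaces convergence in norm: the
  pairings converge by applying Fatou's lemma to \<open>l * (h + P (f n / l)) \<plusminus> z * f n\<close>.\<close>

lemma pairing_tendsto:
  fixes f :: "nat \<Rightarrow> 'b \<Rightarrow> real"
  assumes [measurable]: "\<And>n. f n \<in> borel_measurable M" "g \<in> borel_measurable M" "z \<in> borel_measurable M"
    and lim: "AE x in M. (\<lambda>n. f n x) \<longlonglongrightarrow> g x" and l: "0 < l"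
    and g: "(\<integral>\<^sup>+x. P (g x / l) \<partial>M) < \<infinity>"
    and le: "\<And>n. (\<integral>\<^sup>+x. P (f n x / l) \<partial>M) \<le> (\<integral>\<^sup>+x. P (g x / l) \<partial>M)"
    and h: "integrable M h" and z: "AE x in M. \<forall>b. \<bar>z x * b\<bar> \<le> h x + P b"
  shows "integrable M (\<lambda>x. z x * g x)" "\<And>n. integrable M (\<lambda>x. z x * f n x)"
    "(\<lambda>n. \<integral>x. z x * f n x \<partial>M) \<longlonglongrightarrow> (\<integral>x. z x * g x \<partial>M)"
proof -
  have Pg: "integrable M (\<lambda>x. P (g x / l))" using g by (intro integrableI_nonneg) auto
  have Pf: "integrable M (\<lambda>x. P (f n x / l))" for n
    using order_le_less_trans[OF le[of n] g] by (intro integrableI_nonneg) auto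
  have Ple: "(\<integral>x. P (f n x / l) \<partial>M) \<le> (\<integral>x. P (g x / l) \<partial>M)" for n
    using le[of n] nn_integral_eq_integral[OF Pf[of n]] nn_integral_eq_integral[OF Pg]
    by (simp add: integral_nonneg_AE)
  have dom: "AE x in M. \<bar>z x * b x\<bar> \<le> l * (h x + P (b x / l))" for b
    using z
  proof eventually_elim
    case (elim x)
    then have "\<bar>z x * (b x / l)\<bar> \<le> h x + P (b x / l)" by blast
    then have "\<bar>z x * b x\<bar> / l \<le> h x + P (b x / l)" using l by (simp add: abs_mult)
    then show ?case using l by (simp add: field_simps)
  qed
  have [measurable]: "h \<in> borel_measurable M" using h by auto
  have bnd: "integrable M (\<lambda>x. z x * b x)"
    if [measurable]: "b \<in> borel_measurable M" and Pb: "integrable M (\<lambda>x. P (b x / l))" for b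
  proof (rule Bochner_Integration.integrable_bound)
    show "integrable M (\<lambda>x. l * (h x + P (b x / l)))" using h Pb by simp
    show "AE x in M. norm (z x * b x) \<le> norm (l * (h x + P (b x / l)))"
      using dom[of b] by eventually_elim simp
  qed measurable
  show ig: "integrable M (\<lambda>x. z x * g x)" using Pg by (intro bnd) auto
  show if': "integrable M (\<lambda>x. z x * f n x)" for n using Pf by (intro bnd) auto
  \<comment> \<open>Lower semicontinuity of the pairing, up to \<open>e\<close>, for
    \<open>z\<close> and for \<open>- z\<close>; the two signs of \<open>\<sigma>\<close> bound the
    limit from both sides.\<close>
  have *: "eventually (\<lambda>n. (\<integral>x. \<sigma> * (z x * g x) \<partial>M) - e < (\<integral>x. \<sigma> * (z x * f n x) \<partial>M)) sequentially"
    if \<sigma>: "\<bar>\<sigma>\<bar> = 1" and e: "0 < e" for \<sigma> e :: real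
  proof (rule ccontr)
    assume neg: "\<not> ?thesis"
    let ?F = "\<lambda>n x. l * (h x + P (f n x / l)) + \<sigma> * (z x * f n x)"
    let ?G = "\<lambda>x. l * (h x + P (g x / l)) + \<sigma> * (z x * g x)"
    let ?C = "l * ((\<integral>x. h x \<partial>M) + (\<integral>x. P (g x / l) \<partial>M)) + (\<integral>x. \<sigma> * (z x * g x) \<partial>M)"
    have F: "(\<integral>x. ?F n x \<partial>M) = l * ((\<integral>x. h x \<partial>M) + (\<integral>x. P (f n x / l) \<partial>M)) + (\<integral>x. \<sigma> * (z x * f n x) \<partial>M)" for n
      using h Pf[of n] if'[of n] by (subst Bochner_Integration.integral_add) auto
    \<comment> \<open>Along the indices where the claim fails, \<open>Ple\<close> keeps the modular
      part at most at its value for the limit \<open>g\<close>, so the integral of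
      \<open>?F n\<close> stays \<open>e\<close> below that of \<open>?G\<close>, against Fatou's
      lemma.\<close>
    have "(\<integral>x. ?G x \<partial>M) \<le> ?C - e"
    proof (rule fatou_real(2)[of M ?F])
      show "integrable M (?F n)" for n using h Pf[of n] if'[of n] by auto
      show "AE x in M. 0 \<le> ?F n x" for n
        using dom[of "f n"] by eventually_elim (use \<sigma> in \<open>auto simp: abs_if split: if_splits\<close>)
      show "AE x in M. (\<lambda>n. ?F n x) \<longlonglongrightarrow> ?G x"
        using lim by eventually_elim (use l in \<open>auto intro!: tendsto_intros P_tendsto\<close>)
      have "\<exists>\<^sub>F n in sequentially. (\<integral>x. \<sigma> * (z x * f n x) \<partial>M) \<le> (\<integral>x. \<sigma> * (z x * g x) \<partial>M) - e"
        using neg by (simp add: frequently_def not_le)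
      then show "\<exists>\<^sub>F n in sequentially. (\<integral>x. ?F n x \<partial>M) \<le> ?C - e"
      proof (rule frequently_mono[rotated], intro allI impI)
        fix n assume "(\<integral>x. \<sigma> * (z x * f n x) \<partial>M) \<le> (\<integral>x. \<sigma> * (z x * g x) \<partial>M) - e"
        moreover have "l * ((\<integral>x. h x \<partial>M) + (\<integral>x. P (f n x / l) \<partial>M)) \<le> l * ((\<integral>x. h x \<partial>M) + (\<integral>x. P (g x / l) \<partial>M))"
          using Ple[of n] l by simp
        ultimately show "(\<integral>x. ?F n x \<partial>M) \<le> ?C - e" unfolding F by linarith
      qed
    qed measurable
    moreover have "(\<integral>x. ?G x \<partial>M) = ?C"
      using h Pg ig by (subst Bochner_Integration.integral_add) auto
    ultimately show False using e by simp
  qed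
  show "(\<lambda>n. \<integral>x. z x * f n x \<partial>M) \<longlonglongrightarrow> (\<integral>x. z x * g x \<partial>M)"
  proof (rule order_tendstoI)
    fix a assume "a < (\<integral>x. z x * g x \<partial>M)"
    then show "eventually (\<lambda>n. a < (\<integral>x. z x * f n x \<partial>M)) sequentially"
      using *[of 1 "(\<integral>x. z x * g x \<partial>M) - a"] by simp
  next
    fix a assume "(\<integral>x. z x * g x \<partial>M) < a"
    then show "eventually (\<lambda>n. (\<integral>x. z x * f n x \<partial>M) < a) sequentially"
      using *[of "-1" "a - (\<integral>x. z x * g x \<partial>M)"] by simp
  qed
qed

text \<open>Jensen's inequality for the probability density \<open>r\<close>, followed by Tonelli's
  theorem. With \<open>G x h\<close> a translate by \<open>h\<close> it says that averaging over
  translations does not increase a modular.\<close>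

lemma modular_average_le:
  assumes M: "sigma_finite_measure M" and K: "sigma_finite_measure K"
    and [measurable]: "case_prod G \<in> borel_measurable (M \<Otimes>\<^sub>M K)" "r \<in> borel_measurable K"
    and r0: "\<And>h. 0 \<le> r h" and r: "integrable K r" and r1: "(\<integral>h. r h \<partial>K) = 1"
    and ig: "\<And>x. integrable K (\<lambda>h. r h * G x h)"
    and le: "\<And>h. r h \<noteq> 0 \<Longrightarrow> (\<integral>\<^sup>+x. P (G x h) \<partial>M) \<le> I"
  shows "(\<integral>\<^sup>+x. P (\<integral>h. r h * G x h \<partial>K) \<partial>M) \<le> I"
proof -
  interpret M: sigma_finite_measure M by fact
  interpret K: sigma_finite_measure K by fact
  interpret pair_sigma_finite M K ..
  have pt: "ennreal (P (\<integral>h. r h * G x h \<partial>K)) \<le> (\<integral>\<^sup>+h. ennreal (r h * P (G x h)) \<partial>K)" for x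
  proof -
    let ?a = "\<integral>h. r h * G x h \<partial>K"
    \<comment> \<open>This is \<open>r h\<close> times the tangent of \<open>P\<close> at the
      average \<open>?a\<close>, evaluated at \<open>G x h\<close>; its linear part integrates to
      zero.\<close>
    let ?f = "\<lambda>h. r h * P ?a + p ?a * (r h * G x h - ?a * r h)"
    have ii: "integrable K ?f" using r ig[of x] by auto
    have "(\<integral>h. ?f h \<partial>K) = P ?a"
      using r ig[of x] r1 by simp
    then have "ennreal (P ?a) = ennreal (\<integral>h. ?f h \<partial>K)" by simp
    also have "\<dots> \<le> (\<integral>\<^sup>+h. ennreal (?f h) \<partial>K)"
    proof -
      \<comment> \<open>The tangent may be negative. As \<open>ennreal\<close> sends negative
        numbers to 0, passing to the positive part leaves the nonnegative integral of
        \<open>?f\<close> unchanged.\<close>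
      have "ennreal (\<integral>h. ?f h \<partial>K) \<le> ennreal (\<integral>h. max 0 (?f h) \<partial>K)"
        using ii by (intro ennreal_leI integral_mono) auto
      also have "\<dots> = (\<integral>\<^sup>+h. ennreal (max 0 (?f h)) \<partial>K)"
        using ii by (subst nn_integral_eq_integral) auto
      also have "\<dots> = (\<integral>\<^sup>+h. ennreal (?f h) \<partial>K)"
        by (intro nn_integral_cong) (auto simp: max_def ennreal_neg)
      finally show ?thesis .
    qed
    also have "\<dots> \<le> (\<integral>\<^sup>+h. ennreal (r h * P (G x h)) \<partial>K)"
    proof (intro nn_integral_mono ennreal_leI)
      fix h
      have "r h * (P ?a + p ?a * (G x h - ?a)) \<le> r h * P (G x h)"
        by (intro mult_left_mono P_subgradient r0)
      then show "?f h \<le> r h * P (G x h)" by (simp add: algebra_simps)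
    qed
    finally show ?thesis .
  qed
  have "(\<integral>\<^sup>+x. P (\<integral>h. r h * G x h \<partial>K) \<partial>M) \<le> (\<integral>\<^sup>+x. (\<integral>\<^sup>+h. ennreal (r h * P (G x h)) \<partial>K) \<partial>M)"
    by (intro nn_integral_mono pt)
  also have "\<dots> = (\<integral>\<^sup>+h. (\<integral>\<^sup>+x. ennreal (r h * P (G x h)) \<partial>M) \<partial>K)"
    by (rule Fubini'[symmetric]) measurable
  also have "\<dots> = (\<integral>\<^sup>+h. ennreal (r h) * (\<integral>\<^sup>+x. ennreal (P (G x h)) \<partial>M) \<partial>K)"
  proof (intro nn_integral_cong)
    fix h assume [measurable]: "h \<in> space K"
    have "(\<integral>\<^sup>+x. ennreal (r h * P (G x h)) \<partial>M) = (\<integral>\<^sup>+x. ennreal (r h) * ennreal (P (G x h)) \<partial>M)"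
      by (simp add: ennreal_mult r0)
    also have "\<dots> = ennreal (r h) * (\<integral>\<^sup>+x. ennreal (P (G x h)) \<partial>M)"
      by (rule nn_integral_cmult) measurable
    finally show "(\<integral>\<^sup>+x. ennreal (r h * P (G x h)) \<partial>M) = ennreal (r h) * (\<integral>\<^sup>+x. ennreal (P (G x h)) \<partial>M)" .
  qed
  also have "\<dots> \<le> (\<integral>\<^sup>+h. ennreal (r h) * I \<partial>K)"
  proof (intro nn_integral_mono)
    fix h show "ennreal (r h) * (\<integral>\<^sup>+x. ennreal (P (G x h)) \<partial>M) \<le> ennreal (r h) * I"
      using le[of h] by (cases "r h = 0") (auto intro: mult_left_mono)
  qed
  also have "\<dots> = I"
    using nn_integral_eq_integral[OF r] r0 r1 by (simp add: nn_integral_multc)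
  finally show ?thesis .
qed

end

section \<open>Smooth bumps and mollification\<close>

lemma times_cont_diff_SucI:
  assumes "\<And>x. (f has_derivative f' x) (at x)" "\<And>b. b \<in> Basis \<Longrightarrow> times_cont_diff k (\<lambda>x. f' x b)"
  shows "times_cont_diff (Suc k) f"
proof -
  have "frechet_derivative f (at x) = f' x" for x
    using frechet_derivative_at[OF assms(1)] by simp
  with assms show ?thesis by (auto simp: differentiable_def)
qed

lemma times_cont_diff_Suc_has_derivative:
  "times_cont_diff (Suc k) f \<Longrightarrow> (f has_derivative frechet_derivative f (at x)) (at x)"
  using frechet_derivative_works by auto

lemma times_cont_diff_Suc: "times_cont_diff (Suc k) f \<Longrightarrow> times_cont_diff k f"
proof (induction k arbitrary: f)
  case 0
  then show ?case
    by (auto intro!: differentiable_imp_continuous_on simp: differentiable_on_def intro: differentiable_at_withinI)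
next
  case (Suc k)
  have "times_cont_diff (Suc k) (\<lambda>x. frechet_derivative f (at x) b)" if "b \<in> Basis" for b
    using Suc.prems that by simp
  with Suc.IH have "times_cont_diff k (\<lambda>x. frechet_derivative f (at x) b)" if "b \<in> Basis" for b
    using that by blast
  with Suc.prems show ?case by simp
qed

lemma times_cont_diff_const: "times_cont_diff k (\<lambda>x. c)"
  by (induction k arbitrary: c) auto

lemma times_cont_diff_inner: "times_cont_diff k (\<lambda>x. x \<bullet> a + c)"
proof (cases k)
  case (Suc j)
  show ?thesis unfolding Suc
    by (rule times_cont_diff_SucI[where f' = "\<lambda>x h. h \<bullet> a"])
      (auto intro!: derivative_eq_intros times_cont_diff_const)
qed (auto intro!: continuous_intros)

lemma times_cont_diff_add:
  "times_cont_diff k f \<Longrightarrow> times_cont_diff k g \<Longrightarrow> times_cont_diff k (\<lambda>x. f x + g x)"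
proof (induction k arbitrary: f g)
  case (Suc k)
  show ?case
  proof (rule times_cont_diff_SucI)
    show "((\<lambda>x. f x + g x) has_derivative (\<lambda>h. frechet_derivative f (at x) h + frechet_derivative g (at x) h)) (at x)" for x
      using Suc.prems by (intro has_derivative_add times_cont_diff_Suc_has_derivative)
  qed (use Suc in auto)
qed (auto intro: continuous_on_add)

lemma times_cont_diff_mult:
  "times_cont_diff k f \<Longrightarrow> times_cont_diff k g \<Longrightarrow> times_cont_diff k (\<lambda>x. f x * g x)"
proof (induction k arbitrary: f g)
  case (Suc k)
  have *: "times_cont_diff k f" "times_cont_diff k g" using Suc.prems times_cont_diff_Suc by blast+
  show ?case
  proof (rule times_cont_diff_SucI)
    show "((\<lambda>x. f x * g x) has_derivative (\<lambda>h. f x * frechet_derivative g (at x) h + frechet_derivative f (at x) h * g x)) (at x)" for x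
      using Suc.prems by (intro has_derivative_mult times_cont_diff_Suc_has_derivative)
    show "times_cont_diff k (\<lambda>x. f x * frechet_derivative g (at x) b + frechet_derivative f (at x) b * g x)" if "b \<in> Basis" for b
      using Suc that * by (intro times_cont_diff_add Suc.IH) auto
  qed
qed (auto intro: continuous_on_mult)

text \<open>Derivatives of \<open>exp (- 1 / t)\<close> extended by zero are combinations of these functions.\<close>

definition flat :: "nat \<Rightarrow> real \<Rightarrow> real" where
  "flat n t = (if 0 < t then exp (- 1 / t) / t ^ n else 0)"

lemma flat_tendsto_0: "(flat n \<longlongrightarrow> 0) (at_right 0)"
proof -
  have "((\<lambda>t. inverse t ^ n / exp (inverse t)) \<longlongrightarrow> 0) (at_right (0::real))"
    using filterlim_compose[OF tendsto_power_div_exp_0 filterlim_inverse_at_top_right] .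
  then show ?thesis
  proof (rule Lim_transform_eventually)
    show "\<forall>\<^sub>F t in at_right 0. inverse t ^ n / exp (inverse t) = flat n t"
      by (auto simp: eventually_at_right_field flat_def exp_minus field_simps intro!: exI[of _ 1])
  qed
qed

lemma flat_deriv: "(flat n has_real_derivative flat (n + 2) t - real n * flat (n + 1) t) (at t)"
proof -
  consider "t < 0" | "t = 0" | "0 < t" by linarith
  then show ?thesis
  proof cases
    case 1
    have "((\<lambda>t. 0) has_real_derivative 0) (at t)" by simp
    then have "(flat n has_real_derivative 0) (at t)"
      by (rule has_field_derivative_transform_within_open[where S = "{..<0}"]) (use 1 in \<open>auto simp: flat_def\<close>)
    then show ?thesis using 1 by (simp add: flat_def)
  next
    case 3
    have "((\<lambda>t. exp (- 1 / t) / t ^ n) has_real_derivative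
      (exp (- 1 / t) * (1 / t\<^sup>2) * t ^ n - exp (- 1 / t) * (real n * t ^ (n - 1))) / (t ^ n * t ^ n)) (at t)"
      using 3 by (auto intro!: derivative_eq_intros simp: power2_eq_square)
    also have "(exp (- 1 / t) * (1 / t\<^sup>2) * t ^ n - exp (- 1 / t) * (real n * t ^ (n - 1))) / (t ^ n * t ^ n)
      = flat (n + 2) t - real n * flat (n + 1) t"
      using 3 by (cases n) (auto simp: flat_def field_simps power2_eq_square)
    finally show ?thesis
      by (rule has_field_derivative_transform_within_open[where S = "{0<..}"]) (use 3 in \<open>auto simp: flat_def\<close>)
  next
    case 2
    \<comment> \<open>From the left the quotient is zero, and from the right it equals
      \<open>flat (Suc n)\<close>, which tends to zero.\<close>
    have "((\<lambda>y. flat n y / y) \<longlongrightarrow> 0) (at 0)"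
    proof (rule filterlim_split_at_real)
      show "((\<lambda>y. flat n y / y) \<longlongrightarrow> 0) (at_left 0)"
        by (rule Lim_transform_eventually[OF tendsto_const])
          (auto simp: eventually_at_left_field flat_def intro!: exI[of _ "-1"])
      show "((\<lambda>y. flat n y / y) \<longlongrightarrow> 0) (at_right 0)"
        by (rule Lim_transform_eventually[OF flat_tendsto_0[of "Suc n"]])
          (auto simp: eventually_at_right_field flat_def field_simps intro!: exI[of _ 1])
    qed
    then show ?thesis using 2 by (simp add: DERIV_def flat_def)
  qed
qed

text \<open>The argument of \<open>flat\<close> is a polynomial in \<open>x\<close>, so the chain
  rule needs no exception at the centre, where the norm is not differentiable.\<close>

definition bump :: "'a::euclidean_space \<Rightarrow> real \<Rightarrow> 'a \<Rightarrow> real" where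
  "bump a r x = flat 0 (r\<^sup>2 - (x - a) \<bullet> (x - a))"

lemma bump_times_cont_diff: "times_cont_diff k (bump a r)"
proof -
  \<comment> \<open>All orders \<open>n\<close> are treated at once because differentiating
    \<open>flat n\<close> produces \<open>flat (n + 1)\<close> and \<open>flat (n + 2)\<close>; the
    inner derivative is affine in \<open>x\<close>.\<close>
  have "times_cont_diff k (\<lambda>x. flat n (r\<^sup>2 - (x - a) \<bullet> (x - a)))" for n
  proof (induction k arbitrary: n)
    case 0
    have "continuous_on UNIV (flat n)"
      by (rule DERIV_continuous_on[OF has_field_derivative_at_within[OF flat_deriv]])
    then have "continuous_on UNIV (\<lambda>x. flat n (r\<^sup>2 - (x - a) \<bullet> (x - a)))"
      by (rule continuous_on_compose2) (auto intro!: continuous_intros)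
    then show ?case by simp
  next
    case (Suc k)
    let ?q = "\<lambda>x. r\<^sup>2 - (x - a) \<bullet> (x - a)"
    show ?case
    proof (rule times_cont_diff_SucI)
      fix x
      have q: "(?q has_derivative (\<lambda>h. - 2 * ((x - a) \<bullet> h))) (at x)"
        by (auto intro!: derivative_eq_intros simp: inner_commute)
      show "((\<lambda>x. flat n (?q x)) has_derivative
          (\<lambda>h. (flat (n + 2) (?q x) - real n * flat (n + 1) (?q x)) * (- 2 * ((x - a) \<bullet> h)))) (at x)"
        by (rule has_derivative_compose[OF q flat_deriv[unfolded has_field_derivative_def]])
    next
      fix b :: 'a
      have "times_cont_diff k (\<lambda>x. (flat (n + 2) (?q x) + (- real n) * flat (n + 1) (?q x)) * (- 2 * (x \<bullet> b + (- (a \<bullet> b)))))"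
        by (intro times_cont_diff_mult times_cont_diff_add Suc times_cont_diff_const times_cont_diff_inner)
      then show "times_cont_diff k (\<lambda>x. (flat (n + 2) (?q x) - real n * flat (n + 1) (?q x)) * (- 2 * ((x - a) \<bullet> b)))"
        by (simp add: inner_diff_left)
    qed
  qed
  from this[of 0] show ?thesis by (simp add: bump_def[abs_def])
qed

lemma bump_nonneg: "0 \<le> bump a r x" by (simp add: bump_def flat_def)

lemma bump_eq_0_iff: "0 < r \<Longrightarrow> bump a r x = 0 \<longleftrightarrow> x \<notin> ball a r"
proof -
  assume "0 < r"
  have "(x - a) \<bullet> (x - a) = (dist a x)\<^sup>2" by (simp add: dist_norm norm_minus_commute[of a x] power2_norm_eq_inner)
  moreover have "r\<^sup>2 \<le> (dist a x)\<^sup>2 \<longleftrightarrow> r \<le> dist a x"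
    using \<open>0 < r\<close> by (intro power_mono_iff) auto
  ultimately show ?thesis by (simp add: bump_def flat_def) (metis not_le)
qed

section \<open>Global bounds for smooth functions of bounded support\<close>

definition smooth_bounded_support :: "('a::euclidean_space \<Rightarrow> real) \<Rightarrow> bool" where
  "smooth_bounded_support f \<longleftrightarrow> (\<forall>k. times_cont_diff k f) \<and> (\<exists>R. \<forall>x. R < norm x \<longrightarrow> f x = 0)"

lemma smooth_bounded_support_continuous: "smooth_bounded_support f \<Longrightarrow> continuous_on A f"
  unfolding smooth_bounded_support_def
  by (metis continuous_on_subset subset_UNIV times_cont_diff.simps(1))

lemma smooth_bounded_support_has_derivative:
  "smooth_bounded_support f \<Longrightarrow> (f has_derivative frechet_derivative f (at x)) (at x)"
  unfolding smooth_bounded_support_def using times_cont_diff_Suc_has_derivative by blast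

lemma smooth_bounded_support_partial:
  assumes f: "smooth_bounded_support f" and b: "b \<in> Basis"
  shows "smooth_bounded_support (\<lambda>x. frechet_derivative f (at x) b)"
proof -
  obtain R where R: "\<And>x. R < norm x \<Longrightarrow> f x = 0" using f by (auto simp: smooth_bounded_support_def)
  have "frechet_derivative f (at x) = (\<lambda>h. 0)" if "R < norm x" for x
  proof -
    have "((\<lambda>x. 0) has_derivative (\<lambda>h. 0)) (at x)" by simp
    then have "(f has_derivative (\<lambda>h. 0)) (at x)"
      by (rule has_derivative_transform_within_open[where s = "{x. R < norm x}"])
        (use that R in \<open>auto intro!: open_Collect_less continuous_intros\<close>)
    from frechet_derivative_at[OF this] show ?thesis by simp
  qed
  moreover have "times_cont_diff k (\<lambda>x. frechet_derivative f (at x) b)" for k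
  proof -
    have "times_cont_diff (Suc k) f" using f unfolding smooth_bounded_support_def by blast
    then show ?thesis using b by simp
  qed
  ultimately show ?thesis
    unfolding smooth_bounded_support_def by (intro conjI allI exI[of _ R] impI) simp_all
qed

lemma smooth_bounded_support_bounded:
  assumes f: "smooth_bounded_support f"
  obtains B where "0 \<le> B" "\<And>x. \<bar>f x\<bar> \<le> B"
proof -
  obtain R where R: "\<And>x. R < norm x \<Longrightarrow> f x = 0" using f by (auto simp: smooth_bounded_support_def)
  have "compact (f ` cball 0 R)"
    by (intro compact_continuous_image smooth_bounded_support_continuous f compact_cball)
  then obtain B where "\<And>x. x \<in> cball 0 R \<Longrightarrow> \<bar>f x\<bar> \<le> B"
    by (auto dest!: compact_imp_bounded simp: bounded_iff dist_norm) (metis mem_cball_0)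
  then have "\<bar>f x\<bar> \<le> max 0 B" for x
    using R[of x] by (cases "norm x \<le> R") (auto simp: not_le dist_norm intro: order_trans[OF _ max.cobounded2])
  then show ?thesis using that[of "max 0 B"] by simp
qed

lemma has_derivative_components:
  assumes "(f has_derivative f') (at x)"
  shows "f' (h :: 'a::euclidean_space) = (\<Sum>b\<in>Basis. (h \<bullet> b) * (f' b :: real))"
proof -
  have lin: "linear f'" using assms by (simp add: has_derivative_linear)
  have "f' h = f' (\<Sum>b\<in>Basis. (h \<bullet> b) *\<^sub>R b)" by (simp add: euclidean_representation)
  also have "\<dots> = (\<Sum>b\<in>Basis. (h \<bullet> b) * f' b)"
    by (simp add: linear_sum[OF lin] linear_cmul[OF lin])
  finally show ?thesis .
qed

lemma smooth_bounded_support_mvt: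
  assumes f: "smooth_bounded_support f"
  obtains \<xi> where "f (z + h) - f z = frechet_derivative f (at (z + \<xi> *\<^sub>R h)) h" "0 < \<xi>" "\<xi> < 1"
proof -
  let ?g = "\<lambda>t::real. f (z + t *\<^sub>R h)"
  have "(?g has_derivative (\<lambda>y. frechet_derivative f (at (z + t *\<^sub>R h)) (y *\<^sub>R h))) (at t within {0..1})" for t
    by (rule has_derivative_compose[OF _ smooth_bounded_support_has_derivative[OF f]])
      (auto intro!: derivative_eq_intros)
  then obtain \<xi> where "\<xi> \<in> {0<..<1}" "?g 1 - ?g 0 = frechet_derivative f (at (z + \<xi> *\<^sub>R h)) ((1 - 0) *\<^sub>R h)"
    using mvt_simple[of 0 1 ?g "\<lambda>t y. frechet_derivative f (at (z + t *\<^sub>R h)) (y *\<^sub>R h)"] by auto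
  then show ?thesis using that[of \<xi>] by auto
qed

lemma smooth_bounded_support_lipschitz:
  assumes f: "smooth_bounded_support f"
  obtains B where "0 \<le> B" "\<And>x y. \<bar>f x - f y\<bar> \<le> B * norm (x - y)"
proof -
  have "\<exists>C\<ge>0. \<forall>x. \<bar>frechet_derivative f (at x) b\<bar> \<le> C" if "b \<in> Basis" for b
    using smooth_bounded_support_bounded[OF smooth_bounded_support_partial[OF f that]] by metis
  then obtain C where C: "\<And>b. b \<in> Basis \<Longrightarrow> 0 \<le> C b"
    "\<And>b x. b \<in> Basis \<Longrightarrow> \<bar>frechet_derivative f (at x) b\<bar> \<le> C b" by metis
  have "\<bar>f x - f y\<bar> \<le> (\<Sum>b\<in>Basis. C b) * norm (x - y)" for x y
  proof -
    obtain \<xi> where "f (y + (x - y)) - f y = frechet_derivative f (at (y + \<xi> *\<^sub>R (x - y))) (x - y)"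
      by (rule smooth_bounded_support_mvt[OF f])
    then have e: "f x - f y = frechet_derivative f (at (y + \<xi> *\<^sub>R (x - y))) (x - y)" by simp
    have "\<bar>f x - f y\<bar> \<le> (\<Sum>b\<in>Basis. \<bar>((x - y) \<bullet> b) * frechet_derivative f (at (y + \<xi> *\<^sub>R (x - y))) b\<bar>)"
      unfolding e has_derivative_components[OF smooth_bounded_support_has_derivative[OF f], of "y + \<xi> *\<^sub>R (x - y)" "x - y"]
      by (rule sum_abs)
    also have "\<dots> \<le> (\<Sum>b\<in>Basis. norm (x - y) * C b)"
      unfolding abs_mult by (intro sum_mono mult_mono Basis_le_norm C) auto
    finally show ?thesis unfolding sum_distrib_right by (simp add: mult.commute)
  qed
  then show ?thesis using C(1) that[of "\<Sum>b\<in>Basis. C b"] by (simp add: sum_nonneg)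
qed

text \<open>The mean value theorem moves the increment to a point of the segment, where the gradient
  differs from the one at \<open>z\<close> by at most a Lipschitz constant times
  \<open>norm h\<close>. Uniformity in \<open>z\<close> is what allows integration against an
  arbitrary \<open>w\<close> later.\<close>

lemma smooth_bounded_support_taylor:
  assumes f: "smooth_bounded_support f"
  obtains B where "0 \<le> B"
    "\<And>z h. \<bar>f (z + h) - f z - frechet_derivative f (at z) h\<bar> \<le> B * (norm h)\<^sup>2"
proof -
  let ?D = "\<lambda>b x. frechet_derivative f (at x) b"
  have "\<exists>C\<ge>0. \<forall>x y. \<bar>?D b x - ?D b y\<bar> \<le> C * norm (x - y)" if "b \<in> Basis" for b
    using smooth_bounded_support_lipschitz[OF smooth_bounded_support_partial[OF f that]] by metis
  then obtain C where C: "\<And>b. b \<in> Basis \<Longrightarrow> 0 \<le> C b"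
    "\<And>b x y. b \<in> Basis \<Longrightarrow> \<bar>?D b x - ?D b y\<bar> \<le> C b * norm (x - y)" by metis
  have "\<bar>f (z + h) - f z - frechet_derivative f (at z) h\<bar> \<le> (\<Sum>b\<in>Basis. C b) * (norm h)\<^sup>2" for z h
  proof -
    note comp = has_derivative_components[OF smooth_bounded_support_has_derivative[OF f]]
    obtain \<xi> where \<xi>: "f (z + h) - f z = frechet_derivative f (at (z + \<xi> *\<^sub>R h)) h" "0 < \<xi>" "\<xi> < 1"
      by (rule smooth_bounded_support_mvt[OF f])
    have e: "f (z + h) - f z - frechet_derivative f (at z) h
      = (\<Sum>b\<in>Basis. (h \<bullet> b) * (?D b (z + \<xi> *\<^sub>R h) - ?D b z))"
      unfolding \<xi>(1) comp[of "z + \<xi> *\<^sub>R h" h] comp[of z h] by (simp add: right_diff_distrib sum_subtractf)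
    have "\<bar>f (z + h) - f z - frechet_derivative f (at z) h\<bar>
      \<le> (\<Sum>b\<in>Basis. \<bar>(h \<bullet> b) * (?D b (z + \<xi> *\<^sub>R h) - ?D b z)\<bar>)"
      unfolding e by (rule sum_abs)
    also have "\<dots> \<le> (\<Sum>b\<in>Basis. norm h * (C b * norm h))"
      unfolding abs_mult
    proof (intro sum_mono mult_mono)
      fix b :: 'a assume b: "b \<in> Basis"
      have "\<bar>?D b (z + \<xi> *\<^sub>R h) - ?D b z\<bar> \<le> C b * norm (\<xi> *\<^sub>R h)"
        using C(2)[OF b, of "z + \<xi> *\<^sub>R h" z] by simp
      also have "\<dots> \<le> C b * norm h"
        using \<xi> C(1)[OF b] by (intro mult_left_mono) (auto intro: mult_left_le_one_le)
      finally show "\<bar>?D b (z + \<xi> *\<^sub>R h) - ?D b z\<bar> \<le> C b * norm h" .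
    qed (auto simp: Basis_le_norm)
    finally show ?thesis unfolding sum_distrib_right by (simp add: power2_eq_square mult_ac)
  qed
  then show ?thesis using C(1) that[of "\<Sum>b\<in>Basis. C b"] by (simp add: sum_nonneg)
qed

section \<open>Differentiation of convolutions\<close>

lemma smooth_bounded_support_measurable:
  "smooth_bounded_support f \<Longrightarrow> f \<in> borel_measurable borel"
  by (intro borel_measurable_continuous_onI smooth_bounded_support_continuous)

lemma smooth_bounded_support_convolution_integrable:
  assumes f: "smooth_bounded_support f" and w: "integrable lborel (w :: 'a::euclidean_space \<Rightarrow> real)"
  shows "integrable lborel (\<lambda>y. f (x - y) * w y)"
proof -
  have [measurable]: "f \<in> borel_measurable borel" "w \<in> borel_measurable borel"
    using smooth_bounded_support_measurable[OF f] w by auto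
  obtain B where B: "0 \<le> B" "\<And>x. \<bar>f x\<bar> \<le> B" using smooth_bounded_support_bounded[OF f] by blast
  show ?thesis
    by (rule Bochner_Integration.integrable_bound[of _ "\<lambda>y. B * w y"])
      (use w B in \<open>auto simp: abs_mult intro!: mult_right_mono\<close>)
qed

text \<open>Derivatives fall on the kernel \<open>f\<close>, so integrability of \<open>w\<close> is
  enough. The induction ranges over all kernels because each step replaces \<open>f\<close> by a
  partial derivative.\<close>

lemma convolution_times_cont_diff:
  assumes f: "smooth_bounded_support f" and w: "integrable lborel (w :: 'a::euclidean_space \<Rightarrow> real)"
  shows "times_cont_diff k (\<lambda>x. \<integral>y. f (x - y) * w y \<partial>lborel)"
  using f
proof (induction k arbitrary: f)
  case 0
  note conv = smooth_bounded_support_convolution_integrable[OF 0 w]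
  obtain B where B: "0 \<le> B" "\<And>x y. \<bar>f x - f y\<bar> \<le> B * norm (x - y)"
    using smooth_bounded_support_lipschitz[OF 0] by blast
  let ?C = "B * (\<integral>y. \<bar>w y\<bar> \<partial>lborel)"
  have "?C-lipschitz_on UNIV (\<lambda>x. \<integral>y. f (x - y) * w y \<partial>lborel)"
  proof (rule lipschitz_onI)
    fix x x' :: 'a
    have "\<bar>(\<integral>y. f (x - y) * w y \<partial>lborel) - (\<integral>y. f (x' - y) * w y \<partial>lborel)\<bar>
      = \<bar>\<integral>y. f (x - y) * w y - f (x' - y) * w y \<partial>lborel\<bar>"
      using conv[of x] conv[of x'] by simp
    also have "\<dots> \<le> (\<integral>y. \<bar>f (x - y) * w y - f (x' - y) * w y\<bar> \<partial>lborel)"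
      by (rule integral_abs_bound)
    also have "\<dots> \<le> (\<integral>y. B * norm (x - x') * \<bar>w y\<bar> \<partial>lborel)"
    proof (rule integral_mono)
      show "integrable lborel (\<lambda>y. \<bar>f (x - y) * w y - f (x' - y) * w y\<bar>)"
        using conv[of x] conv[of x'] by auto
      show "\<bar>f (x - y) * w y - f (x' - y) * w y\<bar> \<le> B * norm (x - x') * \<bar>w y\<bar>" for y
      proof -
        have "\<bar>f (x - y) - f (x' - y)\<bar> * \<bar>w y\<bar> \<le> B * norm (x - x') * \<bar>w y\<bar>"
          using B(2)[of "x - y" "x' - y"] by (intro mult_right_mono) auto
        then show ?thesis by (simp add: abs_mult[symmetric] left_diff_distrib)
      qed
    qed (use w in auto)
    finally show "dist (\<integral>y. f (x - y) * w y \<partial>lborel) (\<integral>y. f (x' - y) * w y \<partial>lborel) \<le> ?C * dist x x'"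
      by (simp add: dist_norm mult_ac)
  qed (use B in auto)
  then show ?case using lipschitz_on_continuous_on by auto
next
  case (Suc k)
  note f = Suc.prems
  note conv = smooth_bounded_support_convolution_integrable[OF f w]
  let ?D = "\<lambda>b x. frechet_derivative f (at x) b"
  have Dconv: "integrable lborel (\<lambda>y. ?D b (x - y) * w y)" if "b \<in> Basis" for b x
    using smooth_bounded_support_convolution_integrable[OF smooth_bounded_support_partial[OF f that] w] .
  obtain B where B: "0 \<le> B"
    "\<And>z h. \<bar>f (z + h) - f z - frechet_derivative f (at z) h\<bar> \<le> B * (norm h)\<^sup>2"
    using smooth_bounded_support_taylor[OF f] by blast
  let ?F = "\<lambda>x. \<integral>y. f (x - y) * w y \<partial>lborel"
  let ?F' = "\<lambda>x h. \<Sum>b\<in>Basis. (h \<bullet> b) * (\<integral>y. ?D b (x - y) * w y \<partial>lborel)"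
  let ?C = "B * (\<integral>y. \<bar>w y\<bar> \<partial>lborel)"
  have C: "0 \<le> ?C" using B by (simp add: integral_nonneg_AE)
  show ?case
  proof (rule times_cont_diff_SucI[where f' = ?F'])
    fix x
    have bl: "bounded_linear (?F' x)"
      by (intro bounded_linear_sum bounded_linear_mult_const bounded_linear_inner_left)
    \<comment> \<open>The uniform Taylor remainder integrates against \<open>w\<close> to a multiple
      of \<open>(norm h)\<^sup>2\<close>, which is of smaller order than
      \<open>norm h\<close>.\<close>
    have est: "norm (?F (x + h) - ?F x - ?F' x h) \<le> ?C * (norm h)\<^sup>2" for h
    proof -
      have s: "integrable lborel (\<lambda>y. frechet_derivative f (at (x - y)) h * w y)"
        and s': "(\<integral>y. frechet_derivative f (at (x - y)) h * w y \<partial>lborel) = ?F' x h"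
      proof -
        have e: "frechet_derivative f (at (x - y)) h * w y = (\<Sum>b\<in>Basis. (h \<bullet> b) * (?D b (x - y) * w y))" for y
          using has_derivative_components[OF smooth_bounded_support_has_derivative[OF f], of "x - y" h]
          by (simp add: sum_distrib_right mult.assoc)
        show "integrable lborel (\<lambda>y. frechet_derivative f (at (x - y)) h * w y)"
          unfolding e by (intro Bochner_Integration.integrable_sum integrable_mult_right Dconv)
        show "(\<integral>y. frechet_derivative f (at (x - y)) h * w y \<partial>lborel) = ?F' x h"
          unfolding e by (subst Bochner_Integration.integral_sum) (auto intro!: Dconv)
      qed
      have e: "?F (x + h) - ?F x - ?F' x h
        = (\<integral>y. f (x + h - y) * w y - f (x - y) * w y - frechet_derivative f (at (x - y)) h * w y \<partial>lborel)"
        unfolding s'[symmetric] using conv[of "x + h"] conv[of x] s by simp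
      have "norm (?F (x + h) - ?F x - ?F' x h) \<le> (\<integral>y. \<bar>f (x + h - y) * w y - f (x - y) * w y - frechet_derivative f (at (x - y)) h * w y\<bar> \<partial>lborel)"
        unfolding e real_norm_def by (rule integral_abs_bound)
      also have "\<dots> \<le> (\<integral>y. B * (norm h)\<^sup>2 * \<bar>w y\<bar> \<partial>lborel)"
      proof (rule integral_mono)
        show "integrable lborel (\<lambda>y. \<bar>f (x + h - y) * w y - f (x - y) * w y - frechet_derivative f (at (x - y)) h * w y\<bar>)"
          by (intro integrable_abs Bochner_Integration.integrable_diff conv s)
        fix y
        have "f (x + h - y) * w y - f (x - y) * w y - frechet_derivative f (at (x - y)) h * w y
          = (f ((x - y) + h) - f (x - y) - frechet_derivative f (at (x - y)) h) * w y"
          by (simp only: left_diff_distrib add_diff_eq diff_add_eq)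
        then show "\<bar>f (x + h - y) * w y - f (x - y) * w y - frechet_derivative f (at (x - y)) h * w y\<bar> \<le> B * (norm h)\<^sup>2 * \<bar>w y\<bar>"
          by (simp only: abs_mult) (intro mult_right_mono B(2) abs_ge_zero)
      qed (use w in auto)
      finally show ?thesis by (simp add: mult_ac)
    qed
    show "(?F has_derivative ?F' x) (at x)"
      unfolding has_derivative_at
    proof (intro conjI bl)
      show "(\<lambda>h. norm (?F (x + h) - ?F x - ?F' x h) / norm h) \<midarrow>0\<rightarrow> 0"
      proof (rule Lim_null_comparison)
        show "\<forall>\<^sub>F h in at 0. norm (norm (?F (x + h) - ?F x - ?F' x h) / norm h) \<le> ?C * norm h"
        proof (rule always_eventually, rule allI)
          fix h
          show "norm (norm (?F (x + h) - ?F x - ?F' x h) / norm h) \<le> ?C * norm h"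
            using est[of h] by (cases "h = 0") (auto simp: divide_le_eq power2_eq_square mult.assoc)
        qed
        show "((\<lambda>h. ?C * norm h) \<longlongrightarrow> 0) (at (0::'a))"
          by (auto intro!: tendsto_eq_intros)
      qed
    qed
  next
    fix b :: 'a assume b: "b \<in> Basis"
    have "?F' x b = (\<integral>y. ?D b (x - y) * w y \<partial>lborel)" for x
      using b by (simp add: inner_Basis if_distrib[of "\<lambda>c. c * _"] cong: if_cong)
    then show "times_cont_diff k (\<lambda>x. ?F' x b)"
      using Suc.IH[OF smooth_bounded_support_partial[OF f b]] by simp
  qed
qed

text \<open>The centre \<open>a\<close> need not be the origin, so that mollification can also shift.\<close>

definition mollifier :: "'a::euclidean_space \<Rightarrow> real \<Rightarrow> 'a \<Rightarrow> real" where
  "mollifier a r x = bump a r x / (\<integral>y. bump a r y \<partial>lborel)"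

lemma bump_smooth:
  fixes a :: "'a::euclidean_space"
  assumes "0 < r"
  shows "smooth_bounded_support (bump a r)"
  unfolding smooth_bounded_support_def
proof (intro conjI allI exI impI)
  fix x :: 'a assume "norm a + r < norm x"
  then have "x \<notin> ball a r"
    using norm_triangle_sub[of x a] by (auto simp: dist_norm norm_minus_commute)
  then show "bump a r x = 0" using bump_eq_0_iff[OF assms] by blast
qed (rule bump_times_cont_diff)

lemma bump_integrable: "0 < r \<Longrightarrow> integrable lborel (bump a r)"
proof -
  assume r: "0 < r"
  have "integrable lborel (\<lambda>x. indicator (cball a r) x *\<^sub>R bump a r x)"
    by (intro borel_integrable_compact compact_cball smooth_bounded_support_continuous bump_smooth r)
  also have "(\<lambda>x. indicator (cball a r) x *\<^sub>R bump a r x) = bump a r"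
    using bump_eq_0_iff[OF r, of a] by (auto simp: indicator_def fun_eq_iff)
  finally show ?thesis .
qed

lemma bump_integral_pos:
  assumes r: "0 < r"
  shows "0 < (\<integral>x. bump a r x \<partial>lborel)"
proof (rule ccontr)
  assume "\<not> ?thesis"
  moreover have "0 \<le> (\<integral>x. bump a r x \<partial>lborel)"
    by (intro integral_nonneg_AE always_eventually allI bump_nonneg)
  ultimately have "(\<integral>x. bump a r x \<partial>lborel) = 0" by linarith
  then have "AE x in lborel. bump a r x = 0"
    using integral_nonneg_eq_0_iff_AE[OF bump_integrable[OF r], of a] bump_nonneg[of a r] by simp
  then have "AE x in lborel. x \<notin> ball a r"
    unfolding bump_eq_0_iff[OF r] .
  then have "ball a r \<in> null_sets lborel" by (subst AE_iff_null_sets) auto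
  then show False using content_ball_pos[OF r, of a] by (simp add: null_sets_def measure_def)
qed

lemma mollifier_nonneg: "0 < r \<Longrightarrow> 0 \<le> mollifier a r x"
  by (simp add: mollifier_def less_imp_le bump_nonneg bump_integral_pos)

lemma mollifier_integrable: "0 < r \<Longrightarrow> integrable lborel (mollifier a r)"
  unfolding mollifier_def[abs_def] by (intro integrable_divide bump_integrable)

lemma mollifier_integral: "0 < r \<Longrightarrow> (\<integral>x. mollifier a r x \<partial>lborel) = 1"
  using bump_integral_pos[of r a] by (simp add: mollifier_def)

lemma mollifier_eq_0: "0 < r \<Longrightarrow> x \<notin> cball a r \<Longrightarrow> mollifier a r x = 0"
  using bump_eq_0_iff[of r a x] by (simp add: mollifier_def)

lemma mollifier_smooth: "0 < r \<Longrightarrow> smooth_bounded_support (mollifier a r)"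
proof -
  assume r: "0 < r"
  have e: "mollifier a r = (\<lambda>x. inverse (\<integral>y. bump a r y \<partial>lborel) * bump a r x)"
    by (rule ext) (simp add: mollifier_def divide_inverse mult.commute)
  have "times_cont_diff k (mollifier a r)" for k
    unfolding e by (intro times_cont_diff_mult times_cont_diff_const bump_times_cont_diff)
  moreover obtain R where "\<And>x. R < norm x \<Longrightarrow> bump a r x = 0"
    using bump_smooth[OF r, of a] unfolding smooth_bounded_support_def by blast
  ultimately show ?thesis
    unfolding smooth_bounded_support_def by (intro conjI allI exI[of _ R] impI) (simp_all add: e)
qed

section \<open>Mollification as a convolution\<close>

lemma lborel_integral_reflect:
  fixes f :: "'a::euclidean_space \<Rightarrow> real"
  assumes [measurable]: "f \<in> borel_measurable borel"
  shows "(\<integral>h. f (x - h) \<partial>lborel) = (\<integral>y. f y \<partial>lborel)"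
    "integrable lborel (\<lambda>h. f (x - h)) \<longleftrightarrow> integrable lborel f"
proof -
  have "lborel = density (distr lborel borel (\<lambda>h. x + (-1::real) *\<^sub>R h)) (\<lambda>_. \<bar>-1::real\<bar>^DIM('a))"
    by (rule lborel_affine) simp
  also have "\<dots> = distr lborel borel (\<lambda>h. x - h)" by (simp add: density_1)
  finally have e: "lborel = distr lborel borel (\<lambda>h. x - h)" .
  show "(\<integral>h. f (x - h) \<partial>lborel) = (\<integral>y. f y \<partial>lborel)"
    by (subst (2) e) (simp add: integral_distr)
  show "integrable lborel (\<lambda>h. f (x - h)) \<longleftrightarrow> integrable lborel f"
    by (subst (2) e) (simp add: integrable_distr_eq)
qed

definition mollify :: "'a::euclidean_space \<Rightarrow> real \<Rightarrow> ('a \<Rightarrow> real) \<Rightarrow> 'a \<Rightarrow> real" where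
  "mollify a r w x = (\<integral>h. mollifier a r h * w (x - h) \<partial>lborel)"

lemma
  fixes w :: "'a::euclidean_space \<Rightarrow> real"
  assumes r: "0 < r" and w: "integrable lborel w"
  shows mollify_integrable: "integrable lborel (\<lambda>h. mollifier a r h * w (x - h))"
    and mollify_times_cont_diff: "times_cont_diff k (mollify a r w)"
proof -
  note s = mollifier_smooth[OF r, of a]
  have [measurable]: "mollifier a r \<in> borel_measurable borel" "w \<in> borel_measurable borel"
    using smooth_bounded_support_measurable[OF s] w by auto
  show "integrable lborel (\<lambda>h. mollifier a r h * w (x - h))" for x
    using lborel_integral_reflect(2)[of "\<lambda>h. mollifier a r h * w (x - h)" x]
      smooth_bounded_support_convolution_integrable[OF s w, of x] by simp
  have "mollify a r w x = (\<integral>y. mollifier a r (x - y) * w y \<partial>lborel)" for x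
    unfolding mollify_def using lborel_integral_reflect(1)[of "\<lambda>h. mollifier a r h * w (x - h)" x] by simp
  then have "mollify a r w = (\<lambda>x. \<integral>y. mollifier a r (x - y) * w y \<partial>lborel)" by (rule ext)
  then show "times_cont_diff k (mollify a r w)"
    using convolution_times_cont_diff[OF s w, of k] by (simp only:)
qed

lemma mollify_nonneg:
  assumes "0 < r" "\<And>x. 0 \<le> w x" shows "0 \<le> mollify a r w x"
  unfolding mollify_def
  by (rule integral_nonneg_AE, rule AE_I2, rule mult_nonneg_nonneg[OF mollifier_nonneg[OF assms(1)] assms(2)])

lemma mollify_support:
  assumes "0 < r" "mollify a r w x \<noteq> 0"
  obtains h where "h \<in> cball a r" "w (x - h) \<noteq> 0"
proof -
  have "\<exists>h. mollifier a r h * w (x - h) \<noteq> 0"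
  proof (rule ccontr)
    assume "\<not> ?thesis"
    then have "mollifier a r h * w (x - h) = 0" for h by blast
    then have "mollify a r w x = 0" unfolding mollify_def by (simp only: Bochner_Integration.integral_zero)
    with assms(2) show False ..
  qed
  then obtain h where "mollifier a r h \<noteq> 0" "w (x - h) \<noteq> 0" by auto
  with mollifier_eq_0[OF assms(1), of h a] show ?thesis by (intro that[of h]) auto
qed

section \<open>Translations in the mean\<close>

lemma nn_integral_translate:
  fixes h :: "'a::euclidean_space"
  assumes [measurable]: "f \<in> borel_measurable borel"
  shows "(\<integral>\<^sup>+x. f (x - h) \<partial>lborel) = (\<integral>\<^sup>+x. f x \<partial>lborel)"
proof -
  have "(\<integral>\<^sup>+x. f x \<partial>lborel) = (\<integral>\<^sup>+x. f x \<partial>distr lborel borel ((+) (- h)))"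
    by (simp only: lborel_distr_plus)
  also have "\<dots> = (\<integral>\<^sup>+x. f (x - h) \<partial>lborel)" by (subst nn_integral_distr) auto
  finally show ?thesis by simp
qed

definition L1_translation_continuous :: "('a::euclidean_space \<Rightarrow> real) \<Rightarrow> bool" where
  "L1_translation_continuous f \<longleftrightarrow>
    (\<forall>e>0. \<exists>d>0. \<forall>h. norm h < d \<longrightarrow> (\<integral>\<^sup>+x. ennreal \<bar>f (x - h) - f x\<bar> \<partial>lborel) \<le> ennreal e)"

text \<open>By translation invariance the two outer terms of the triangle inequality are the same
  \<open>L1\<close> distance, so the property passes to limits in the mean.\<close>

lemma L1_translation_continuous_approx:
  fixes f :: "'a::euclidean_space \<Rightarrow> real"
  assumes [measurable]: "f \<in> borel_measurable borel"
    and ap: "\<And>e. 0 < e \<Longrightarrow> \<exists>g\<in>borel_measurable borel. L1_translation_continuous g \<and>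
      (\<integral>\<^sup>+x. ennreal \<bar>f x - g x\<bar> \<partial>lborel) \<le> ennreal e"
  shows "L1_translation_continuous f"
  unfolding L1_translation_continuous_def
proof (intro allI impI)
  fix e :: real assume e: "0 < e"
  obtain g where [measurable]: "g \<in> borel_measurable borel" and g: "L1_translation_continuous g"
    and fg: "(\<integral>\<^sup>+x. ennreal \<bar>f x - g x\<bar> \<partial>lborel) \<le> ennreal (e/3)"
    using ap[of "e/3"] e by auto
  obtain d where d: "0 < d" "\<And>h. norm h < d \<Longrightarrow> (\<integral>\<^sup>+x. ennreal \<bar>g (x - h) - g x\<bar> \<partial>lborel) \<le> ennreal (e/3)"
    using g e unfolding L1_translation_continuous_def by (metis divide_pos_pos zero_less_numeral)
  have "(\<integral>\<^sup>+x. ennreal \<bar>f (x - h) - f x\<bar> \<partial>lborel) \<le> ennreal e" if h: "norm h < d" for h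
  proof -
    have "(\<integral>\<^sup>+x. ennreal \<bar>f (x - h) - f x\<bar> \<partial>lborel)
      \<le> (\<integral>\<^sup>+x. (ennreal \<bar>f (x - h) - g (x - h)\<bar> + ennreal \<bar>g (x - h) - g x\<bar>) + ennreal \<bar>f x - g x\<bar> \<partial>lborel)"
      by (intro nn_integral_mono) (simp flip: ennreal_plus)
    also have "\<dots> = (\<integral>\<^sup>+x. ennreal \<bar>f (x - h) - g (x - h)\<bar> \<partial>lborel) + (\<integral>\<^sup>+x. ennreal \<bar>g (x - h) - g x\<bar> \<partial>lborel)
        + (\<integral>\<^sup>+x. ennreal \<bar>f x - g x\<bar> \<partial>lborel)"
      by (simp add: nn_integral_add)
    also have "(\<integral>\<^sup>+x. ennreal \<bar>f (x - h) - g (x - h)\<bar> \<partial>lborel) = (\<integral>\<^sup>+x. ennreal \<bar>f x - g x\<bar> \<partial>lborel)"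
      by (rule nn_integral_translate[of "\<lambda>x. ennreal \<bar>f x - g x\<bar>"]) measurable
    also have "\<dots> + (\<integral>\<^sup>+x. ennreal \<bar>g (x - h) - g x\<bar> \<partial>lborel) + (\<integral>\<^sup>+x. ennreal \<bar>f x - g x\<bar> \<partial>lborel)
      \<le> ennreal (e/3) + ennreal (e/3) + ennreal (e/3)"
      by (intro add_mono fg d h)
    also have "\<dots> = ennreal e" using e by (simp flip: ennreal_plus)
    finally show ?thesis .
  qed
  with d(1) show "\<exists>d>0. \<forall>h. norm h < d \<longrightarrow> (\<integral>\<^sup>+x. ennreal \<bar>f (x - h) - f x\<bar> \<partial>lborel) \<le> ennreal e" by blast
qed

text \<open>A point of an open set stays in it under small translations, so the measure
  \<open>S h\<close> of the points of \<open>U\<close> that are moved out of it tends to zero by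
  dominated convergence. The symmetric difference of \<open>U\<close> and its translate is made up
  of \<open>S h\<close> and \<open>S (- h)\<close>.\<close>

lemma L1_translation_continuous_open:
  fixes U :: "'a::euclidean_space set"
  assumes U: "open U" and fin: "emeasure lborel U < \<infinity>"
  shows "L1_translation_continuous (indicator U)"
proof -
  have [measurable]: "U \<in> sets borel" using U by simp
  define S where "S h = (\<integral>\<^sup>+x. ennreal (indicator U x * (1 - indicator U (x - h))) \<partial>lborel)" for h :: 'a
  have S0: "\<exists>d>0. \<forall>h. norm h < d \<longrightarrow> S h \<le> ennreal e" if e: "0 < e" for e
  proof (rule ccontr)
    assume neg: "\<not> ?thesis"
    have "\<exists>h. norm h < inverse (real (Suc n)) \<and> \<not> S h \<le> ennreal e" for n
    proof -
      have "0 < inverse (real (Suc n))" by simp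
      with neg show ?thesis by blast
    qed
    then obtain h where h: "\<And>n. norm (h n) < inverse (real (Suc n))" "\<And>n. \<not> S (h n) \<le> ennreal e" by metis
    have h0: "h \<longlonglongrightarrow> 0"
      by (rule Lim_null_comparison[OF _ LIMSEQ_inverse_real_of_nat], rule always_eventually)
        (use h(1) less_imp_le in blast)
    have "(\<lambda>n. S (h n)) \<longlonglongrightarrow> (\<integral>\<^sup>+x. 0 \<partial>(lborel :: 'a measure))"
      unfolding S_def
    proof (rule nn_integral_dominated_convergence[where w = "indicator U"])
      show "AE x in lborel. (\<lambda>n. ennreal (indicator U x * (1 - indicator U (x - h n)))) \<longlonglongrightarrow> 0"
      proof (rule AE_I2)
        fix x
        show "(\<lambda>n. ennreal (indicator U x * (1 - indicator U (x - h n)))) \<longlonglongrightarrow> 0"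
        proof (cases "x \<in> U")
          case True
          have "(\<lambda>n. x - h n) \<longlonglongrightarrow> x - 0" by (intro tendsto_intros h0)
          then have "\<forall>\<^sub>F n in sequentially. x - h n \<in> U" using U True by (auto dest: topological_tendstoD)
          then have "\<forall>\<^sub>F n in sequentially. 0 = ennreal (indicator U x * (1 - indicator U (x - h n)))"
            by eventually_elim simp
          then show ?thesis by (rule Lim_transform_eventually[OF tendsto_const])
        qed simp
      qed
      show "AE x in lborel. ennreal (indicator U x * (1 - indicator U (x - h n))) \<le> indicator U x" for n
        by (rule AE_I2) (simp add: indicator_def)
      show "(\<integral>\<^sup>+ x. indicator U x \<partial>lborel) < \<infinity>" using fin by simp
    qed measurable
    then have "(\<lambda>n. S (h n)) \<longlonglongrightarrow> 0" by simp
    then have "\<forall>\<^sub>F n in sequentially. S (h n) < ennreal e" using e by (intro order_tendstoD(2)) auto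
    then obtain n where "S (h n) < ennreal e" unfolding eventually_sequentially by blast
    with h(2)[of n] show False by simp
  qed
  have T: "(\<integral>\<^sup>+x. ennreal \<bar>indicator U (x - h) - indicator U x\<bar> \<partial>lborel) = S h + S (- h)" for h
  proof -
    have "(\<integral>\<^sup>+x. ennreal \<bar>indicator U (x - h) - indicator U x\<bar> \<partial>lborel)
      = (\<integral>\<^sup>+x. ennreal (indicator U x * (1 - indicator U (x - h))) + ennreal (indicator U (x - h) * (1 - indicator U (x - h - (- h)))) \<partial>lborel)"
      by (intro nn_integral_cong) (auto simp: indicator_def)
    also have "\<dots> = S h + (\<integral>\<^sup>+x. ennreal (indicator U (x - h) * (1 - indicator U (x - h - (- h)))) \<partial>lborel)"
      unfolding S_def by (rule nn_integral_add) measurable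
    also have "(\<integral>\<^sup>+x. ennreal (indicator U (x - h) * (1 - indicator U (x - h - (- h)))) \<partial>lborel) = S (- h)"
      unfolding S_def by (rule nn_integral_translate[of "\<lambda>x. ennreal (indicator U x * (1 - indicator U (x - (- h))))"]) measurable
    finally show ?thesis .
  qed
  show ?thesis
    unfolding L1_translation_continuous_def
  proof (intro allI impI)
    fix e :: real assume e: "0 < e"
    then obtain d where d: "0 < d" "\<And>h. norm h < d \<Longrightarrow> S h \<le> ennreal (e/2)" using S0[of "e/2"] by auto
    have "(\<integral>\<^sup>+x. ennreal \<bar>indicator U (x - h) - indicator U x\<bar> \<partial>lborel) \<le> ennreal e" if "norm h < d" for h
    proof -
      have "S h + S (- h) \<le> ennreal (e/2) + ennreal (e/2)" using that by (intro add_mono d(2)) auto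
      also have "\<dots> = ennreal e" using e by (simp flip: ennreal_plus)
      finally show ?thesis unfolding T .
    qed
    with d(1) show "\<exists>d>0. \<forall>h. norm h < d \<longrightarrow> (\<integral>\<^sup>+x. ennreal \<bar>indicator U (x - h) - indicator U x\<bar> \<partial>lborel) \<le> ennreal e" by blast
  qed
qed

lemma L1_translation_continuous_scale:
  assumes "L1_translation_continuous f" and [measurable]: "f \<in> borel_measurable borel"
  shows "L1_translation_continuous (\<lambda>x. f x * c)"
  unfolding L1_translation_continuous_def
proof (intro allI impI)
  fix e :: real assume e: "0 < e"
  then have "0 < e / (\<bar>c\<bar> + 1)" by simp
  then obtain d where d: "0 < d" "\<And>h. norm h < d \<Longrightarrow> (\<integral>\<^sup>+x. ennreal \<bar>f (x - h) - f x\<bar> \<partial>lborel) \<le> ennreal (e / (\<bar>c\<bar> + 1))"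
    using assms unfolding L1_translation_continuous_def by blast
  have "(\<integral>\<^sup>+x. ennreal \<bar>f (x - h) * c - f x * c\<bar> \<partial>lborel) \<le> ennreal e" if "norm h < d" for h
  proof -
    have "(\<integral>\<^sup>+x. ennreal \<bar>f (x - h) * c - f x * c\<bar> \<partial>lborel) = (\<integral>\<^sup>+x. ennreal \<bar>c\<bar> * ennreal \<bar>f (x - h) - f x\<bar> \<partial>lborel)"
      by (intro nn_integral_cong) (simp add: ennreal_mult[symmetric] abs_mult[symmetric] algebra_simps)
    also have "\<dots> = ennreal \<bar>c\<bar> * (\<integral>\<^sup>+x. ennreal \<bar>f (x - h) - f x\<bar> \<partial>lborel)"
      by (rule nn_integral_cmult) measurable
    also have "\<dots> \<le> ennreal \<bar>c\<bar> * ennreal (e / (\<bar>c\<bar> + 1))"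
      by (intro mult_left_mono d that) auto
    also have "\<dots> \<le> ennreal e"
      using e by (simp add: ennreal_mult[symmetric] field_simps)
    finally show ?thesis .
  qed
  with d(1) show "\<exists>d>0. \<forall>h. norm h < d \<longrightarrow> (\<integral>\<^sup>+x. ennreal \<bar>f (x - h) * c - f x * c\<bar> \<partial>lborel) \<le> ennreal e" by blast
qed

lemma L1_translation_continuous_add:
  assumes f: "L1_translation_continuous f" and g: "L1_translation_continuous g"
    and [measurable]: "f \<in> borel_measurable borel" "g \<in> borel_measurable borel"
  shows "L1_translation_continuous (\<lambda>x. f x + g x)"
  unfolding L1_translation_continuous_def
proof (intro allI impI)
  fix e :: real assume e: "0 < e"
  then have e2: "0 < e/2" by simp
  obtain d where d: "0 < d" "\<And>h. norm h < d \<Longrightarrow> (\<integral>\<^sup>+x. ennreal \<bar>f (x - h) - f x\<bar> \<partial>lborel) \<le> ennreal (e/2)"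
    using f e2 unfolding L1_translation_continuous_def by blast
  obtain d' where d': "0 < d'" "\<And>h. norm h < d' \<Longrightarrow> (\<integral>\<^sup>+x. ennreal \<bar>g (x - h) - g x\<bar> \<partial>lborel) \<le> ennreal (e/2)"
    using g e2 unfolding L1_translation_continuous_def by blast
  have "(\<integral>\<^sup>+x. ennreal \<bar>f (x - h) + g (x - h) - (f x + g x)\<bar> \<partial>lborel) \<le> ennreal e" if "norm h < min d d'" for h
  proof -
    have "(\<integral>\<^sup>+x. ennreal \<bar>f (x - h) + g (x - h) - (f x + g x)\<bar> \<partial>lborel)
      \<le> (\<integral>\<^sup>+x. ennreal \<bar>f (x - h) - f x\<bar> + ennreal \<bar>g (x - h) - g x\<bar> \<partial>lborel)"
      by (intro nn_integral_mono) (simp flip: ennreal_plus)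
    also have "\<dots> = (\<integral>\<^sup>+x. ennreal \<bar>f (x - h) - f x\<bar> \<partial>lborel) + (\<integral>\<^sup>+x. ennreal \<bar>g (x - h) - g x\<bar> \<partial>lborel)"
      by (rule nn_integral_add) measurable
    also have "\<dots> \<le> ennreal (e/2) + ennreal (e/2)" using that by (intro add_mono d d') auto
    also have "\<dots> = ennreal e" using e by (simp flip: ennreal_plus)
    finally show ?thesis .
  qed
  with d(1) d'(1) show "\<exists>d>0. \<forall>h. norm h < d \<longrightarrow> (\<integral>\<^sup>+x. ennreal \<bar>f (x - h) + g (x - h) - (f x + g x)\<bar> \<partial>lborel) \<le> ennreal e"
    by (intro exI[of _ "min d d'"]) simp
qed

text \<open>Induction on integrable functions; indicators of Borel sets of finite measure are
  reached from open sets by outer regularity.\<close>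

lemma integrable_L1_translation_continuous:
  fixes f :: "'a::euclidean_space \<Rightarrow> real"
  assumes "integrable lborel f"
  shows "L1_translation_continuous f"
  using assms
proof (induction rule: integrable_induct)
  case (base A c)
  then have [measurable]: "A \<in> sets borel" by simp
  have "L1_translation_continuous (indicator A)"
  proof (rule L1_translation_continuous_approx)
    fix e :: real assume e: "0 < e"
    have "A \<in> sets lebesgue" by simp
    then obtain U where U: "open U" "A \<subseteq> U" "emeasure lebesgue (U - A) < ennreal e"
      using sets_lebesgue_outer_open[OF _ e] by blast
    have [measurable]: "U \<in> sets borel" using U by simp
    have UA: "emeasure lborel (U - A) < ennreal e" using U(3) by simp
    have "emeasure lborel U = emeasure lborel (A \<union> (U - A))" using U(2) by (simp add: Un_absorb1)
    also have "\<dots> \<le> emeasure lborel A + emeasure lborel (U - A)" by (rule emeasure_subadditive) auto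
    also have "\<dots> < \<infinity>" using base(2) UA by (auto simp: less_top[symmetric])
    finally have "L1_translation_continuous (indicator U :: 'a \<Rightarrow> real)"
      by (intro L1_translation_continuous_open U)
    moreover have "(\<integral>\<^sup>+x. ennreal \<bar>indicator A x - indicator U x\<bar> \<partial>lborel) \<le> ennreal e"
    proof -
      have "(\<integral>\<^sup>+x. ennreal \<bar>indicator A x - indicator U x\<bar> \<partial>lborel) = (\<integral>\<^sup>+x. indicator (U - A) x \<partial>lborel)"
        using U(2) by (intro nn_integral_cong) (auto simp: indicator_def)
      also have "\<dots> = emeasure lborel (U - A)" by simp
      finally show ?thesis using UA by simp
    qed
    ultimately show "\<exists>g\<in>borel_measurable borel. L1_translation_continuous g \<and>
      (\<integral>\<^sup>+x. ennreal \<bar>indicator A x - g x\<bar> \<partial>lborel) \<le> ennreal e"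
      by (intro bexI[of _ "indicator U"] conjI) auto
  qed simp
  then show ?case
    using L1_translation_continuous_scale[of "indicator A" c] by simp
next
  case (add f g)
  then show ?case by (intro L1_translation_continuous_add) auto
next
  case (lim f S)
  show ?case
  proof (rule L1_translation_continuous_approx)
    show fm [measurable]: "f \<in> borel_measurable borel" using borel_measurable_integrable[OF \<open>integrable lborel f\<close>] by simp
    have [measurable]: "S i \<in> borel_measurable borel" for i using lim.hyps(1)[of i] by auto
    fix e :: real assume e: "0 < e"
    have "(\<lambda>i. \<integral>\<^sup>+x. ennreal \<bar>f x - S i x\<bar> \<partial>lborel) \<longlonglongrightarrow> (\<integral>\<^sup>+x. 0 \<partial>(lborel :: 'a measure))"
    \<comment> \<open>The approximants of the induction rule satisfy
      \<open>\<bar>S i x\<bar> \<le> 2 * \<bar>f x\<bar>\<close>, whence the factor 3.\<close>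
    proof (rule nn_integral_dominated_convergence[where w = "\<lambda>x. ennreal (3 * \<bar>f x\<bar>)"])
      show "AE x in lborel. (\<lambda>i. ennreal \<bar>f x - S i x\<bar>) \<longlonglongrightarrow> 0"
      proof (rule AE_I2)
        fix x
        have "(\<lambda>i. \<bar>f x - S i x\<bar>) \<longlonglongrightarrow> \<bar>f x - f x\<bar>" by (intro tendsto_intros lim.hyps(2)) simp
        then show "(\<lambda>i. ennreal \<bar>f x - S i x\<bar>) \<longlonglongrightarrow> 0" using tendsto_ennrealI by fastforce
      qed
      show "AE x in lborel. ennreal \<bar>f x - S i x\<bar> \<le> ennreal (3 * \<bar>f x\<bar>)" for i
        using lim.hyps(3)[of _ i] by (intro AE_I2 ennreal_leI) (smt (verit) real_norm_def space_lborel UNIV_I)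
      have "integrable lborel (\<lambda>x. 3 * \<bar>f x\<bar>)" using \<open>integrable lborel f\<close> by auto
      then show "(\<integral>\<^sup>+x. ennreal (3 * \<bar>f x\<bar>) \<partial>lborel) < \<infinity>" by (subst nn_integral_eq_integral) auto
    qed measurable
    then have "\<forall>\<^sub>F i in sequentially. (\<integral>\<^sup>+x. ennreal \<bar>f x - S i x\<bar> \<partial>lborel) < ennreal e"
      using e by (intro order_tendstoD(2)) auto
    then obtain i where "(\<integral>\<^sup>+x. ennreal \<bar>f x - S i x\<bar> \<partial>lborel) < ennreal e"
      by (auto simp: eventually_sequentially)
    then show "\<exists>g\<in>borel_measurable borel. L1_translation_continuous g \<and>
      (\<integral>\<^sup>+x. ennreal \<bar>f x - g x\<bar> \<partial>lborel) \<le> ennreal e"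
      using lim.IH[of i] by (intro bexI[of _ "S i"] conjI) auto
  qed
qed

lemma mollify_measurable:
  assumes "0 < r" "integrable lborel w"
  shows "mollify a r w \<in> borel_measurable borel"
  using mollify_times_cont_diff[OF assms, of 0] by (auto intro: borel_measurable_continuous_onI)

text \<open>By Tonelli's theorem the \<open>L1\<close> distance between the mollification and
  \<open>w\<close> is at most an average of the distances between \<open>w\<close> and its
  translates by vectors of norm at most \<open>norm (a n) + r n\<close>. Convergence in the mean
  then yields a subsequence that converges almost everywhere.\<close>

lemma mollify_AE_subseq:
  fixes w :: "'a::euclidean_space \<Rightarrow> real"
  assumes w: "integrable lborel w" and r: "\<And>n. 0 < r n" and a0: "a \<longlonglongrightarrow> 0" and r0: "r \<longlonglongrightarrow> 0"
  obtains k :: "nat \<Rightarrow> nat" where "strict_mono k"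
    "AE x in lborel. (\<lambda>n. mollify (a (k n)) (r (k n)) w x) \<longlonglongrightarrow> w x"
proof -
  have [measurable]: "w \<in> borel_measurable borel" using w by auto
  have [measurable]: "mollifier (a n) (r n) \<in> borel_measurable borel" for n
    using smooth_bounded_support_measurable[OF mollifier_smooth[OF r]] .
  note [measurable] = mollify_measurable[OF r w]
  let ?I = "\<lambda>n. \<integral>\<^sup>+x. ennreal \<bar>mollify (a n) (r n) w x - w x\<bar> \<partial>lborel"
  have le: "\<forall>\<^sub>F n in sequentially. ?I n \<le> ennreal e" if e: "0 < e" for e
  proof -
    obtain d where d: "0 < d" "\<And>h. norm h < d \<Longrightarrow> (\<integral>\<^sup>+x. ennreal \<bar>w (x - h) - w x\<bar> \<partial>lborel) \<le> ennreal e"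
      using integrable_L1_translation_continuous[OF w] e unfolding L1_translation_continuous_def by blast
    have "(\<lambda>n. norm (a n) + r n) \<longlonglongrightarrow> norm (0::'a) + 0" by (intro tendsto_intros a0 r0)
    then have "\<forall>\<^sub>F n in sequentially. norm (a n) + r n < d" using d(1) by (intro order_tendstoD(2)) auto
    then show ?thesis
    proof eventually_elim
      case (elim n)
      have pt: "ennreal \<bar>mollify (a n) (r n) w x - w x\<bar>
        \<le> (\<integral>\<^sup>+h. ennreal (mollifier (a n) (r n) h * \<bar>w (x - h) - w x\<bar>) \<partial>lborel)" for x
      proof -
        note i1 = mollify_integrable[OF r[of n] w, of "a n" x]
        have i2: "integrable lborel (\<lambda>h. mollifier (a n) (r n) h * w x)"
          by (intro integrable_mult_left mollifier_integrable r)
        have i3: "integrable lborel (\<lambda>h. mollifier (a n) (r n) h * \<bar>w (x - h) - w x\<bar>)"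
        proof (rule Bochner_Integration.integrable_bound[OF integrable_abs[OF Bochner_Integration.integrable_diff[OF i1 i2]]])
          show "AE h in lborel. norm (mollifier (a n) (r n) h * \<bar>w (x - h) - w x\<bar>)
            \<le> norm \<bar>mollifier (a n) (r n) h * w (x - h) - mollifier (a n) (r n) h * w x\<bar>"
            by (rule AE_I2) (simp add: abs_mult flip: right_diff_distrib)
        qed measurable
        have "mollify (a n) (r n) w x - w x
          = (\<integral>h. mollifier (a n) (r n) h * w (x - h) - mollifier (a n) (r n) h * w x \<partial>lborel)"
          unfolding mollify_def using Bochner_Integration.integral_diff[OF i1 i2] mollifier_integral[OF r[of n], of "a n"]
          by simp
        then have "\<bar>mollify (a n) (r n) w x - w x\<bar>
          \<le> (\<integral>h. \<bar>mollifier (a n) (r n) h * w (x - h) - mollifier (a n) (r n) h * w x\<bar> \<partial>lborel)"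
          by (simp only: integral_abs_bound)
        also have "\<dots> = (\<integral>h. mollifier (a n) (r n) h * \<bar>w (x - h) - w x\<bar> \<partial>lborel)"
          by (intro Bochner_Integration.integral_cong refl)
            (simp add: abs_mult mollifier_nonneg[OF r] flip: right_diff_distrib)
        finally have "ennreal \<bar>mollify (a n) (r n) w x - w x\<bar>
          \<le> ennreal (\<integral>h. mollifier (a n) (r n) h * \<bar>w (x - h) - w x\<bar> \<partial>lborel)" by (rule ennreal_leI)
        also have "\<dots> = (\<integral>\<^sup>+h. ennreal (mollifier (a n) (r n) h * \<bar>w (x - h) - w x\<bar>) \<partial>lborel)"
          by (rule nn_integral_eq_integral[symmetric, OF i3]) (simp add: mollifier_nonneg[OF r])
        finally show ?thesis .
      qed
      have "?I n \<le> (\<integral>\<^sup>+x. (\<integral>\<^sup>+h. ennreal (mollifier (a n) (r n) h * \<bar>w (x - h) - w x\<bar>) \<partial>lborel) \<partial>lborel)"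
        by (intro nn_integral_mono pt)
      also have "\<dots> = (\<integral>\<^sup>+h. (\<integral>\<^sup>+x. ennreal (mollifier (a n) (r n) h * \<bar>w (x - h) - w x\<bar>) \<partial>lborel) \<partial>lborel)"
        by (rule lborel_pair.Fubini'[symmetric]) measurable
      also have "\<dots> = (\<integral>\<^sup>+h. ennreal (mollifier (a n) (r n) h) * (\<integral>\<^sup>+x. ennreal \<bar>w (x - h) - w x\<bar> \<partial>lborel) \<partial>lborel)"
        by (intro nn_integral_cong) (simp add: ennreal_mult mollifier_nonneg[OF r] nn_integral_cmult)
      also have "\<dots> \<le> (\<integral>\<^sup>+h. ennreal (mollifier (a n) (r n) h) * ennreal e \<partial>lborel)"
      proof (intro nn_integral_mono)
        fix h
        show "ennreal (mollifier (a n) (r n) h) * (\<integral>\<^sup>+x. ennreal \<bar>w (x - h) - w x\<bar> \<partial>lborel)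
          \<le> ennreal (mollifier (a n) (r n) h) * ennreal e"
        proof (cases "h \<in> cball (a n) (r n)")
          case True
          then have "norm h \<le> norm (a n) + r n"
            using norm_triangle_ineq2[of h "a n"] by (simp add: dist_norm norm_minus_commute)
          then have "norm h < d" using elim by simp
          then show ?thesis by (intro mult_left_mono d) auto
        next
          case False
          then show ?thesis by (simp add: mollifier_eq_0[OF r])
        qed
      qed
      also have "\<dots> = (\<integral>\<^sup>+h. ennreal (mollifier (a n) (r n) h) \<partial>lborel) * ennreal e"
        by (rule nn_integral_multc) measurable
      also have "(\<integral>\<^sup>+h. ennreal (mollifier (a n) (r n) h) \<partial>lborel) = 1"
        using nn_integral_eq_integral[OF mollifier_integrable[OF r[of n]], of "a n"]
          mollifier_nonneg[OF r[of n], of "a n"] mollifier_integral[OF r[of n], of "a n"]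
        by simp
      finally show "?I n \<le> ennreal e" by simp
    qed
  qed
  \<comment> \<open>Finitely many indices are discarded so that the mean distance is finite, and the
    difference \<open>u n\<close> integrable, for every \<open>n\<close>.\<close>
  obtain N where N: "\<And>n. N \<le> n \<Longrightarrow> ?I n \<le> ennreal 1"
    using le[of 1] by (auto simp: eventually_sequentially)
  define u where "u n x = mollify (a (n + N)) (r (n + N)) w x - w x" for n x
  have [measurable]: "u n \<in> borel_measurable borel" for n unfolding u_def by measurable
  have Iu: "(\<integral>\<^sup>+x. ennreal \<bar>u n x\<bar> \<partial>lborel) = ?I (n + N)" for n by (simp add: u_def)
  have iu: "integrable lborel (u n)" for n
    unfolding integrable_iff_bounded using N[of "n + N"] Iu[of n]
    by (auto simp: order_le_less_trans[OF _ ennreal_one_less_top])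
  have "(\<lambda>n. \<integral>x. norm (u n x) \<partial>lborel) \<longlonglongrightarrow> 0"
  proof (rule LIMSEQ_I)
    fix e :: real assume e: "0 < e"
    then obtain M where M: "\<And>n. M \<le> n \<Longrightarrow> ?I n \<le> ennreal (e/2)"
      using le[of "e/2"] by (auto simp: eventually_sequentially)
    have "norm ((\<integral>x. norm (u n x) \<partial>lborel) - 0) < e" if "M \<le> n" for n
    proof -
      have "ennreal (\<integral>x. norm (u n x) \<partial>lborel) = (\<integral>\<^sup>+x. ennreal \<bar>u n x\<bar> \<partial>lborel)"
        using nn_integral_eq_integral[OF integrable_norm[OF iu[of n]]] by simp
      also have "\<dots> \<le> ennreal (e/2)" unfolding Iu using that by (intro M) simp
      finally have "(\<integral>x. norm (u n x) \<partial>lborel) \<le> e/2" using e by (simp add: ennreal_le_iff)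
      then show ?thesis using e by (simp add: abs_of_nonneg[OF integral_nonneg_AE])
    qed
    then show "\<exists>M. \<forall>n\<ge>M. norm ((\<integral>x. norm (u n x) \<partial>lborel) - 0) < e" by blast
  qed
  then obtain k where k: "strict_mono k" "AE x in lborel. (\<lambda>n. u (k n) x) \<longlonglongrightarrow> 0"
    using tendsto_L1_AE_subseq[of lborel u] iu by blast
  show ?thesis
  proof (rule that[of "\<lambda>n. k n + N"])
    show "strict_mono (\<lambda>n. k n + N)" using k(1) by (simp add: strict_mono_def)
    show "AE x in lborel. (\<lambda>n. mollify (a (k n + N)) (r (k n + N)) w x) \<longlonglongrightarrow> w x"
      using k(2) by eventually_elim (simp add: u_def LIM_zero_iff)
  qed
qed

section \<open>The singular measure\<close>

text \<open>The restriction of \<open>frac_measure\<close> to the Borel sets, where Tonelli's theorem is available.\<close>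

definition frac_lborel :: "('a::euclidean_space \<times> 'a) measure" where
  "frac_lborel = density lborel (\<lambda>(x, y). ennreal (1 / norm (x - y) ^ DIM('a)))"

lemma sets_frac_lborel [measurable_cong, simp]: "sets frac_lborel = sets borel"
  by (simp add: frac_lborel_def)

lemma space_frac_lborel [simp]: "space frac_lborel = UNIV"
  by (simp add: frac_lborel_def)

lemma borel_measurable_fst' [measurable]:
  "fst \<in> borel_measurable (borel :: ('a::euclidean_space \<times> 'b::euclidean_space) measure)"
  by (intro borel_measurable_continuous_onI continuous_intros)

lemma borel_measurable_snd' [measurable]:
  "snd \<in> borel_measurable (borel :: ('a::euclidean_space \<times> 'b::euclidean_space) measure)"
  by (intro borel_measurable_continuous_onI continuous_intros)

lemma kernel_measurable [measurable]:
  "(\<lambda>(x::'a::euclidean_space, y). ennreal (1 / norm (x - y) ^ DIM('a))) \<in> borel_measurable borel"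
  unfolding split_beta by measurable

lemma measurable_lborel_pair:
  fixes f :: "'a::euclidean_space \<times> 'b::euclidean_space \<Rightarrow> ennreal"
  shows "f \<in> borel_measurable borel \<Longrightarrow> f \<in> borel_measurable (lborel \<Otimes>\<^sub>M lborel)"
  by (simp add: lborel_prod)

lemma nn_integral_lborel_pair:
  fixes f :: "'a::euclidean_space \<times> 'b::euclidean_space \<Rightarrow> ennreal"
  assumes [measurable]: "f \<in> borel_measurable borel"
  shows "(\<integral>\<^sup>+p. f p \<partial>lborel) = (\<integral>\<^sup>+x. \<integral>\<^sup>+y. f (x, y) \<partial>lborel \<partial>lborel)"
    "(\<integral>\<^sup>+p. f p \<partial>lborel) = (\<integral>\<^sup>+y. \<integral>\<^sup>+x. f (x, y) \<partial>lborel \<partial>lborel)"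
proof -
  show 1: "(\<integral>\<^sup>+p. f p \<partial>lborel) = (\<integral>\<^sup>+x. \<integral>\<^sup>+y. f (x, y) \<partial>lborel \<partial>lborel)"
    unfolding lborel_prod[symmetric]
    by (rule lborel.nn_integral_fst[symmetric]) (rule measurable_lborel_pair[OF assms])
  show "(\<integral>\<^sup>+p. f p \<partial>lborel) = (\<integral>\<^sup>+y. \<integral>\<^sup>+x. f (x, y) \<partial>lborel \<partial>lborel)"
    unfolding 1 using lborel_pair.Fubini[OF measurable_lborel_pair[OF assms]] by simp
qed

lemma nn_integral_frac_lborel:
  fixes f :: "'a::euclidean_space \<times> 'a \<Rightarrow> ennreal"
  assumes [measurable]: "f \<in> borel_measurable borel"
  shows "(\<integral>\<^sup>+p. f p \<partial>frac_lborel) = (\<integral>\<^sup>+x. \<integral>\<^sup>+y. ennreal (1 / norm (x - y) ^ DIM('a)) * f (x, y) \<partial>lborel \<partial>lborel)"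
    "(\<integral>\<^sup>+p. f p \<partial>frac_lborel) = (\<integral>\<^sup>+y. \<integral>\<^sup>+x. ennreal (1 / norm (x - y) ^ DIM('a)) * f (x, y) \<partial>lborel \<partial>lborel)"
proof -
  let ?k = "\<lambda>(x::'a, y). ennreal (1 / norm (x - y) ^ DIM('a))"
  have e: "(\<integral>\<^sup>+p. f p \<partial>frac_lborel) = (\<integral>\<^sup>+p. ?k p * f p \<partial>lborel)"
    unfolding frac_lborel_def by (rule nn_integral_density) auto
  have m: "(\<lambda>p. ?k p * f p) \<in> borel_measurable borel" by measurable
  show "(\<integral>\<^sup>+p. f p \<partial>frac_lborel) = (\<integral>\<^sup>+x. \<integral>\<^sup>+y. ennreal (1 / norm (x - y) ^ DIM('a)) * f (x, y) \<partial>lborel \<partial>lborel)"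
    unfolding e nn_integral_lborel_pair(1)[OF m] by simp
  show "(\<integral>\<^sup>+p. f p \<partial>frac_lborel) = (\<integral>\<^sup>+y. \<integral>\<^sup>+x. ennreal (1 / norm (x - y) ^ DIM('a)) * f (x, y) \<partial>lborel \<partial>lborel)"
    unfolding e nn_integral_lborel_pair(2)[OF m] by simp
qed

text \<open>The density depends on \<open>x - y\<close> alone, so it is preserved when both points
  move by the same \<open>h\<close>.\<close>

lemma nn_integral_frac_lborel_translate:
  fixes f :: "'a::euclidean_space \<times> 'a \<Rightarrow> ennreal"
  assumes [measurable]: "f \<in> borel_measurable borel"
  shows "(\<integral>\<^sup>+p. f (p - (h, h)) \<partial>frac_lborel) = (\<integral>\<^sup>+p. f p \<partial>frac_lborel)"
proof -
  let ?k = "\<lambda>(x::'a, y). ennreal (1 / norm (x - y) ^ DIM('a))"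
  have "(\<integral>\<^sup>+p. f (p - (h, h)) \<partial>frac_lborel) = (\<integral>\<^sup>+p. ?k p * f (p - (h, h)) \<partial>lborel)"
    unfolding frac_lborel_def by (rule nn_integral_density) auto
  also have "\<dots> = (\<integral>\<^sup>+p. ?k (p - (h, h)) * f (p - (h, h)) \<partial>lborel)"
    by (intro nn_integral_cong) (auto simp: split_beta)
  also have "\<dots> = (\<integral>\<^sup>+p. ?k p * f p \<partial>lborel)"
    by (rule nn_integral_translate[of "\<lambda>p. ?k p * f p"]) measurable
  also have "\<dots> = (\<integral>\<^sup>+p. f p \<partial>frac_lborel)"
    unfolding frac_lborel_def by (rule nn_integral_density[symmetric]) auto
  finally show ?thesis .
qed

lemma nn_integral_frac_lborel_swap:
  fixes f :: "'a::euclidean_space \<times> 'a \<Rightarrow> ennreal"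
  assumes [measurable]: "f \<in> borel_measurable borel"
  shows "(\<integral>\<^sup>+p. f (snd p, fst p) \<partial>frac_lborel) = (\<integral>\<^sup>+p. f p \<partial>frac_lborel)"
proof -
  have "(\<lambda>p. f (snd p, fst p)) \<in> borel_measurable borel"
    by (rule measurable_compose[OF _ assms]) (intro borel_measurable_continuous_onI continuous_intros)
  then have "(\<integral>\<^sup>+p. f (snd p, fst p) \<partial>frac_lborel)
    = (\<integral>\<^sup>+x. \<integral>\<^sup>+y. ennreal (1 / norm (x - y) ^ DIM('a)) * f (y, x) \<partial>lborel \<partial>lborel)"
    by (subst nn_integral_frac_lborel(1)) simp_all
  also have "\<dots> = (\<integral>\<^sup>+p. f p \<partial>frac_lborel)"
    by (subst nn_integral_frac_lborel(2)[OF assms]) (simp add: norm_minus_commute)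
  finally show ?thesis .
qed

text \<open>A null set \<open>N\<close> gives the null strips \<open>N \<times> UNIV\<close> and
  \<open>UNIV \<times> N\<close>, and the measure has a density with respect to
  \<open>lborel\<close>. Limits almost everywhere thereby pass to difference quotients.\<close>

lemma AE_frac_lborel:
  fixes Q :: "'a::euclidean_space \<Rightarrow> bool"
  assumes "AE x in lborel. Q x"
  shows "AE p in frac_lborel. Q (fst p) \<and> Q (snd p)"
proof -
  obtain N where N: "{x \<in> space lborel. \<not> Q x} \<subseteq> N" "emeasure lborel N = 0" "N \<in> sets lborel"
    using assms by (rule AE_E)
  have m: "N \<times> UNIV \<in> sets (lborel \<Otimes>\<^sub>M lborel)" "UNIV \<times> N \<in> sets (lborel \<Otimes>\<^sub>M lborel)"
    using N(3) by (auto intro!: pair_measureI)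
  have "emeasure (lborel \<Otimes>\<^sub>M lborel) (N \<times> (UNIV :: 'a set)) = 0"
    "emeasure (lborel \<Otimes>\<^sub>M lborel) ((UNIV :: 'a set) \<times> N) = 0"
    using N(2,3) by (auto simp: lborel.emeasure_pair_measure_Times)
  with m have z: "N \<times> (UNIV :: 'a set) \<in> null_sets lborel" "(UNIV :: 'a set) \<times> N \<in> null_sets lborel"
    unfolding null_sets_def lborel_prod by auto
  have "AE p in lborel. p \<notin> N \<times> (UNIV :: 'a set)" "AE p in lborel. p \<notin> (UNIV :: 'a set) \<times> N"
    using AE_not_in[OF z(1)] AE_not_in[OF z(2)] .
  then have "AE p in lborel. Q (fst p) \<and> Q (snd p)"
    by eventually_elim (use N(1) in auto)
  then show ?thesis
    unfolding frac_lborel_def by (subst AE_density) (auto elim: eventually_mono)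
qed

lemma sigma_finite_frac_lborel: "sigma_finite_measure (frac_lborel :: ('a::euclidean_space \<times> 'a) measure)"
  unfolding frac_lborel_def
  by (subst sigma_finite_measure.sigma_finite_iff_density_finite[OF lborel.sigma_finite_measure_axioms]) (auto simp: split_beta)

text \<open>The part of a difference quotient that comes from a bounded Lipschitz factor.\<close>

definition lip_kernel :: "real \<Rightarrow> 'a::euclidean_space \<Rightarrow> real" where
  "lip_kernel s h = min (norm h powr - s) (norm h powr (1 - s))"

lemma lip_kernel_measurable [measurable]: "lip_kernel s \<in> borel_measurable borel"
  unfolding lip_kernel_def[abs_def] by measurable

lemma lip_kernel_nonneg [simp]: "0 \<le> lip_kernel s h"
  by (simp add: lip_kernel_def)

lemma lip_kernel_le_1:
  assumes "0 < s" "s < 1" shows "lip_kernel s h \<le> 1"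
proof (cases "norm h \<le> 1")
  case True
  then have "norm h powr (1 - s) \<le> 1 powr (1 - s)" using assms by (intro powr_mono2) auto
  then show ?thesis by (simp add: lip_kernel_def)
next
  case False
  then have "norm h powr - s \<le> 1 powr - s" using assms by (intro powr_mono2') auto
  then show ?thesis by (simp add: lip_kernel_def)
qed

text \<open>The weight is homogeneous of degree \<open>- DIM('a)\<close>, so the bound does not
  depend on \<open>a\<close>. The ratio 4 instead of 2 leaves room for the closed outer edge of the
  small dyadic shells in the next lemma.\<close>

lemma nn_integral_shell_le:
  fixes a :: real
  assumes a: "0 < a"
  shows "(\<integral>\<^sup>+h. indicator {h. a \<le> norm h \<and> norm h < 4 * a} h * ennreal (1 / norm h ^ DIM('a)) \<partial>(lborel :: 'a::euclidean_space measure))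
    \<le> ennreal (4 ^ DIM('a) * measure lborel (ball (0::'a) 1))"
proof -
  have "(\<integral>\<^sup>+h. indicator {h. a \<le> norm h \<and> norm h < 4 * a} h * ennreal (1 / norm h ^ DIM('a)) \<partial>(lborel :: 'a measure))
    \<le> (\<integral>\<^sup>+h. ennreal (1 / a ^ DIM('a)) * indicator (ball 0 (4 * a)) h \<partial>(lborel :: 'a measure))"
  proof (intro nn_integral_mono)
    fix h :: 'a
    show "indicator {h. a \<le> norm h \<and> norm h < 4 * a} h * ennreal (1 / norm h ^ DIM('a))
      \<le> ennreal (1 / a ^ DIM('a)) * indicator (ball 0 (4 * a)) h"
    proof (cases "a \<le> norm h \<and> norm h < 4 * a")
      case True
      then have "1 / norm h ^ DIM('a) \<le> 1 / a ^ DIM('a)"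
        using a by (intro divide_left_mono power_mono mult_pos_pos zero_less_power) auto
      then show ?thesis using True by (simp add: ennreal_leI)
    qed simp
  qed
  also have "\<dots> = ennreal (1 / a ^ DIM('a)) * emeasure lborel (ball (0::'a) (4 * a))"
    by (rule nn_integral_cmult_indicator) simp
  also have "emeasure lborel (ball (0::'a) (4 * a)) = ennreal (measure lborel (ball (0::'a) (4 * a)))"
    by (rule emeasure_eq_ennreal_measure) (use emeasure_lborel_ball_finite[of "0::'a" "4 * a"] in auto)
  also have "measure lborel (ball (0::'a) (4 * a)) = (4 * a) ^ DIM('a) * measure lborel (ball (0::'a) 1)"
    using a by (intro content_ball_conv_unit_ball) simp
  also have "ennreal (1 / a ^ DIM('a)) * ennreal ((4 * a) ^ DIM('a) * measure lborel (ball (0::'a) 1))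
    = ennreal (4 ^ DIM('a) * measure lborel (ball (0::'a) 1))"
    using a by (simp add: ennreal_mult[symmetric] power_mult_distrib)
  finally show ?thesis by simp
qed

text \<open>All dyadic shells obey the same bound for the weight, while \<open>lip_kernel\<close>
  decays like \<open>q1 ^ n\<close> with \<open>q1 = 2 powr (- s)\<close> on the outer shells and
  like \<open>q2 ^ n\<close> with \<open>q2 = (1/2) powr (1 - s)\<close> on the inner ones. Both
  geometric series converge because \<open>0 < s < 1\<close>.\<close>

lemma lip_kernel_integral_finite:
  assumes s: "0 < s" "s < 1"
  shows "(\<integral>\<^sup>+h. ennreal (1 / norm h ^ DIM('a)) * ennreal (lip_kernel s h) \<partial>(lborel :: 'a::euclidean_space measure)) < \<infinity>"
proof -
  let ?k = "\<lambda>h::'a. ennreal (1 / norm h ^ DIM('a))"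
  let ?S = "\<lambda>a (h::'a). indicator {h. a \<le> norm h \<and> norm h < 4 * a} h * ?k h"
  let ?C = "4 ^ DIM('a) * measure lborel (ball (0::'a) 1)"
  define q1 where "q1 = 2 powr (- s)"
  define q2 where "q2 = (1/2) powr (1 - s)"
  have q: "0 \<le> q1" "q1 < 1" "0 \<le> q2" "q2 < 1"
    using s powr_less_mono[of "- s" 0 2] powr_less_mono2[of "1 - s" "1/2" 1] by (auto simp: q1_def q2_def)
  let ?F = "\<lambda>n h. ennreal (q1 ^ n) * ?S (2 ^ n) h + ennreal (q2 ^ n) * ?S ((1/2) ^ (n + 1)) h"
  have m [measurable]: "?S a \<in> borel_measurable lborel" for a by measurable
  have pt: "?k h * ennreal (lip_kernel s h) \<le> (\<Sum>n. ?F n h)" for h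
  proof (cases "h = 0")
    case False
    have ex: "\<exists>n. 2 ^ n \<le> t \<and> t < 2 ^ (n + 1)" if "1 \<le> t" for t :: real
    proof -
      have "0 \<le> \<lfloor>log 2 t\<rfloor>" using that by simp
      then obtain n where n: "\<lfloor>log 2 t\<rfloor> = int n" using nonneg_int_cases by blast
      then have "real n \<le> log 2 t" "log 2 t < real n + 1" by linarith+
      then have "2 powr real n \<le> t" "t < 2 powr real (n + 1)"
        using that by (simp_all add: le_log_iff log_less_iff add.commute)
      then show ?thesis by (intro exI[of _ n]) (simp only: powr_realpow zero_less_numeral)
    qed
    have "\<exists>n. ?k h * ennreal (lip_kernel s h) \<le> ?F n h"
    proof (cases "1 \<le> norm h")
      case True
      then obtain n where n: "2 ^ n \<le> norm h" "norm h < 2 ^ (n + 1)" using ex by blast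
      have "lip_kernel s h \<le> norm h powr - s" by (simp add: lip_kernel_def)
      also have "\<dots> \<le> (2 ^ n) powr - s" using n s by (intro powr_mono2') auto
      also have "\<dots> = q1 ^ n" by (simp add: q1_def powr_realpow[symmetric] powr_powr mult.commute)
      finally have "?k h * ennreal (lip_kernel s h) \<le> ?k h * ennreal (q1 ^ n)" by (intro mult_left_mono ennreal_leI) auto
      also have "\<dots> = ennreal (q1 ^ n) * ?S (2 ^ n) h" using n by (simp add: mult.commute)
      also have "\<dots> \<le> ?F n h" by simp
      finally show ?thesis by blast
    next
      case small: False
      then have "1 \<le> 1 / norm h" using False by (simp add: field_simps)
      then obtain n where n: "2 ^ n \<le> 1 / norm h" "1 / norm h < 2 ^ (n + 1)" using ex by blast
      then have n': "norm h \<le> (1/2) ^ n" "(1/2) ^ (n + 1) < norm h"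
        using False by (auto simp: field_simps)
      have "lip_kernel s h \<le> norm h powr (1 - s)" by (simp add: lip_kernel_def)
      also have "\<dots> \<le> ((1/2) ^ n) powr (1 - s)" using n' s by (intro powr_mono2) auto
      also have "\<dots> = q2 ^ n" by (simp add: q2_def powr_realpow[symmetric] powr_powr mult.commute)
      finally have "?k h * ennreal (lip_kernel s h) \<le> ?k h * ennreal (q2 ^ n)" by (intro mult_left_mono ennreal_leI) auto
      also have "\<dots> = ennreal (q2 ^ n) * ?S ((1/2) ^ (n + 1)) h"
      proof -
        have "norm h < 4 * (1/2) ^ (n + 1)" using n'(1) False by (simp add: order_le_less_trans)
        then show ?thesis using n'(2) by (simp add: mult.commute less_imp_le)
      qed
      also have "\<dots> \<le> ?F n h" by simp
      finally show ?thesis by blast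
    qed
    then obtain n where "?k h * ennreal (lip_kernel s h) \<le> ?F n h" ..
    also have "\<dots> \<le> (\<Sum>n. ?F n h)"
      using sum_le_suminf[of "\<lambda>n. ?F n h" "{n}"] by (simp add: summableI)
    finally show ?thesis .
  qed (simp add: lip_kernel_def)
  have "(\<integral>\<^sup>+h. ?k h * ennreal (lip_kernel s h) \<partial>lborel) \<le> (\<integral>\<^sup>+h. (\<Sum>n. ?F n h) \<partial>lborel)"
    by (intro nn_integral_mono pt)
  also have "\<dots> = (\<Sum>n. \<integral>\<^sup>+h. ?F n h \<partial>lborel)"
    by (rule nn_integral_suminf) measurable
  also have "\<dots> \<le> (\<Sum>n. ennreal (q1 ^ n * ?C + q2 ^ n * ?C))"
  proof (intro suminf_le allI summableI)
    fix n
    have "(\<integral>\<^sup>+h. ?F n h \<partial>lborel) = ennreal (q1 ^ n) * (\<integral>\<^sup>+h. ?S (2 ^ n) h \<partial>lborel)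
      + ennreal (q2 ^ n) * (\<integral>\<^sup>+h. ?S ((1/2) ^ (n + 1)) h \<partial>lborel)"
      by (simp add: nn_integral_add nn_integral_cmult)
    also have "\<dots> \<le> ennreal (q1 ^ n) * ennreal ?C + ennreal (q2 ^ n) * ennreal ?C"
      by (intro add_mono mult_left_mono nn_integral_shell_le) auto
    also have "\<dots> = ennreal (q1 ^ n * ?C + q2 ^ n * ?C)"
      using q by (simp add: ennreal_mult ennreal_plus)
    finally show "(\<integral>\<^sup>+h. ?F n h \<partial>lborel) \<le> ennreal (q1 ^ n * ?C + q2 ^ n * ?C)" .
  qed
  also have "\<dots> < \<infinity>"
  proof -
    have "summable (\<lambda>n. q1 ^ n * ?C + q2 ^ n * ?C)"
      using q by (intro summable_add summable_mult2 summable_geometric) auto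
    then have "(\<Sum>n. ennreal (q1 ^ n * ?C + q2 ^ n * ?C)) \<noteq> top"
      using q by (intro ennreal_suminf_neq_top) auto
    then show ?thesis by (simp only: less_top infinity_ennreal_def)
  qed
  finally show ?thesis .
qed

context convex_pair begin

text \<open>Since \<open>lip_kernel\<close> is at most 1, convexity and \<open>P 0 = 0\<close> take
  it out of \<open>P\<close> as a linear factor, and the double integral is bounded by a product.
  The second claim follows by exchanging the two variables.\<close>

lemma lip_kernel_modular:
  fixes q :: "'a::euclidean_space \<Rightarrow> real"
  assumes s: "0 < s" "s < 1" and [measurable]: "q \<in> borel_measurable borel"
    and fin: "(\<integral>\<^sup>+x. P (q x) \<partial>lborel) < \<infinity>"
  shows "(\<integral>\<^sup>+p. P (lip_kernel s (fst p - snd p) * q (snd p)) \<partial>frac_lborel) < \<infinity>"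
    "(\<integral>\<^sup>+p. P (lip_kernel s (fst p - snd p) * q (fst p)) \<partial>frac_lborel) < \<infinity>"
proof -
  let ?K = "\<integral>\<^sup>+h. ennreal (1 / norm h ^ DIM('a)) * ennreal (lip_kernel s h) \<partial>(lborel :: 'a measure)"
  let ?k = "\<lambda>h::'a. ennreal (1 / norm h ^ DIM('a)) * ennreal (lip_kernel s h)"
  have [measurable]: "?k \<in> borel_measurable borel" by measurable
  have "(\<integral>\<^sup>+p. P (lip_kernel s (fst p - snd p) * q (snd p)) \<partial>frac_lborel)
    = (\<integral>\<^sup>+y. \<integral>\<^sup>+x. ennreal (1 / norm (x - y) ^ DIM('a)) * ennreal (P (lip_kernel s (x - y) * q y)) \<partial>lborel \<partial>lborel)"
    by (subst nn_integral_frac_lborel(2)) simp_all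
  also have "\<dots> \<le> (\<integral>\<^sup>+y. \<integral>\<^sup>+x. ennreal (P (q y)) * ?k (x - y) \<partial>lborel \<partial>lborel)"
  proof (intro nn_integral_mono)
    fix x y :: 'a
    have "P (lip_kernel s (x - y) * q y) \<le> lip_kernel s (x - y) * P (q y)"
      by (intro P_scale lip_kernel_le_1 s lip_kernel_nonneg)
    then have "ennreal (P (lip_kernel s (x - y) * q y)) \<le> ennreal (lip_kernel s (x - y)) * ennreal (P (q y))"
      by (simp add: ennreal_mult[symmetric] ennreal_leI)
    then have "ennreal (1 / norm (x - y) ^ DIM('a)) * ennreal (P (lip_kernel s (x - y) * q y))
      \<le> ennreal (1 / norm (x - y) ^ DIM('a)) * (ennreal (lip_kernel s (x - y)) * ennreal (P (q y)))"
      by (rule mult_left_mono) simp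
    then show "ennreal (1 / norm (x - y) ^ DIM('a)) * ennreal (P (lip_kernel s (x - y) * q y))
      \<le> ennreal (P (q y)) * ?k (x - y)" by (simp only: mult_ac)
  qed
  also have "\<dots> = (\<integral>\<^sup>+y. ennreal (P (q y)) * ?K \<partial>lborel)"
  proof (intro nn_integral_cong)
    fix y :: 'a
    have "(\<integral>\<^sup>+x. ennreal (P (q y)) * ?k (x - y) \<partial>lborel) = ennreal (P (q y)) * (\<integral>\<^sup>+x. ?k (x - y) \<partial>lborel)"
      by (rule nn_integral_cmult) measurable
    also have "(\<integral>\<^sup>+x. ?k (x - y) \<partial>lborel) = ?K" by (rule nn_integral_translate) measurable
    finally show "(\<integral>\<^sup>+x. ennreal (P (q y)) * ?k (x - y) \<partial>lborel) = ennreal (P (q y)) * ?K" .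
  qed
  also have "\<dots> = (\<integral>\<^sup>+y. P (q y) \<partial>lborel) * ?K" by (rule nn_integral_multc) measurable
  also have "\<dots> < \<infinity>" using fin lip_kernel_integral_finite[OF s, where 'a='a] by (simp add: ennreal_mult_less_top)
  finally show *: "(\<integral>\<^sup>+p. P (lip_kernel s (fst p - snd p) * q (snd p)) \<partial>frac_lborel) < \<infinity>" .
  have "(\<integral>\<^sup>+p. P (lip_kernel s (fst p - snd p) * q (fst p)) \<partial>frac_lborel)
    = (\<integral>\<^sup>+p. P (lip_kernel s (snd p - fst p) * q (snd p)) \<partial>frac_lborel)"
    using nn_integral_frac_lborel_swap[of "\<lambda>p. ennreal (P (lip_kernel s (snd p - fst p) * q (snd p)))"] by simp
  also have "\<dots> = (\<integral>\<^sup>+p. P (lip_kernel s (fst p - snd p) * q (snd p)) \<partial>frac_lborel)"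
    by (simp add: lip_kernel_def norm_minus_commute)
  finally show "(\<integral>\<^sup>+p. P (lip_kernel s (fst p - snd p) * q (fst p)) \<partial>frac_lborel) < \<infinity>" using * by simp
qed

end

section \<open>Functions of finite energy\<close>

lemma D_frac_apply: "D_frac s u p = (u (fst p) - u (snd p)) / norm (fst p - snd p) powr s"
  by (simp add: D_frac_def split_beta)

lemma D_frac_measurable [measurable]:
  assumes [measurable]: "u \<in> borel_measurable borel"
  shows "D_frac s u \<in> borel_measurable borel"
  unfolding D_frac_apply[abs_def] by measurable

lemma D_frac_add: "D_frac s (\<lambda>x. u x + v x) p = D_frac s u p + D_frac s v p"
  and D_frac_diff: "D_frac s (\<lambda>x. u x - v x) p = D_frac s u p - D_frac s v p"
  and D_frac_cmult: "D_frac s (\<lambda>x. c * u x) p = c * D_frac s u p"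
  and D_frac_cdiv: "D_frac s (\<lambda>x. u x / c) p = D_frac s u p / c"
  by (simp_all add: D_frac_apply algebra_simps diff_divide_distrib add_divide_distrib)

lemma D_frac_abs_le:
  "\<bar>u (fst p) - u (snd p)\<bar> \<le> \<bar>v (fst p) - v (snd p)\<bar> \<Longrightarrow> \<bar>D_frac s u p\<bar> \<le> \<bar>D_frac s v p\<bar>"
  by (simp add: D_frac_apply abs_divide divide_right_mono)

text \<open>The two bounds on \<open>a\<close> match the two branches of the minimum in
  \<open>lip_kernel\<close>: boundedness for distant points, the Lipschitz estimate for close
  ones.\<close>

lemma lip_kernel_bound:
  assumes "\<bar>a\<bar> \<le> L" "\<bar>a\<bar> \<le> L * norm h"
  shows "\<bar>a\<bar> / norm h powr s \<le> L * lip_kernel s h"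
proof (cases "h = 0")
  case False
  have L: "0 \<le> L" using assms(1) by linarith
  have e: "\<bar>a\<bar> / norm h powr s = \<bar>a\<bar> * norm h powr - s" by (simp add: powr_minus_divide)
  have 1: "\<bar>a\<bar> * norm h powr - s \<le> L * norm h powr - s"
    using assms(1) by (intro mult_right_mono) auto
  have "\<bar>a\<bar> * norm h powr - s \<le> (L * norm h) * norm h powr - s"
    using assms(2) by (intro mult_right_mono) auto
  also have "\<dots> = L * norm h powr (1 - s)"
    using False powr_add[of "norm h" 1 "- s"] by simp
  finally have 2: "\<bar>a\<bar> * norm h powr - s \<le> L * norm h powr (1 - s)" .
  show ?thesis unfolding e lip_kernel_def using 1 2 L by (simp add: min_def)
qed (simp add: lip_kernel_def)

locale frac_setting = convex_pair P p for P p +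
  fixes s :: real and \<Omega> :: "'a::euclidean_space set"
  assumes s: "0 < s" "s < 1"
    and open_domain: "open \<Omega>" and bounded_domain: "bounded \<Omega>" and domain_ne: "\<Omega> \<noteq> {}"
begin

section \<open>The space of finite energy at some scale\<close>

lemma domain_measurable [measurable]: "\<Omega> \<in> sets borel" using open_domain by simp

lemma emeasure_domain: "emeasure lborel \<Omega> < \<infinity>"
  using emeasure_bounded_finite[OF bounded_domain] by simp

definition supported :: "('a \<Rightarrow> real) \<Rightarrow> bool" where
  "supported u \<longleftrightarrow> u \<in> borel_measurable borel \<and> (\<forall>x. x \<notin> \<Omega> \<longrightarrow> u x = 0)"

lemma supported_measurable [measurable_dest]: "supported u \<Longrightarrow> u \<in> borel_measurable borel"
  by (simp add: supported_def)

definition energy :: "('a \<Rightarrow> real) \<Rightarrow> ennreal" where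
  "energy u = (\<integral>\<^sup>+p. P (D_frac s u p) \<partial>frac_lborel)"

text \<open>The Orlicz condition on \<open>u\<close> itself is not listed because the Poincare
  inequality supplies it, see \<open>W_modular\<close>. The scale \<open>l\<close> depends on
  \<open>u\<close>: a modular that is finite at one scale may be infinite at a smaller one.\<close>

definition W :: "('a \<Rightarrow> real) set" where
  "W = {u. supported u \<and> (\<exists>l>0. energy (\<lambda>x. u x / l) < \<infinity>)}"

lemma W_supported: "u \<in> W \<Longrightarrow> supported u" by (simp add: W_def)

lemma W_measurable [measurable_dest]: "u \<in> W \<Longrightarrow> u \<in> borel_measurable borel"
  by (simp add: W_def supported_def)

lemma energy_mono:
  assumes "\<And>p. \<bar>u (fst p) - u (snd p)\<bar> \<le> \<bar>v (fst p) - v (snd p)\<bar>"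
  shows "energy u \<le> energy v"
  unfolding energy_def by (intro nn_integral_mono ennreal_leI P_mono D_frac_abs_le assms)

lemma W_mono:
  assumes "v \<in> W" "supported u" "\<And>x y. \<bar>u x - u y\<bar> \<le> \<bar>v x - v y\<bar>"
  shows "u \<in> W"
proof -
  obtain l where l: "0 < l" "energy (\<lambda>x. v x / l) < \<infinity>" using assms(1) by (auto simp: W_def)
  have "\<bar>u x / l - u y / l\<bar> \<le> \<bar>v x / l - v y / l\<bar>" for x y
    using assms(3)[of x y] l(1) by (simp add: divide_right_mono flip: diff_divide_distrib)
  then have "energy (\<lambda>x. u x / l) \<le> energy (\<lambda>x. v x / l)" by (intro energy_mono)
  with l assms(2) show ?thesis by (auto simp: W_def)
qed

lemma energy_add:
  assumes [measurable]: "u \<in> borel_measurable borel" "v \<in> borel_measurable borel" and ab: "0 < a" "0 < b"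
  shows "energy (\<lambda>x. (u x + v x) / (a + b)) \<le> energy (\<lambda>x. u x / a) + energy (\<lambda>x. v x / b)"
proof -
  have "energy (\<lambda>x. (u x + v x) / (a + b))
    \<le> (\<integral>\<^sup>+p. ennreal (P (D_frac s (\<lambda>x. u x / a) p)) + ennreal (P (D_frac s (\<lambda>x. v x / b) p)) \<partial>frac_lborel)"
    unfolding energy_def
    by (intro nn_integral_mono)
      (simp add: D_frac_cdiv D_frac_add P_sum_scale[OF ab] flip: ennreal_plus)
  also have "\<dots> = energy (\<lambda>x. u x / a) + energy (\<lambda>x. v x / b)"
    unfolding energy_def by (rule nn_integral_add) measurable
  finally show ?thesis .
qed

lemma W_add:
  assumes "u \<in> W" "v \<in> W" shows "(\<lambda>x. u x + v x) \<in> W"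
proof -
  obtain a where a: "0 < a" "energy (\<lambda>x. u x / a) < \<infinity>" using assms(1) by (auto simp: W_def)
  obtain b where b: "0 < b" "energy (\<lambda>x. v x / b) < \<infinity>" using assms(2) by (auto simp: W_def)
  have "energy (\<lambda>x. (u x + v x) / (a + b)) < \<infinity>"
    using energy_add[OF W_measurable[OF assms(1)] W_measurable[OF assms(2)] a(1) b(1)] a(2) b(2)
    by (auto intro: order_le_less_trans)
  moreover have "supported (\<lambda>x. u x + v x)"
    using assms by (auto simp: W_def supported_def)
  ultimately show ?thesis using a b unfolding W_def
    by (intro CollectI conjI exI[of _ "a + b"]) auto
qed

lemma W_cmult:
  assumes "u \<in> W" shows "(\<lambda>x. c * u x) \<in> W"
proof -
  obtain a where a: "0 < a" "energy (\<lambda>x. u x / a) < \<infinity>" using assms(1) by (auto simp: W_def)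
  let ?b = "a * (\<bar>c\<bar> + 1)"
  have "energy (\<lambda>x. (c * u x) / ?b) \<le> energy (\<lambda>x. u x / a)"
  proof (rule energy_mono)
    fix p :: "'a \<times> 'a"
    have "\<bar>c * u (fst p) / ?b - c * u (snd p) / ?b\<bar> = \<bar>c\<bar> / (\<bar>c\<bar> + 1) * \<bar>u (fst p) / a - u (snd p) / a\<bar>"
      using a(1) by (simp add: abs_mult abs_divide flip: diff_divide_distrib right_diff_distrib)
    also have "\<dots> \<le> \<bar>u (fst p) / a - u (snd p) / a\<bar>"
      by (intro mult_left_le_one_le) auto
    finally show "\<bar>c * u (fst p) / ?b - c * u (snd p) / ?b\<bar> \<le> \<bar>u (fst p) / a - u (snd p) / a\<bar>" .
  qed
  then have "energy (\<lambda>x. (c * u x) / ?b) < \<infinity>" using a(2) by (rule order_le_less_trans)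
  moreover have "0 < ?b" using a(1) by simp
  moreover have "supported (\<lambda>x. c * u x)" using assms by (auto simp: W_def supported_def)
  ultimately show ?thesis unfolding W_def by (intro CollectI conjI exI[of _ ?b]) auto
qed

lemma W_diff: "u \<in> W \<Longrightarrow> v \<in> W \<Longrightarrow> (\<lambda>x. u x - v x) \<in> W"
  using W_add[of u "\<lambda>x. (-1) * v x"] W_cmult[of v "-1"] by simp

lemma W_pos_part: "u \<in> W \<Longrightarrow> (\<lambda>x. max 0 (u x)) \<in> W"
  by (rule W_mono[of u]) (auto simp: W_def supported_def max_def)

text \<open>Integrate over \<open>y\<close> in a ball outside the domain.\<close>

lemma poincare:
  obtains c k where "0 < c" "0 < k"
    "\<And>u. supported u \<Longrightarrow> ennreal c * (\<integral>\<^sup>+x. P (k * u x) \<partial>lborel) \<le> energy u"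
proof -
  obtain R where R: "0 < R" "\<Omega> \<subseteq> ball 0 R" using bounded_subset_ballD[OF bounded_domain] by blast
  obtain e :: 'a where e: "norm e = 1" using norm_Basis nonempty_Basis by blast
  \<comment> \<open>Every point of \<open>?B\<close> has norm between \<open>2 * R\<close> and
    \<open>4 * R\<close>, hence lies outside \<Omega> and within \<open>5 * R\<close> of each point
    of \<Omega>; the constants \<open>?k\<close> and \<open>?c\<close> bound the difference quotient
    and the weight at that distance.\<close>
  let ?B = "ball ((3 * R) *\<^sub>R e) R"
  let ?k = "1 / (5 * R) powr s"
  let ?c = "measure lborel ?B * (1 / (5 * R) ^ DIM('a))"
  have far: "y \<notin> \<Omega> \<and> norm (x - y) \<le> 5 * R \<and> x \<noteq> y" if "x \<in> \<Omega>" "y \<in> ?B" for x y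
  proof -
    have x: "norm x < R" using that R by auto
    have y: "norm ((3 * R) *\<^sub>R e - y) < R" using that by (simp add: dist_norm)
    have n: "norm ((3 * R) *\<^sub>R e) = 3 * R" using e R by simp
    have "2 * R < norm y" using y n norm_triangle_ineq2[of "(3 * R) *\<^sub>R e" y] by linarith
    moreover have "norm y < 4 * R" using y n norm_triangle_ineq3[of "(3 * R) *\<^sub>R e" y] by linarith
    moreover have "norm (x - y) \<le> norm x + norm y" by (rule norm_triangle_ineq4)
    ultimately show ?thesis using x R by auto
  qed
  have "ennreal ?c * (\<integral>\<^sup>+x. P (?k * u x) \<partial>lborel) \<le> energy u" if u: "supported u" for u
  proof -
    have [measurable]: "u \<in> borel_measurable borel" using u by measurable
    have "ennreal ?c * (\<integral>\<^sup>+x. P (?k * u x) \<partial>lborel) = (\<integral>\<^sup>+x. ennreal ?c * ennreal (P (?k * u x)) \<partial>lborel)"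
      by (rule nn_integral_cmult[symmetric]) measurable
    also have "\<dots> \<le> (\<integral>\<^sup>+x. \<integral>\<^sup>+y. ennreal (1 / norm (x - y) ^ DIM('a)) * ennreal (P (D_frac s u (x, y))) \<partial>lborel \<partial>lborel)"
    proof (intro nn_integral_mono)
      fix x
      show "ennreal ?c * ennreal (P (?k * u x)) \<le> (\<integral>\<^sup>+y. ennreal (1 / norm (x - y) ^ DIM('a)) * ennreal (P (D_frac s u (x, y))) \<partial>lborel)"
      proof (cases "x \<in> \<Omega>")
        case False
        then have "u x = 0" using u by (simp add: supported_def)
        then show ?thesis by simp
      next
        case True
        have b: "emeasure lborel ?B = ennreal (measure lborel ?B)"
          by (rule emeasure_eq_ennreal_measure) (use emeasure_lborel_ball_finite[of "(3 * R) *\<^sub>R e" R] in auto)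
        have "ennreal ?c * ennreal (P (?k * u x)) = (ennreal (1 / (5 * R) ^ DIM('a)) * ennreal (P (?k * u x))) * emeasure lborel ?B"
          unfolding b using R by (simp add: ennreal_mult[symmetric] mult_ac)
        also have "\<dots> = (\<integral>\<^sup>+y. (ennreal (1 / (5 * R) ^ DIM('a)) * ennreal (P (?k * u x))) * indicator ?B y \<partial>lborel)"
          by (rule nn_integral_cmult_indicator[symmetric]) simp
        also have "\<dots> \<le> (\<integral>\<^sup>+y. ennreal (1 / norm (x - y) ^ DIM('a)) * ennreal (P (D_frac s u (x, y))) \<partial>lborel)"
        proof (intro nn_integral_mono)
          fix y
          show "(ennreal (1 / (5 * R) ^ DIM('a)) * ennreal (P (?k * u x))) * indicator ?B y
            \<le> ennreal (1 / norm (x - y) ^ DIM('a)) * ennreal (P (D_frac s u (x, y)))"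
          proof (cases "y \<in> ?B")
            case yB: True
            note f = far[OF True yB]
            have pos: "0 < norm (x - y)" using f by simp
            have "u y = 0" using f u by (simp add: supported_def)
            then have D: "D_frac s u (x, y) = u x / norm (x - y) powr s" by (simp add: D_frac_def)
            have "norm (x - y) powr s \<le> (5 * R) powr s" using f s by (intro powr_mono2) auto
            then have "\<bar>?k * u x\<bar> \<le> \<bar>D_frac s u (x, y)\<bar>"
              unfolding D using pos R
              by (simp add: abs_divide) (intro divide_left_mono mult_pos_pos, auto)
            then have "ennreal (P (?k * u x)) \<le> ennreal (P (D_frac s u (x, y)))" by (intro ennreal_leI P_mono)
            moreover have "ennreal (1 / (5 * R) ^ DIM('a)) \<le> ennreal (1 / norm (x - y) ^ DIM('a))"
              using f pos R(1) by (intro ennreal_leI divide_left_mono power_mono mult_pos_pos zero_less_power) auto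
            ultimately show ?thesis using yB by (auto intro: mult_mono)
          qed simp
        qed
        finally show ?thesis .
      qed
    qed
    also have "\<dots> = energy u"
      unfolding energy_def by (rule nn_integral_frac_lborel(1)[symmetric]) measurable
    finally show ?thesis .
  qed
  moreover have "0 < measure lborel ?B" using content_ball_pos[OF R(1)] by simp
  then have "0 < ?c" using R by simp
  moreover have "0 < ?k" using R by simp
  ultimately show ?thesis using that by blast
qed

text \<open>The Poincare inequality controls the modular of \<open>k * u / a\<close>; the larger of
  the scales \<open>a\<close> and \<open>a / k\<close> serves the function and its difference
  quotient at once.\<close>

lemma W_modular:
  assumes "u \<in> W" obtains l where "0 < l" "(\<integral>\<^sup>+x. P (u x / l) \<partial>lborel) < \<infinity>" "energy (\<lambda>x. u x / l) < \<infinity>"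
proof -
  obtain a where a: "0 < a" "energy (\<lambda>x. u x / a) < \<infinity>" using assms(1) by (auto simp: W_def)
  obtain c k where ck: "0 < c" "0 < k" "\<And>u. supported u \<Longrightarrow> ennreal c * (\<integral>\<^sup>+x. P (k * u x) \<partial>lborel) \<le> energy u"
    using poincare by blast
  have "supported (\<lambda>x. u x / a)" using assms by (auto simp: W_def supported_def)
  then have "ennreal c * (\<integral>\<^sup>+x. P (k * (u x / a)) \<partial>lborel) < \<infinity>" using ck(3) a(2) order_le_less_trans by blast
  then have f: "(\<integral>\<^sup>+x. P (k * (u x / a)) \<partial>lborel) < \<infinity>" using ck(1) by (auto simp: ennreal_mult_less_top)
  let ?l = "max a (a / k)"
  have l: "0 < ?l" using a by simp
  have "(\<integral>\<^sup>+x. P (u x / ?l) \<partial>lborel) \<le> (\<integral>\<^sup>+x. P (k * (u x / a)) \<partial>lborel)"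
  proof (intro nn_integral_mono ennreal_leI P_mono)
    fix x
    have "\<bar>u x\<bar> / ?l \<le> \<bar>u x\<bar> / (a / k)" using a ck by (intro divide_left_mono) (auto simp: less_max_iff_disj)
    then show "\<bar>u x / ?l\<bar> \<le> \<bar>k * (u x / a)\<bar>" using a ck l by (simp add: abs_mult mult.commute)
  qed
  moreover have "energy (\<lambda>x. u x / ?l) \<le> energy (\<lambda>x. u x / a)"
  proof (rule energy_mono)
    fix p :: "'a \<times> 'a"
    have "\<bar>u (fst p) - u (snd p)\<bar> / ?l \<le> \<bar>u (fst p) - u (snd p)\<bar> / a" using a by (intro divide_left_mono) (auto simp: less_max_iff_disj)
    then show "\<bar>u (fst p) / ?l - u (snd p) / ?l\<bar> \<le> \<bar>u (fst p) / a - u (snd p) / a\<bar>"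
      using a l by (simp flip: diff_divide_distrib)
  qed
  ultimately show ?thesis using that[OF l] f a(2) order_le_less_trans by blast
qed

text \<open>Superlinearity bounds \<open>\<bar>u\<bar>\<close> by a multiple of the modular
  integrand plus a constant, and the constant is integrable over the bounded domain.\<close>

lemma W_integrable: assumes u: "u \<in> W" shows "integrable lborel u"
proof -
  have [measurable]: "u \<in> borel_measurable borel" using u by measurable
  obtain l where l: "0 < l" "(\<integral>\<^sup>+x. P (u x / l) \<partial>lborel) < \<infinity>" using W_modular[OF u] by blast
  obtain B where B: "0 \<le> B" "\<And>t. 0 \<le> t \<Longrightarrow> 1 * t \<le> P t + B" using P_superlinear[of 1] by blast
  have i: "integrable lborel (\<lambda>x. P (u x / l))" using l(2) by (intro integrableI_nonneg) auto
  have "integrable lborel (\<lambda>x. l * (P (u x / l) + B * indicator \<Omega> x))"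
    using emeasure_domain by (intro integrable_mult_right Bochner_Integration.integrable_add i) simp_all
  then show ?thesis
  proof (rule Bochner_Integration.integrable_bound)
    show "AE x in lborel. norm (u x) \<le> norm (l * (P (u x / l) + B * indicator \<Omega> x))"
    proof (rule AE_I2)
      fix x
      show "norm (u x) \<le> norm (l * (P (u x / l) + B * indicator \<Omega> x))"
      proof (cases "x \<in> \<Omega>")
        case True
        have "\<bar>u x / l\<bar> \<le> P (u x / l) + B" using B(2)[of "\<bar>u x / l\<bar>"] unfolding P_abs by simp
        then have "\<bar>u x\<bar> \<le> l * (P (u x / l) + B)" using l(1) by (simp add: field_simps)
        then show ?thesis using True by simp
      qed (use W_supported[OF u] in \<open>simp add: supported_def\<close>)
    qed
  qed measurable
qed

text \<open>A discrete product rule: the quotient of the product is \<open>g x\<close> times that of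
  \<open>u\<close> plus \<open>u y\<close> times that of \<open>g\<close>, and the latter is
  controlled by \<open>lip_kernel\<close>. The scale \<open>l + l * ?L\<close> is the one that
  \<open>P_sum_scale\<close> produces from the two terms.\<close>

lemma W_cutoff:
  assumes u: "u \<in> W" and [measurable]: "g \<in> borel_measurable borel"
    and g: "\<And>x. 0 \<le> g x" "\<And>x. g x \<le> 1" and lip: "\<And>x y. \<bar>g x - g y\<bar> \<le> L * norm (x - y)"
  shows "(\<lambda>x. g x * u x) \<in> W"
proof -
  have [measurable]: "u \<in> borel_measurable borel" using u by measurable
  obtain l where l: "0 < l" "(\<integral>\<^sup>+x. P (u x / l) \<partial>lborel) < \<infinity>" "energy (\<lambda>x. u x / l) < \<infinity>"
    using W_modular[OF u] by blast
  let ?L = "max 1 L"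
  have L: "0 < ?L" by simp
  let ?m = "l + l * ?L"
  have m: "0 < ?m" using l by (simp add: add_pos_pos)
  let ?q = "\<lambda>y. u y / l"
  have pt: "P (D_frac s (\<lambda>x. g x * u x / ?m) p)
    \<le> P (D_frac s (\<lambda>x. u x / l) p) + P (lip_kernel s (fst p - snd p) * ?q (snd p))" for p
  proof -
    obtain x y where p: "p = (x, y)" by (cases p)
    let ?n = "norm (x - y) powr s"
    have "D_frac s (\<lambda>x. g x * u x) p = g x * D_frac s u p + (g x - g y) / ?n * u y"
      by (simp add: p D_frac_def diff_divide_distrib[symmetric] add_divide_distrib[symmetric] algebra_simps)
    also have "\<bar>\<dots>\<bar> \<le> g x * \<bar>D_frac s u p\<bar> + \<bar>g x - g y\<bar> / ?n * \<bar>u y\<bar>"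
      using g(1)[of x] by (intro order_trans[OF abs_triangle_ineq]) (simp add: abs_mult abs_divide)
    also have "\<dots> \<le> \<bar>D_frac s u p\<bar> + (?L * lip_kernel s (x - y)) * \<bar>u y\<bar>"
    proof (intro add_mono mult_right_mono lip_kernel_bound)
      show "g x * \<bar>D_frac s u p\<bar> \<le> \<bar>D_frac s u p\<bar>" using g[of x] by (intro mult_left_le_one_le) auto
      show "\<bar>g x - g y\<bar> \<le> ?L" using g[of x] g[of y] by linarith
      have "L * norm (x - y) \<le> ?L * norm (x - y)" by (intro mult_right_mono) auto
      then show "\<bar>g x - g y\<bar> \<le> ?L * norm (x - y)" using lip[of x y] by linarith
    qed auto
    finally have b: "\<bar>D_frac s (\<lambda>x. g x * u x) p\<bar> \<le> \<bar>D_frac s u p\<bar> + ?L * lip_kernel s (x - y) * \<bar>u y\<bar>" .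
    have "P (D_frac s (\<lambda>x. g x * u x / ?m) p) \<le> P ((\<bar>D_frac s u p\<bar> + ?L * lip_kernel s (x - y) * \<bar>u y\<bar>) / ?m)"
      unfolding D_frac_cdiv
    proof (rule P_mono)
      have "0 \<le> \<bar>D_frac s u p\<bar> + ?L * lip_kernel s (x - y) * \<bar>u y\<bar>" using b by linarith
      then show "\<bar>D_frac s (\<lambda>x. g x * u x) p / ?m\<bar> \<le> \<bar>(\<bar>D_frac s u p\<bar> + ?L * lip_kernel s (x - y) * \<bar>u y\<bar>) / ?m\<bar>"
        unfolding abs_divide using b m by (intro divide_right_mono) auto
    qed
    also have "\<dots> \<le> P (\<bar>D_frac s u p\<bar> / l) + P ((?L * lip_kernel s (x - y) * \<bar>u y\<bar>) / (l * ?L))"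
      using l L by (intro P_sum_scale mult_pos_pos) auto
    also have "P (\<bar>D_frac s u p\<bar> / l) = P (D_frac s (\<lambda>x. u x / l) p)"
      unfolding D_frac_cdiv using P_abs[of "D_frac s u p / l"] l by simp
    also have "(?L * lip_kernel s (x - y) * \<bar>u y\<bar>) / (l * ?L) = \<bar>lip_kernel s (x - y) * ?q y\<bar>"
      using l L by (simp add: abs_mult field_simps)
    finally show ?thesis unfolding P_abs by (simp only: p fst_conv snd_conv)
  qed
  have "energy (\<lambda>x. g x * u x / ?m)
    \<le> (\<integral>\<^sup>+p. ennreal (P (D_frac s (\<lambda>x. u x / l) p)) + ennreal (P (lip_kernel s (fst p - snd p) * ?q (snd p))) \<partial>frac_lborel)"
    unfolding energy_def
    by (intro nn_integral_mono) (simp only: ennreal_plus[symmetric] P_nonneg, intro ennreal_leI pt)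
  also have "\<dots> = energy (\<lambda>x. u x / l) + (\<integral>\<^sup>+p. P (lip_kernel s (fst p - snd p) * ?q (snd p)) \<partial>frac_lborel)"
    unfolding energy_def by (rule nn_integral_add) measurable
  also have "\<dots> < \<infinity>"
    using l(3) lip_kernel_modular(1)[OF s, of ?q] l(2) by simp
  finally have "energy (\<lambda>x. g x * u x / ?m) < \<infinity>" .
  moreover have "supported (\<lambda>x. g x * u x)" using W_supported[OF u] by (auto simp: supported_def)
  ultimately show ?thesis using m unfolding W_def by (intro CollectI conjI exI[of _ ?m]) auto
qed

text \<open>The hypotheses are stable under multiplication by constants, so all multiples of
  \<open>v\<close> have finite energy, which may fail for a general member of \<open>W\<close>.
  Pairs with both points outside \<Omega> contribute nothing; the others are charged to a point in
  \<Omega>, and the factor 2 in \<open>?q\<close> offsets the division by \<open>1 + 1\<close> when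
  the two variables are separated.\<close>

lemma energy_lipschitz:
  assumes v: "supported v" and lip: "\<And>x y. \<bar>v x - v y\<bar> \<le> L * norm (x - y)" and B: "\<And>x. \<bar>v x\<bar> \<le> B"
  shows "energy v < \<infinity>"
proof -
  let ?L = "max (2 * B) L"
  let ?q = "\<lambda>x. 2 * ?L * indicator \<Omega> x :: real"
  have pt: "P (D_frac s v p) \<le> P (lip_kernel s (fst p - snd p) * ?q (fst p)) + P (lip_kernel s (fst p - snd p) * ?q (snd p))" for p
  proof (cases "fst p \<in> \<Omega> \<or> snd p \<in> \<Omega>")
    case False
    then have "D_frac s v p = 0" using v by (simp add: D_frac_apply supported_def)
    then show ?thesis by simp
  next
    case True
    have "\<bar>v (fst p) - v (snd p)\<bar> \<le> ?L * norm (fst p - snd p)"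
      using lip[of "fst p" "snd p"] by (rule order_trans) (intro mult_right_mono, auto)
    moreover have "\<bar>v (fst p) - v (snd p)\<bar> \<le> ?L" using B[of "fst p"] B[of "snd p"] by linarith
    ultimately have "\<bar>D_frac s v p\<bar> \<le> ?L * lip_kernel s (fst p - snd p)"
      unfolding D_frac_apply abs_divide using lip_kernel_bound[of "v (fst p) - v (snd p)" ?L "fst p - snd p" s] by simp
    also have "\<dots> \<le> (lip_kernel s (fst p - snd p) * ?q (fst p) + lip_kernel s (fst p - snd p) * ?q (snd p)) / (1 + 1)"
    proof -
      have "0 \<le> B" using B[of undefined] by linarith
      then have "0 \<le> ?L * lip_kernel s (fst p - snd p)" by (intro mult_nonneg_nonneg) auto
      then show ?thesis using True by (auto simp: indicator_def algebra_simps)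
    qed
    finally have "P (D_frac s v p) \<le> P ((lip_kernel s (fst p - snd p) * ?q (fst p) + lip_kernel s (fst p - snd p) * ?q (snd p)) / (1 + 1))"
      by (intro P_mono) simp
    also have "\<dots> \<le> P (lip_kernel s (fst p - snd p) * ?q (fst p) / 1) + P (lip_kernel s (fst p - snd p) * ?q (snd p) / 1)"
      by (rule P_sum_scale) auto
    finally show ?thesis by simp
  qed
  have "P (?q x) = P (2 * ?L) * indicator \<Omega> x" for x by (simp add: indicator_def)
  then have "(\<integral>\<^sup>+x. P (?q x) \<partial>lborel) = (\<integral>\<^sup>+x. ennreal (P (2 * ?L)) * indicator \<Omega> x \<partial>lborel)"
    by (intro nn_integral_cong) (simp add: indicator_def)
  also have "\<dots> = ennreal (P (2 * ?L)) * emeasure lborel \<Omega>" by (rule nn_integral_cmult_indicator) simp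
  also have "\<dots> < \<infinity>" using emeasure_domain by (simp add: ennreal_mult_less_top)
  finally have q: "(\<integral>\<^sup>+x. P (?q x) \<partial>lborel) < \<infinity>" .
  have qm: "?q \<in> borel_measurable borel" by measurable
  have "energy v \<le> (\<integral>\<^sup>+p. ennreal (P (lip_kernel s (fst p - snd p) * ?q (fst p))) + ennreal (P (lip_kernel s (fst p - snd p) * ?q (snd p))) \<partial>frac_lborel)"
    unfolding energy_def
    by (intro nn_integral_mono) (simp only: ennreal_plus[symmetric] P_nonneg, intro ennreal_leI pt)
  also have "\<dots> = (\<integral>\<^sup>+p. P (lip_kernel s (fst p - snd p) * ?q (fst p)) \<partial>frac_lborel) + (\<integral>\<^sup>+p. P (lip_kernel s (fst p - snd p) * ?q (snd p)) \<partial>frac_lborel)"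
    by (rule nn_integral_add) measurable
  also have "\<dots> < \<infinity>" using lip_kernel_modular[OF s qm q] by simp
  finally show ?thesis .
qed

text \<open>The difference quotient of the mollification is the average of the quotients of the
  translates of \<open>u\<close>, all of which have the same energy;
  \<open>modular_average_le\<close> then applies to both modulars.\<close>

lemma mollify_modular_le:
  assumes u: "integrable lborel u" and r: "0 < r"
  shows "(\<integral>\<^sup>+x. P (mollify a r u x) \<partial>lborel) \<le> (\<integral>\<^sup>+x. P (u x) \<partial>lborel)"
    and "energy (mollify a r u) \<le> energy u"
proof -
  have [measurable]: "u \<in> borel_measurable borel" using u by auto
  have [measurable]: "mollifier a r \<in> borel_measurable borel"
    using smooth_bounded_support_measurable[OF mollifier_smooth[OF r]] .
  note sf = lborel.sigma_finite_measure_axioms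
  show "(\<integral>\<^sup>+x. P (mollify a r u x) \<partial>lborel) \<le> (\<integral>\<^sup>+x. P (u x) \<partial>lborel)"
    unfolding mollify_def
  proof (rule modular_average_le[OF sf sf])
    show "(\<integral>\<^sup>+x. P (u (x - h)) \<partial>lborel) \<le> (\<integral>\<^sup>+x. P (u x) \<partial>lborel)" for h
      using nn_integral_translate[of "\<lambda>x. ennreal (P (u x))" h] by simp
  qed (use mollifier_nonneg[OF r] mollifier_integrable[OF r] mollifier_integral[OF r] mollify_integrable[OF r u] in auto)
  let ?G = "\<lambda>p h. (u (fst p - h) - u (snd p - h)) / norm (fst p - snd p) powr s"
  have ig: "integrable lborel (\<lambda>h. mollifier a r h * ?G p h)" for p
    using Bochner_Integration.integrable_diff[OF mollify_integrable[OF r u, of a "fst p"] mollify_integrable[OF r u, of a "snd p"]]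
    by (simp add: right_diff_distrib[symmetric])
  have "D_frac s (mollify a r u) p = (\<integral>h. mollifier a r h * ?G p h \<partial>lborel)" for p
    unfolding D_frac_apply mollify_def
      Bochner_Integration.integral_diff[OF mollify_integrable[OF r u, of a "fst p"] mollify_integrable[OF r u, of a "snd p"], symmetric]
    by (simp add: right_diff_distrib[symmetric])
  then have "energy (mollify a r u) = (\<integral>\<^sup>+p. P (\<integral>h. mollifier a r h * ?G p h \<partial>lborel) \<partial>frac_lborel)"
    by (simp add: energy_def)
  also have "\<dots> \<le> energy u"
  proof (rule modular_average_le[OF sigma_finite_frac_lborel sf])
    show "(\<integral>\<^sup>+p. P (?G p h) \<partial>frac_lborel) \<le> energy u" for h
      using nn_integral_frac_lborel_translate[of "\<lambda>p. ennreal (P (D_frac s u p))" h]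
      by (simp add: energy_def D_frac_apply)
  qed (use mollifier_nonneg[OF r] mollifier_integrable[OF r] mollifier_integral[OF r] ig in auto)
  finally show "energy (mollify a r u) \<le> energy u" .
qed

end

section \<open>Density of test functions\<close>

lemma test_functions_smooth:
  assumes "f \<in> test_functions \<Omega>" shows "smooth_bounded_support f"
proof -
  have "bounded {x. f x \<noteq> 0}"
    using assms by (auto simp: test_functions_def intro: bounded_subset[OF compact_imp_bounded closure_subset])
  then obtain R where R: "\<And>x. f x \<noteq> 0 \<Longrightarrow> norm x \<le> R" by (auto simp: bounded_iff)
  have "\<forall>x. R < norm x \<longrightarrow> f x = 0" using R not_le by blast
  then show ?thesis using assms unfolding smooth_bounded_support_def test_functions_def by blast
qed

lemma test_functions_supp:
  assumes f: "f \<in> test_functions \<Omega>" and x: "x \<notin> \<Omega>" shows "f x = 0"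
  using assms closure_subset[of "{x. f x \<noteq> 0}"] unfolding test_functions_def by blast

lemma test_functions_add:
  assumes "f \<in> test_functions \<Omega>" "g \<in> test_functions \<Omega>"
  shows "(\<lambda>x. f x + g x) \<in> test_functions \<Omega>"
proof -
  have sub: "closure {x. f x + g x \<noteq> 0} \<subseteq> closure {x. f x \<noteq> 0} \<union> closure {x. g x \<noteq> 0}"
    unfolding closure_Un[symmetric] by (intro closure_mono) auto
  have "compact (closure {x. f x \<noteq> 0} \<union> closure {x. g x \<noteq> 0})"
    using assms by (auto simp: test_functions_def intro: compact_Un)
  then have "compact (closure {x. f x + g x \<noteq> 0})"
    using sub by (meson closed_closure bounded_subset compact_eq_bounded_closed)
  then show ?thesis using assms sub unfolding test_functions_def
    by (auto intro: times_cont_diff_add)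
qed

lemma test_functions_minus:
  assumes "f \<in> test_functions \<Omega>" shows "(\<lambda>x. - f x) \<in> test_functions \<Omega>"
proof -
  have "times_cont_diff k (\<lambda>x. (- 1) * f x)" for k
    using assms by (intro times_cont_diff_mult times_cont_diff_const) (auto simp: test_functions_def)
  then show ?thesis using assms by (simp add: test_functions_def)
qed

text \<open>A cone condition, uniform over the part of the closure in \<open>cball p \<rho>\<close>.
  The ball \<open>cball (t *\<^sub>R e) (c * t)\<close> contains the support of the mollifier with
  that centre and radius, so mollifying with it moves supports into \<Omega>.\<close>

definition inward_at :: "'a::euclidean_space set \<Rightarrow> 'a \<Rightarrow> real \<Rightarrow> bool" where
  "inward_at \<Omega> p \<rho> \<longleftrightarrow> 0 < \<rho> \<and> (\<exists>e c t0. 0 < c \<and> 0 < t0 \<and>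
    (\<forall>t. 0 < t \<and> t < t0 \<longrightarrow> (\<forall>x\<in>closure \<Omega> \<inter> cball p \<rho>. \<forall>h\<in>cball (t *\<^sub>R e) (c * t). x + h \<in> \<Omega>)))"

text \<open>Around an interior point small translations in all directions stay inside, so the
  direction may be \<open>0\<close> and \<open>c = 1\<close>.\<close>

lemma inward_at_interior:
  assumes "open \<Omega>" "p \<in> \<Omega>" shows "\<exists>\<rho>. inward_at \<Omega> p \<rho>"
proof -
  obtain r where r: "0 < r" "ball p r \<subseteq> \<Omega>" using assms open_contains_ball by blast
  have "x + h \<in> \<Omega>" if "t < r/2" "x \<in> cball p (r/2)" "h \<in> cball (t *\<^sub>R 0) (1 * t)" for x h and t :: real
  proof -
    have "norm (x + h - p) \<le> norm (x - p) + norm h" using norm_triangle_ineq[of "x - p" h] by (simp add: algebra_simps)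
    then have "x + h \<in> ball p r" using that by (simp add: dist_norm norm_minus_commute)
    then show ?thesis using r by blast
  qed
  then show ?thesis using r(1) unfolding inward_at_def
    by (intro exI[of _ "r/2"] conjI exI[of _ 0] exI[of _ 1]) auto
qed

text \<open>Moving by \<open>t\<close> along \<open>e\<close> raises the height
  \<open>x \<bullet> e\<close> by \<open>t\<close> and leaves the foot point fixed. A further
  displacement \<open>k\<close> changes the height by at most \<open>norm k\<close> and the graph by
  at most \<open>2 * L * norm k\<close>; with \<open>norm k \<le> ?c * t\<close> the total loss is
  at most \<open>t / 2\<close>.\<close>

lemma inward_at_boundary:
  fixes \<Omega> :: "'a::euclidean_space set"
  assumes "lipschitz_boundary \<Omega>" "p \<in> frontier \<Omega>" shows "\<exists>\<rho>. inward_at \<Omega> p \<rho>"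
proof -
  obtain e r L and g :: "'a \<Rightarrow> real" where e: "norm e = 1" and r: "0 < r" and
    lip: "L-lipschitz_on {z. z \<bullet> e = 0} g" and
    loc: "\<Omega> \<inter> ball p r = {x \<in> ball p r. g (x - (x \<bullet> e) *\<^sub>R e) < x \<bullet> e}"
    using assms unfolding lipschitz_boundary_def by blast
  let ?pr = "\<lambda>x. x - (x \<bullet> e) *\<^sub>R e"
  have L: "0 \<le> L" using lip by (rule lipschitz_on_nonneg)
  have ee: "e \<bullet> e = 1" using e by (simp add: norm_eq_1)
  have pr_norm: "norm (?pr x) \<le> 2 * norm x" for x
  proof -
    have "norm (?pr x) \<le> norm x + norm ((x \<bullet> e) *\<^sub>R e)" by (rule norm_triangle_ineq4)
    also have "\<dots> \<le> 2 * norm x" using Cauchy_Schwarz_ineq2[of x e] e by simp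
    finally show ?thesis .
  qed
  have pr_diff: "?pr x - ?pr y = ?pr (x - y)" for x y by (simp add: inner_diff_left algebra_simps)
  have glip: "g (?pr x) \<le> g (?pr y) + 2 * L * norm (x - y)" for x y
  proof -
    have m: "?pr z \<in> {z. z \<bullet> e = 0}" for z by (simp add: inner_diff_left ee)
    have "dist (g (?pr x)) (g (?pr y)) \<le> L * dist (?pr x) (?pr y)"
      by (rule lipschitz_onD[OF lip m m])
    also have "\<dots> \<le> L * (2 * norm (x - y))"
      unfolding dist_norm pr_diff using L pr_norm by (intro mult_left_mono)
    finally show ?thesis by (simp add: dist_real_def abs_le_iff)
  qed
  \<comment> \<open>Points of the closure satisfy the graph inequality only in its non-strict form;
    the gain along \<open>e\<close> makes it strict again.\<close>
  have clos: "g (?pr x) \<le> x \<bullet> e" if x: "x \<in> closure \<Omega>" "x \<in> cball p (r/2)" for x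
  proof (rule field_le_epsilon)
    fix \<epsilon> :: real assume \<epsilon>: "0 < \<epsilon>"
    let ?d = "min (r/2) (\<epsilon> / (1 + 2 * L))"
    have "0 < ?d" using r \<epsilon> L by (auto intro: divide_pos_pos)
    then obtain y where y: "y \<in> \<Omega>" "dist y x < ?d" using x(1) closure_approachable by blast
    have "y \<in> ball p r" using y(2) x(2) dist_triangle[of p y x] by (simp add: dist_commute)
    then have "g (?pr y) < y \<bullet> e" using loc y(1) by blast
    moreover have "y \<bullet> e \<le> x \<bullet> e + norm (x - y)"
      using Cauchy_Schwarz_ineq2[of "y - x" e] e by (simp add: inner_diff_left norm_minus_commute)
    moreover have "(1 + 2 * L) * norm (x - y) \<le> \<epsilon>"
      using y(2) L by (simp add: dist_norm norm_minus_commute pos_less_divide_eq mult.commute less_imp_le)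
    ultimately show "g (?pr x) \<le> x \<bullet> e + \<epsilon>" using glip[of x y] by (simp add: algebra_simps)
  qed
  let ?c = "1 / (2 * (1 + 2 * L))"
  have c: "0 < ?c" "?c \<le> 1" "?c * (1 + 2 * L) = 1/2" using L by (auto simp: field_simps)
  have "x + h \<in> \<Omega>" if t: "0 < t" "t < r/4" and x: "x \<in> closure \<Omega> \<inter> cball p (r/2)"
    and h: "h \<in> cball (t *\<^sub>R e) (?c * t)" for t x h
  proof -
    define k where "k = h - t *\<^sub>R e"
    have hk: "h = t *\<^sub>R e + k" by (simp add: k_def)
    have k: "norm k \<le> ?c * t" using h by (simp add: k_def dist_norm norm_minus_commute)
    have "?c * t \<le> 1 * t" using t by (intro mult_right_mono c(2)) simp
    then have "norm h \<le> 2 * t" using norm_triangle_ineq[of "t *\<^sub>R e" k] k t e by (simp add: hk)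
    moreover have "norm (x + h - p) \<le> norm (x - p) + norm h" using norm_triangle_ineq[of "x - p" h] by (simp add: algebra_simps)
    ultimately have ball: "x + h \<in> ball p r" using t x by (simp add: dist_norm norm_minus_commute)
    have e': "?pr (x + h) = ?pr (x + k)" by (simp add: hk inner_add_left ee algebra_simps)
    have "g (?pr (x + h)) \<le> g (?pr x) + 2 * L * norm k"
      unfolding e' using glip[of "x + k" x] by simp
    also have "\<dots> \<le> x \<bullet> e + 2 * L * norm k" using clos x by simp
    also have "\<dots> < x \<bullet> e + (t - norm k)"
    proof -
      have "(1 + 2 * L) * norm k \<le> (1 + 2 * L) * (?c * t)" using k L by (intro mult_left_mono) auto
      also have "\<dots> = t / 2" using c(3) by (metis mult.assoc mult.commute times_divide_eq_left mult_1)
      finally show ?thesis using t by (simp add: algebra_simps)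
    qed
    also have "\<dots> \<le> (x + h) \<bullet> e"
      using Cauchy_Schwarz_ineq2[of k e] e by (simp add: hk inner_add_left ee abs_le_iff)
    finally show ?thesis using ball loc by blast
  qed
  then show ?thesis using r c(1) unfolding inward_at_def
    by (intro exI[of _ "r/2"] conjI exI[of _ e] exI[of _ ?c] exI[of _ "r/4"]) auto
qed

section \<open>Convergence of pairings and approximation by test functions\<close>

context convex_pair begin

text \<open>A pointwise Young inequality with an integrable \<open>h\<close>. It covers the members
  of the predual, with the conjugate of \<open>\<bar>z\<bar>\<close> as \<open>h\<close>, and also
  the flux of the minimiser, for which integrability is known at one scale only.\<close>

definition pairable :: "'b measure \<Rightarrow> ('b \<Rightarrow> real) \<Rightarrow> bool" where
  "pairable M z \<longleftrightarrow> z \<in> borel_measurable M \<and>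
    (\<exists>h. integrable M h \<and> (AE x in M. \<forall>b. \<bar>z x * b\<bar> \<le> h x + P b))"

end

context frac_setting begin

lemma test_function_energy:
  assumes f: "f \<in> test_functions \<Omega>" shows "energy (\<lambda>x. c * f x) < \<infinity>"
proof -
  note sm = test_functions_smooth[OF f]
  obtain L where L: "0 \<le> L" "\<And>x y. \<bar>f x - f y\<bar> \<le> L * norm (x - y)"
    using smooth_bounded_support_lipschitz[OF sm] by blast
  obtain B where B: "0 \<le> B" "\<And>x. \<bar>f x\<bar> \<le> B" using smooth_bounded_support_bounded[OF sm] by blast
  show ?thesis
  proof (rule energy_lipschitz)
    have "f \<in> borel_measurable borel" by (rule smooth_bounded_support_measurable[OF sm])
    then show "supported (\<lambda>x. c * f x)" using test_functions_supp[OF f] by (simp add: supported_def)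
    show "\<bar>c * f x - c * f y\<bar> \<le> (\<bar>c\<bar> * L) * norm (x - y)" for x y
      using mult_left_mono[OF L(2)[of x y], of "\<bar>c\<bar>"] by (simp add: abs_mult[symmetric] right_diff_distrib mult.assoc)
    show "\<bar>c * f x\<bar> \<le> \<bar>c\<bar> * B" for x unfolding abs_mult by (intro mult_left_mono B) simp
  qed
qed

lemma test_function_W:
  assumes f: "f \<in> test_functions \<Omega>" shows "f \<in> W"
proof -
  have "f \<in> borel_measurable borel" by (rule smooth_bounded_support_measurable[OF test_functions_smooth[OF f]])
  then have "supported f" using test_functions_supp[OF f] by (simp add: supported_def)
  moreover have "energy (\<lambda>x. f x / 1) < \<infinity>" using test_function_energy[OF f, of 1] by simp
  ultimately show ?thesis unfolding W_def by (intro CollectI conjI exI[of _ 1]) auto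
qed

text \<open>Both pairings are instances of \<open>pairing_tendsto\<close>. The modular bounds are
  assumed at every scale because the scale at which the modulars are finite depends on
  \<open>w\<close>.\<close>

lemma W_pairing_tendsto:
  assumes w: "w \<in> W" and f: "\<And>n. f n \<in> W" and lim: "AE x in lborel. (\<lambda>n. f n x) \<longlonglongrightarrow> w x"
    and le: "\<And>n l. 0 < l \<Longrightarrow> energy (\<lambda>x. f n x / l) \<le> energy (\<lambda>x. w x / l)"
    "\<And>n l. 0 < l \<Longrightarrow> (\<integral>\<^sup>+x. P (f n x / l) \<partial>lborel) \<le> (\<integral>\<^sup>+x. P (w x / l) \<partial>lborel)"
  shows "pairable frac_lborel z \<Longrightarrow> integrable frac_lborel (\<lambda>p. z p * D_frac s w p)"
    "pairable frac_lborel z \<Longrightarrow> (\<lambda>n. \<integral>p. z p * D_frac s (f n) p \<partial>frac_lborel) \<longlonglongrightarrow> (\<integral>p. z p * D_frac s w p \<partial>frac_lborel)"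
    "pairable lborel z' \<Longrightarrow> integrable lborel (\<lambda>x. z' x * w x)"
    "pairable lborel z' \<Longrightarrow> (\<lambda>n. \<integral>x. z' x * f n x \<partial>lborel) \<longlonglongrightarrow> (\<integral>x. z' x * w x \<partial>lborel)"
proof -
  obtain l where l: "0 < l" "(\<integral>\<^sup>+x. P (w x / l) \<partial>lborel) < \<infinity>" "energy (\<lambda>x. w x / l) < \<infinity>"
    using W_modular[OF w] by blast
  have [measurable]: "w \<in> borel_measurable borel" "f n \<in> borel_measurable borel" for n using w f by measurable
  have Dlim: "AE p in frac_lborel. (\<lambda>n. D_frac s (f n) p) \<longlonglongrightarrow> D_frac s w p"
    using AE_frac_lborel[OF lim]
  proof eventually_elim
    case (elim p)
    have c: "(\<lambda>n. (f n (fst p) - f n (snd p)) * inverse (norm (fst p - snd p) powr s))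
      \<longlonglongrightarrow> (w (fst p) - w (snd p)) * inverse (norm (fst p - snd p) powr s)"
      using elim by (intro tendsto_mult_right tendsto_diff) auto
    then show ?case by (simp add: D_frac_apply divide_inverse)
  qed
  have e: "(\<integral>\<^sup>+p. P (D_frac s (f n) p / l) \<partial>frac_lborel) \<le> (\<integral>\<^sup>+p. P (D_frac s w p / l) \<partial>frac_lborel)"
    "(\<integral>\<^sup>+p. P (D_frac s w p / l) \<partial>frac_lborel) < \<infinity>" for n
    using le(1)[OF l(1), of n] l(3) by (simp_all add: energy_def D_frac_cdiv)
  {
    assume "pairable frac_lborel z"
    then obtain h where z: "z \<in> borel_measurable frac_lborel" "integrable frac_lborel h" "AE p in frac_lborel. \<forall>b. \<bar>z p * b\<bar> \<le> h p + P b"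
      unfolding pairable_def by blast
    have m: "D_frac s (f n) \<in> borel_measurable frac_lborel" "D_frac s w \<in> borel_measurable frac_lborel" for n by measurable
    note p = pairing_tendsto[OF m z(1) Dlim l(1) e(2) e(1) z(2,3)]
    show "integrable frac_lborel (\<lambda>p. z p * D_frac s w p)" by (rule p(1))
    show "(\<lambda>n. \<integral>p. z p * D_frac s (f n) p \<partial>frac_lborel) \<longlonglongrightarrow> (\<integral>p. z p * D_frac s w p \<partial>frac_lborel)" by (rule p(3))
  }
  {
    assume "pairable lborel z'"
    then obtain h where z: "z' \<in> borel_measurable lborel" "integrable lborel h" "AE x in lborel. \<forall>b. \<bar>z' x * b\<bar> \<le> h x + P b"
      unfolding pairable_def by blast
    have m: "f n \<in> borel_measurable lborel" "w \<in> borel_measurable lborel" for n by measurable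
    note p = pairing_tendsto[OF m z(1) lim l(1) l(2) le(2)[OF l(1)] z(2,3)]
    show "integrable lborel (\<lambda>x. z' x * w x)" by (rule p(1))
    show "(\<lambda>n. \<integral>x. z' x * f n x \<partial>lborel) \<longlonglongrightarrow> (\<integral>x. z' x * w x \<partial>lborel)" by (rule p(3))
  }
qed

lemma W_pairing_integrable:
  assumes w: "w \<in> W"
  shows "pairable frac_lborel z \<Longrightarrow> integrable frac_lborel (\<lambda>p. z p * D_frac s w p)"
    "pairable lborel z' \<Longrightarrow> integrable lborel (\<lambda>x. z' x * w x)"
  using W_pairing_tendsto(1,3)[of w "\<lambda>_. w"] w by auto

text \<open>A single sequence serves all pairings. Convergence almost everywhere is recorded as well
  because the singular weight \<open>u powr (q - 1)\<close> is not known to be pairable and is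
  treated by Fatou's lemma.\<close>

definition approximable :: "('a \<Rightarrow> real) \<Rightarrow> bool" where
  "approximable w \<longleftrightarrow> w \<in> W \<and> (\<exists>f. (\<forall>n. f n \<in> test_functions \<Omega> \<and> (\<forall>x. 0 \<le> f n x)) \<and>
    (AE x in lborel. (\<lambda>n. f n x) \<longlonglongrightarrow> w x) \<and>
    (\<forall>z. pairable frac_lborel z \<longrightarrow>
      (\<lambda>n. \<integral>p. z p * D_frac s (f n) p \<partial>frac_lborel) \<longlonglongrightarrow> (\<integral>p. z p * D_frac s w p \<partial>frac_lborel)) \<and>
    (\<forall>z. pairable lborel z \<longrightarrow> (\<lambda>n. \<integral>x. z x * f n x \<partial>lborel) \<longlonglongrightarrow> (\<integral>x. z x * w x \<partial>lborel)))"

lemma approximable_add: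
  assumes "approximable u" "approximable v" shows "approximable (\<lambda>x. u x + v x)"
proof -
  obtain f where u: "u \<in> W" "\<And>n. f n \<in> test_functions \<Omega>" "\<And>n x. 0 \<le> f n x" "AE x in lborel. (\<lambda>n. f n x) \<longlonglongrightarrow> u x"
    "\<And>z. pairable frac_lborel z \<Longrightarrow> (\<lambda>n. \<integral>p. z p * D_frac s (f n) p \<partial>frac_lborel) \<longlonglongrightarrow> (\<integral>p. z p * D_frac s u p \<partial>frac_lborel)"
    "\<And>z. pairable lborel z \<Longrightarrow> (\<lambda>n. \<integral>x. z x * f n x \<partial>lborel) \<longlonglongrightarrow> (\<integral>x. z x * u x \<partial>lborel)"
    using assms(1) unfolding approximable_def by blast
  obtain g where v: "v \<in> W" "\<And>n. g n \<in> test_functions \<Omega>" "\<And>n x. 0 \<le> g n x" "AE x in lborel. (\<lambda>n. g n x) \<longlonglongrightarrow> v x"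
    "\<And>z. pairable frac_lborel z \<Longrightarrow> (\<lambda>n. \<integral>p. z p * D_frac s (g n) p \<partial>frac_lborel) \<longlonglongrightarrow> (\<integral>p. z p * D_frac s v p \<partial>frac_lborel)"
    "\<And>z. pairable lborel z \<Longrightarrow> (\<lambda>n. \<integral>x. z x * g n x \<partial>lborel) \<longlonglongrightarrow> (\<integral>x. z x * v x \<partial>lborel)"
    using assms(2) unfolding approximable_def by blast
  have D: "(\<integral>p. z p * D_frac s (\<lambda>x. a x + b x) p \<partial>frac_lborel)
    = (\<integral>p. z p * D_frac s a p \<partial>frac_lborel) + (\<integral>p. z p * D_frac s b p \<partial>frac_lborel)"
    if "pairable frac_lborel z" "a \<in> W" "b \<in> W" for a b z
    unfolding D_frac_add distrib_left using that
    by (intro Bochner_Integration.integral_add W_pairing_integrable)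
  have E: "(\<integral>x. z x * (a x + b x) \<partial>lborel) = (\<integral>x. z x * a x \<partial>lborel) + (\<integral>x. z x * b x \<partial>lborel)"
    if "pairable lborel z" "a \<in> W" "b \<in> W" for a b z
    unfolding distrib_left using that
    by (intro Bochner_Integration.integral_add W_pairing_integrable)
  note tw = test_function_W[OF u(2)] test_function_W[OF v(2)]
  show ?thesis
    unfolding approximable_def
  proof (intro conjI exI[of _ "\<lambda>n x. f n x + g n x"] allI impI)
    show "AE x in lborel. (\<lambda>n. f n x + g n x) \<longlonglongrightarrow> u x + v x"
      using u(4) v(4) by eventually_elim (rule tendsto_add)
    show "(\<lambda>n. \<integral>p. z p * D_frac s (\<lambda>x. f n x + g n x) p \<partial>frac_lborel) \<longlonglongrightarrow> (\<integral>p. z p * D_frac s (\<lambda>x. u x + v x) p \<partial>frac_lborel)"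
      if "pairable frac_lborel z" for z
      unfolding D[OF that tw] D[OF that u(1) v(1)] by (intro tendsto_add u(5) v(5) that)
    show "(\<lambda>n. \<integral>x. z x * (f n x + g n x) \<partial>lborel) \<longlonglongrightarrow> (\<integral>x. z x * (u x + v x) \<partial>lborel)"
      if "pairable lborel z" for z
      unfolding E[OF that tw] E[OF that u(1) v(1)] by (intro tendsto_add u(6) v(6) that)
  qed (use u v in \<open>auto intro: W_add test_functions_add add_nonneg_nonneg\<close>)
qed

text \<open>The mollifications are supported in the Minkowski sum of the compact set
  \<open>closure \<Omega> \<inter> cball b \<rho>\<close> and a ball, and \<open>inward_at\<close>
  places this compact sum inside \<Omega>.\<close>

lemma approximable_local:
  assumes w: "w \<in> W" and nn: "\<And>x. 0 \<le> w x" and b: "inward_at \<Omega> b \<rho>"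
    and supp: "\<And>x. w x \<noteq> 0 \<Longrightarrow> x \<in> cball b \<rho>"
  shows "approximable w"
proof -
  obtain e c t0 where c: "0 < c" "0 < t0" and
    inw: "\<And>t x h. \<lbrakk>0 < t; t < t0; x \<in> closure \<Omega> \<inter> cball b \<rho>; h \<in> cball (t *\<^sub>R e) (c * t)\<rbrakk> \<Longrightarrow> x + h \<in> \<Omega>"
    using b unfolding inward_at_def by blast
  note iw = W_integrable[OF w]
  \<comment> \<open>The denominator \<open>n + 2\<close> keeps \<open>t n\<close> strictly below
    \<open>t0\<close> already at \<open>n = 0\<close>.\<close>
  define t where "t n = t0 / real (n + 2)" for n
  have t: "0 < t n" "t n < t0" for n
    using c mult_strict_left_mono[of 1 "real (n + 2)" t0] by (auto simp: t_def divide_less_eq)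
  have t_lim: "t \<longlonglongrightarrow> 0"
    unfolding t_def by (rule LIMSEQ_ignore_initial_segment) (rule lim_const_over_n)
  have ct: "0 < c * t n" for n using c t by simp
  have a_lim: "(\<lambda>n. t n *\<^sub>R e) \<longlonglongrightarrow> 0" using tendsto_scaleR[OF t_lim tendsto_const[of e]] by simp
  have r_lim: "(\<lambda>n. c * t n) \<longlonglongrightarrow> 0" using tendsto_mult_right_zero[OF t_lim] by simp
  obtain k where k: "strict_mono k" "AE x in lborel. (\<lambda>n. mollify (t (k n) *\<^sub>R e) (c * t (k n)) w x) \<longlonglongrightarrow> w x"
    using mollify_AE_subseq[OF iw ct a_lim r_lim] by blast
  define f where "f n = mollify (t (k n) *\<^sub>R e) (c * t (k n)) w" for n
  have ftest: "f n \<in> test_functions \<Omega>" for n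
  proof -
    let ?S = "{x + h |x h. x \<in> closure \<Omega> \<inter> cball b \<rho> \<and> h \<in> cball (t (k n) *\<^sub>R e) (c * t (k n))}"
    have cS: "compact ?S" by (intro compact_sums closed_Int_compact compact_cball closed_closure)
    have "{x. f n x \<noteq> 0} \<subseteq> ?S"
    proof
      fix x assume "x \<in> {x. f n x \<noteq> 0}"
      then obtain h where h: "h \<in> cball (t (k n) *\<^sub>R e) (c * t (k n))" "w (x - h) \<noteq> 0"
        unfolding f_def using mollify_support[OF ct] by blast
      then have "x - h \<in> \<Omega>" using W_supported[OF w] by (auto simp: supported_def)
      then have "x - h \<in> closure \<Omega> \<inter> cball b \<rho>" using supp[OF h(2)] closure_subset by blast
      then show "x \<in> ?S" using h(1) by (intro CollectI exI[of _ "x - h"] exI[of _ h]) auto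
    qed
    then have sub: "closure {x. f n x \<noteq> 0} \<subseteq> ?S" using cS by (simp add: closure_minimal compact_imp_closed)
    moreover have "?S \<subseteq> \<Omega>" using inw t by blast
    moreover have "compact (closure {x. f n x \<noteq> 0})"
      using sub cS by (meson closed_closure bounded_subset compact_eq_bounded_closed)
    moreover have "times_cont_diff j (f n)" for j unfolding f_def by (rule mollify_times_cont_diff[OF ct iw])
    ultimately show ?thesis unfolding test_functions_def by blast
  qed
  have div: "f n x / l = mollify (t (k n) *\<^sub>R e) (c * t (k n)) (\<lambda>x. w x / l) x" for n l x
    unfolding f_def mollify_def by simp
  have iwl: "integrable lborel (\<lambda>x. w x / l)" for l using iw by simp
  have le1: "energy (\<lambda>x. f n x / l) \<le> energy (\<lambda>x. w x / l)" for n l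
    unfolding div using mollify_modular_le(2)[OF iwl ct] by simp
  have le2: "(\<integral>\<^sup>+x. P (f n x / l) \<partial>lborel) \<le> (\<integral>\<^sup>+x. P (w x / l) \<partial>lborel)" for n l
    unfolding div using mollify_modular_le(1)[OF iwl ct] by simp
  have flim: "AE x in lborel. (\<lambda>n. f n x) \<longlonglongrightarrow> w x" using k(2) by (simp add: f_def)
  note pt = W_pairing_tendsto[OF w test_function_W[OF ftest] flim le1 le2]
  have fnn: "0 \<le> f n x" for n x unfolding f_def by (rule mollify_nonneg[OF ct nn])
  show ?thesis
    unfolding approximable_def
    by (intro conjI exI[of _ f] allI impI w ftest fnn flim pt(2) pt(4))
qed

text \<open>The balls are peeled off one at a time: the cut-off \<open>?g\<close> is 1 on the half
  ball and 0 outside the ball, so the remainder \<open>(1 - ?g x) * w x\<close> is carried by the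
  other half balls.\<close>

lemma approximable_cover:
  assumes "finite F" "\<And>b. b \<in> F \<Longrightarrow> inward_at \<Omega> b (\<rho> b)"
    and "w \<in> W" "\<And>x. 0 \<le> w x" "\<And>x. w x \<noteq> 0 \<Longrightarrow> \<exists>b\<in>F. x \<in> ball b (\<rho> b / 2)"
  shows "approximable w"
  using assms
proof (induction F arbitrary: w rule: finite_induct)
  \<comment> \<open>Here \<open>w\<close> vanishes identically, and any ball given by an interior
    point qualifies.\<close>
  case empty
  obtain x where x: "x \<in> \<Omega>" using domain_ne by blast
  obtain r where "inward_at \<Omega> x r" using inward_at_interior[OF open_domain x] by blast
  then show ?case using empty by (intro approximable_local) auto
next
  case (insert b F)
  have b: "inward_at \<Omega> b (\<rho> b)" using insert by auto
  then have \<rho>: "0 < \<rho> b" by (simp add: inward_at_def)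
  let ?g = "\<lambda>x. max 0 (min 1 (2 - 2 * dist x b / \<rho> b))"
  have lip: "\<bar>?g x - ?g y\<bar> \<le> 2 / \<rho> b * norm (x - y)" for x y
  proof -
    have "\<bar>?g x - ?g y\<bar> \<le> \<bar>2 * dist x b / \<rho> b - 2 * dist y b / \<rho> b\<bar>" by (auto simp: max_def min_def)
    also have "2 * dist x b / \<rho> b - 2 * dist y b / \<rho> b = 2 / \<rho> b * (dist x b - dist y b)"
      by (simp add: right_diff_distrib)
    also have "\<bar>2 / \<rho> b * (dist x b - dist y b)\<bar> = 2 / \<rho> b * \<bar>dist x b - dist y b\<bar>"
      unfolding abs_mult using \<rho> by simp
    also have "\<dots> \<le> 2 / \<rho> b * norm (x - y)"
      using \<rho> dist_triangle[of x b y] dist_triangle[of y b x]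
      by (intro mult_left_mono) (auto simp: dist_norm norm_minus_commute abs_le_iff)
    finally show ?thesis .
  qed
  have gm [measurable]: "?g \<in> borel_measurable borel" by measurable
  have w1: "(\<lambda>x. ?g x * w x) \<in> W" by (rule W_cutoff[OF insert.prems(2) gm _ _ lip]) auto
  have w2: "(\<lambda>x. (1 - ?g x) * w x) \<in> W"
  proof (rule W_cutoff[where L = "2 / \<rho> b"])
    show "\<bar>(1 - ?g x) - (1 - ?g y)\<bar> \<le> 2 / \<rho> b * norm (x - y)" for x y using lip[of x y] by linarith
  qed (use insert.prems in auto)
  have "approximable (\<lambda>x. ?g x * w x)"
  proof (rule approximable_local[OF w1 _ b])
    fix x
    show "0 \<le> ?g x * w x" using insert.prems by simp
    assume "?g x * w x \<noteq> 0"
    then have "?g x \<noteq> 0" by simp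
    then have "2 * dist x b / \<rho> b < 2" by (auto simp: max_def min_def split: if_splits)
    then show "x \<in> cball b (\<rho> b)" using \<rho> by (simp add: field_simps dist_commute)
  qed
  moreover have "approximable (\<lambda>x. (1 - ?g x) * w x)"
  proof (rule insert.IH)
    show "(\<lambda>x. (1 - ?g x) * w x) \<in> W" by (rule w2)
    fix x
    show "0 \<le> (1 - ?g x) * w x" using insert.prems by (intro mult_nonneg_nonneg) auto
    assume "(1 - ?g x) * w x \<noteq> 0"
    then have "?g x \<noteq> 1" "w x \<noteq> 0" by auto
    then obtain q where q: "q \<in> insert b F" "x \<in> ball q (\<rho> q / 2)" using insert.prems by blast
    have "x \<notin> ball b (\<rho> b / 2)"
    proof
      assume "x \<in> ball b (\<rho> b / 2)"
      then have "2 * dist x b / \<rho> b < 1" using \<rho> by (simp add: field_simps dist_commute)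
      then show False using \<open>?g x \<noteq> 1\<close> by (simp add: max_def min_def)
    qed
    then show "\<exists>q\<in>F. x \<in> ball q (\<rho> q / 2)" using q by auto
  qed (use insert.prems in auto)
  ultimately have "approximable (\<lambda>x. ?g x * w x + (1 - ?g x) * w x)" by (rule approximable_add)
  then show ?case by (simp add: algebra_simps)
qed

lemma W_approximable:
  assumes lip: "lipschitz_boundary \<Omega>" and w: "w \<in> W" "\<And>x. 0 \<le> w x"
  shows "approximable w"
proof -
  have "\<exists>\<rho>. inward_at \<Omega> b \<rho>" if "b \<in> closure \<Omega>" for b
    using that inward_at_interior[OF open_domain] inward_at_boundary[OF lip]
    by (cases "b \<in> \<Omega>") (auto simp: frontier_def interior_open[OF open_domain])
  then obtain \<rho> where \<rho>: "\<And>b. b \<in> closure \<Omega> \<Longrightarrow> inward_at \<Omega> b (\<rho> b)" by metis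
  have "compact (closure \<Omega>)" using bounded_domain by (simp add: compact_closure)
  then obtain F where F: "F \<subseteq> closure \<Omega>" "finite F" "closure \<Omega> \<subseteq> (\<Union>b\<in>F. ball b (\<rho> b / 2))"
  proof (rule compactE_image)
    show "closure \<Omega> \<subseteq> (\<Union>b\<in>closure \<Omega>. ball b (\<rho> b / 2))"
      using \<rho> by (fastforce simp: inward_at_def)
  qed auto
  show ?thesis
  proof (rule approximable_cover[OF F(2) _ w])
    show "inward_at \<Omega> b (\<rho> b)" if "b \<in> F" for b using that F \<rho> by blast
    fix x assume "w x \<noteq> 0"
    then have "x \<in> closure \<Omega>" using W_supported[OF w(1)] closure_subset by (auto simp: supported_def)
    then show "\<exists>b\<in>F. x \<in> ball b (\<rho> b / 2)" using F(3) by blast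
  qed
qed

end

section \<open>Minimisation\<close>

text \<open>This quantitative concavity makes minimising sequences Cauchy in the mean, so that no compact
  embedding is needed.\<close>

lemma powr_midpoint_gap:
  fixes a b q :: real
  assumes q: "0 < q" "q < 1" and ab: "0 \<le> a" "0 \<le> b"
  shows "q * (1 - q) / 8 * (a powr (q/2) - b powr (q/2))\<^sup>2 \<le> ((a + b) / 2) powr q - (a powr q + b powr q) / 2"
proof -
  have main: "q * (1 - q) / 8 * (a powr (q/2) - b powr (q/2))\<^sup>2 \<le> ((a + b) / 2) powr q - (a powr q + b powr q) / 2"
    if ab: "0 \<le> a" "a \<le> b" "0 < b" for a b :: real
  proof (cases "a = 0")
    \<comment> \<open>For \<open>a = 0\<close> the claim reduces to
      \<open>q * (1 - q) / 8 \<le> (1/2) powr q - 1/2\<close>. It follows from \<open>2 * (1/2) powr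
      q = exp ((1 - q) * ln 2) \<ge> 1 + (1 - q) * ln 2\<close> and
      \<open>ln 2 \<ge> 1/2\<close>.\<close>
    case True
    have "1/2 \<le> ln (2::real)" using ln_le_minus_one[of "1/2::real"] by (simp add: ln_div)
    then have "(1 - q) * (1/2) \<le> (1 - q) * ln 2" using q by (intro mult_left_mono) auto
    then have 1: "(1 - q) / 2 \<le> (1 - q) * ln 2" by simp
    have "q * (1 - q) \<le> 1 * (1 - q)" using q by (intro mult_right_mono) auto
    then have 2: "q * (1 - q) \<le> 1 - q" by simp
    have 3: "1 + (1 - q) * ln 2 \<le> exp ((1 - q) * ln 2)" by (rule exp_ge_add_one_self)
    have 4: "exp ((1 - q) * ln 2) = 2 * (1/2) powr q"
    proof -
      have "(1/2) powr q = exp (- (q * ln 2))" by (simp add: powr_def ln_div)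
      moreover have "(1 - q) * ln 2 = ln 2 + - (q * ln 2)" by (simp add: algebra_simps)
      then have "exp ((1 - q) * ln 2) = exp (ln 2) * exp (- (q * ln 2))" by (simp only: exp_add)
      ultimately show ?thesis by simp
    qed
    have "q * (1 - q) / 8 \<le> (1/2) powr q - 1/2"
    proof -
      have "w / 8 \<le> z - 1/2" if "x / 2 \<le> y" "w \<le> x" "1 + y \<le> 2 * z" "0 \<le> x" for w x y z :: real
        using that by linarith
      from this[OF 1 2 3[unfolded 4]] show ?thesis using q by simp
    qed
    then have "q * (1 - q) / 8 * b powr q \<le> ((1/2) powr q - 1/2) * b powr q" by (intro mult_right_mono) auto
    moreover have "(b / 2) powr q = (1/2) powr q * b powr q" using ab by (simp add: powr_mult[symmetric])
    moreover have "(b powr (q/2))\<^sup>2 = b powr q" using ab by (simp add: power2_eq_square powr_add[symmetric])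
    ultimately show ?thesis using True by (simp add: algebra_simps)
  next
    case False
    then have a: "0 < a" using ab by simp
    \<comment> \<open>On \<open>{a..b}\<close> the second derivative of \<open>- (t powr q)\<close>
      is at least its value \<open>?k\<close> at \<open>b\<close>. Subtracting the parabola
      \<open>?k / 2 * t\<^sup>2\<close> therefore leaves a convex function, and the midpoint
      inequality gains the gap of the parabola.\<close>
    let ?k = "q * (1 - q) * b powr (q - 2)"
    let ?g = "\<lambda>t. - (t powr q) - ?k / 2 * t\<^sup>2"
    have "convex_on {a..b} ?g"
    proof (rule f''_ge0_imp_convex)
      show "(?g has_real_derivative - (q * t powr (q - 1)) - ?k * t) (at t)" if "t \<in> {a..b}" for t
        using that a by (auto intro!: derivative_eq_intros)
      show "((\<lambda>t. - (q * t powr (q - 1)) - ?k * t) has_real_derivative q * (1 - q) * t powr (q - 2) - ?k) (at t)"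
        if "t \<in> {a..b}" for t
        using that a by (auto intro!: derivative_eq_intros simp: algebra_simps)
      show "0 \<le> q * (1 - q) * t powr (q - 2) - ?k" if "t \<in> {a..b}" for t
      proof -
        have "b powr (q - 2) \<le> t powr (q - 2)" using that a q by (intro powr_mono2') auto
        then have "?k \<le> q * (1 - q) * t powr (q - 2)" using q by (intro mult_left_mono) auto
        then show ?thesis by simp
      qed
    qed simp
    then have "?g ((1 - 1/2) *\<^sub>R a + (1/2) *\<^sub>R b) \<le> (1 - 1/2) * ?g a + 1/2 * ?g b"
      by (rule convex_onD) (use ab in auto)
    then have "?g ((a + b) / 2) \<le> (?g a + ?g b) / 2" by (simp add: field_simps)
    moreover have "?k / 2 * ((a\<^sup>2 + b\<^sup>2) / 2 - ((a + b) / 2)\<^sup>2) = q * (1 - q) / 8 * (b powr (q - 2) * (b - a)\<^sup>2)"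
      by (simp add: power2_eq_square field_simps)
    ultimately have 1: "q * (1 - q) / 8 * (b powr (q - 2) * (b - a)\<^sup>2) \<le> ((a + b) / 2) powr q - (a powr q + b powr q) / 2"
      by (simp add: algebra_simps add_divide_distrib diff_divide_distrib)
    have "(b powr (q/2) - a powr (q/2))\<^sup>2 \<le> b powr (q - 2) * (b - a)\<^sup>2"
    proof -
      \<comment> \<open>By homogeneity only the ratio matters, and
        \<open>\<theta> \<le> \<theta> powr (q/2) \<le> 1\<close> compares the two squares.\<close>
      define \<theta> where "\<theta> = a / b"
      have th: "0 < \<theta>" "\<theta> \<le> 1" "a = \<theta> * b" using a ab by (auto simp: \<theta>_def)
      have "\<theta> powr 1 \<le> \<theta> powr (q/2)" using th q by (intro powr_mono') auto
      then have t1: "\<theta> \<le> \<theta> powr (q/2)" using th by simp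
      have t2: "\<theta> powr (q/2) \<le> 1" using th q powr_mono2[of "q/2" \<theta> 1] by simp
      have "a powr (q/2) = \<theta> powr (q/2) * b powr (q/2)" using th ab by (simp add: powr_mult)
      then have "(b powr (q/2) - a powr (q/2))\<^sup>2 = (b powr (q/2))\<^sup>2 * (1 - \<theta> powr (q/2))\<^sup>2"
        by (simp add: power2_eq_square algebra_simps)
      also have "\<dots> \<le> (b powr (q/2))\<^sup>2 * (1 - \<theta>)\<^sup>2" using t1 t2 by (intro mult_left_mono power_mono) auto
      also have "(b powr (q/2))\<^sup>2 = b powr (q - 2) * b\<^sup>2"
      proof -
        have "(b powr (q/2))\<^sup>2 = b powr q" using ab by (simp add: power2_eq_square powr_add[symmetric])
        also have "\<dots> = b powr (q - 2) * b powr 2" by (simp add: powr_add[symmetric])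
        also have "b powr 2 = b\<^sup>2" using ab by simp
        finally show ?thesis .
      qed
      also have "b powr (q - 2) * b\<^sup>2 * (1 - \<theta>)\<^sup>2 = b powr (q - 2) * (b - a)\<^sup>2"
        unfolding th(3) by (simp add: power2_eq_square algebra_simps)
      finally show ?thesis .
    qed
    then have "q * (1 - q) / 8 * (b powr (q/2) - a powr (q/2))\<^sup>2 \<le> q * (1 - q) / 8 * (b powr (q - 2) * (b - a)\<^sup>2)"
      using q by (intro mult_left_mono) auto
    with 1 show ?thesis by (simp add: power2_commute)
  qed
  consider "a = 0" "b = 0" | "a \<le> b" "0 < b" | "b \<le> a" "0 < a" using ab by linarith
  then show ?thesis
  proof cases
    case 3
    then show ?thesis using main[of b a] ab by (simp add: power2_commute add.commute)
  qed (use main[of a b] ab in auto)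
qed

text \<open>Factor the difference as \<open>A\<^sup>2 - B\<^sup>2 = (A - B) * (A + B)\<close> with
  \<open>A = a powr (q/2)\<close>, \<open>B = b powr (q/2)\<close>, and apply Young's inequality
  with weight \<open>d\<close>: the first factor is paid for by the concavity gap, the second by a
  small multiple of the total.\<close>

lemma powr_diff_le_gap:
  fixes a b q d :: real
  assumes q: "0 < q" "q < 1" and ab: "0 \<le> a" "0 \<le> b" and d: "0 < d"
  shows "\<bar>a powr q - b powr q\<bar>
    \<le> 4 / (q * (1 - q) * d) * (((a + b) / 2) powr q - (a powr q + b powr q) / 2) + d * (a powr q + b powr q)"
proof -
  define A where "A = a powr (q/2)" define B where "B = b powr (q/2)"
  define G where "G = ((a + b) / 2) powr q - (a powr q + b powr q) / 2"
  have AB: "A\<^sup>2 = a powr q" "B\<^sup>2 = b powr q" "0 \<le> A" "0 \<le> B"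
    by (simp_all add: A_def B_def power2_eq_square powr_add[symmetric])
  have k: "0 < q * (1 - q)" using q by simp
  have gap: "q * (1 - q) / 8 * (A - B)\<^sup>2 \<le> G" unfolding A_def B_def G_def by (rule powr_midpoint_gap[OF q ab])
  then have g: "(A - B)\<^sup>2 \<le> 8 / (q * (1 - q)) * G" using k by (simp add: field_simps)
  have "A\<^sup>2 - B\<^sup>2 = (A - B) * (A + B)" by (simp add: power2_eq_square algebra_simps)
  then have "\<bar>A\<^sup>2 - B\<^sup>2\<bar> = \<bar>A - B\<bar> * (A + B)" using AB(3,4) by (simp only: abs_mult abs_of_nonneg add_nonneg_nonneg)
  also have "\<dots> \<le> (A - B)\<^sup>2 / (2 * d) + d / 2 * (A + B)\<^sup>2"
  proof -
    have "2 * d * (x * y) \<le> x\<^sup>2 + d\<^sup>2 * y\<^sup>2" for x y :: real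
      using zero_le_power2[of "x - d * y"] by (simp add: power2_diff power_mult_distrib algebra_simps)
    from this[of "\<bar>A - B\<bar>" "A + B"]
    have "2 * d * (\<bar>A - B\<bar> * (A + B)) \<le> (A - B)\<^sup>2 + d\<^sup>2 * (A + B)\<^sup>2" by (simp only: power2_abs)
    then show ?thesis using d by (simp add: field_simps power2_eq_square)
  qed
  also have "\<dots> \<le> (A - B)\<^sup>2 / (2 * d) + d * (A\<^sup>2 + B\<^sup>2)"
  proof -
    have "(A + B)\<^sup>2 \<le> 2 * (A\<^sup>2 + B\<^sup>2)" using sum_squares_bound[of A B] by (simp add: power2_sum)
    then have "d / 2 * (A + B)\<^sup>2 \<le> d / 2 * (2 * (A\<^sup>2 + B\<^sup>2))" using d by (intro mult_left_mono) auto
    also have "\<dots> = d * (A\<^sup>2 + B\<^sup>2)" by (simp add: algebra_simps)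
    finally show ?thesis by simp
  qed
  also have "(A - B)\<^sup>2 / (2 * d) \<le> (8 / (q * (1 - q)) * G) / (2 * d)" using g d by (intro divide_right_mono) auto
  also have "(8 / (q * (1 - q)) * G) / (2 * d) = 4 / (q * (1 - q) * d) * G" using d k by simp
  finally show ?thesis unfolding AB G_def by simp
qed

section \<open>The functional and its minimiser\<close>

locale singular_problem = frac_setting P p s \<Omega> for P p s and \<Omega> :: "'a::euclidean_space set" +
  fixes q :: real
  assumes q: "0 < q" "q < 1"
begin

text \<open>Finite energy is required at scale 1, which makes this the effective domain of
  \<open>J\<close> among nonnegative functions. It is convex, but a multiple of a member by a
  constant above 1 may leave it.\<close>

definition X :: "('a \<Rightarrow> real) set" where
  "X = {u. supported u \<and> (\<forall>x. 0 \<le> u x) \<and> energy u < \<infinity>}"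

definition E :: "('a \<Rightarrow> real) \<Rightarrow> real" where
  "E u = (\<integral>p. P (D_frac s u p) \<partial>frac_lborel)"

definition J :: "('a \<Rightarrow> real) \<Rightarrow> real" where
  "J u = (1 - s) / 2 * E u - 1 / q * (\<integral>x. u x powr q \<partial>lborel)"

lemma X_supported: "u \<in> X \<Longrightarrow> supported u" by (simp add: X_def)

lemma X_nonneg: "u \<in> X \<Longrightarrow> 0 \<le> u x" by (simp add: X_def)

lemma X_measurable [measurable_dest]: "u \<in> X \<Longrightarrow> u \<in> borel_measurable borel"
  by (simp add: X_def supported_def)

lemma X_W: "u \<in> X \<Longrightarrow> u \<in> W"
  unfolding X_def W_def by (intro CollectI conjI exI[of _ 1]) auto

lemma X_energy_integrable:
  assumes "u \<in> X" shows "integrable frac_lborel (\<lambda>p. P (D_frac s u p))"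
proof (rule integrableI_nonneg)
  have [measurable]: "u \<in> borel_measurable borel" using assms by measurable
  show "(\<lambda>p. P (D_frac s u p)) \<in> borel_measurable frac_lborel" by measurable
qed (use assms in \<open>auto simp: X_def energy_def\<close>)

lemma E_nonneg: "0 \<le> E u" unfolding E_def by (rule integral_nonneg_AE) simp

lemma X_convex:
  assumes u: "u \<in> X" and v: "v \<in> X" and l: "0 \<le> l" "l \<le> 1"
  shows "(\<lambda>x. (1 - l) * u x + l * v x) \<in> X" "E (\<lambda>x. (1 - l) * u x + l * v x) \<le> (1 - l) * E u + l * E v"
proof -
  let ?w = "\<lambda>x. (1 - l) * u x + l * v x"
  have [measurable]: "u \<in> borel_measurable borel" "v \<in> borel_measurable borel" using u v by measurable
  note iu = X_energy_integrable[OF u] and iv = X_energy_integrable[OF v]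
  have le: "P (D_frac s ?w p) \<le> (1 - l) * P (D_frac s u p) + l * P (D_frac s v p)" for p
    unfolding D_frac_add D_frac_cmult by (rule P_convex_comb[OF l])
  have i: "integrable frac_lborel (\<lambda>p. (1 - l) * P (D_frac s u p) + l * P (D_frac s v p))"
    using iu iv by auto
  have iw: "integrable frac_lborel (\<lambda>p. P (D_frac s ?w p))"
    by (rule Bochner_Integration.integrable_bound[OF i])
      (use le in \<open>auto intro!: AE_I2 order_trans[OF _ abs_ge_self]\<close>)
  have "energy ?w = ennreal (\<integral>p. P (D_frac s ?w p) \<partial>frac_lborel)"
    unfolding energy_def by (rule nn_integral_eq_integral[OF iw]) simp
  then have "energy ?w < \<infinity>" by simp
  moreover have "supported ?w" using u v by (auto simp: X_def supported_def)
  moreover have "0 \<le> ?w x" for x using X_nonneg[OF u] X_nonneg[OF v] l by simp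
  ultimately show "?w \<in> X" by (simp add: X_def)
  have "E ?w \<le> (\<integral>p. (1 - l) * P (D_frac s u p) + l * P (D_frac s v p) \<partial>frac_lborel)"
    unfolding E_def by (rule integral_mono[OF iw i le])
  then show "E ?w \<le> (1 - l) * E u + l * E v" using iu iv by (simp add: E_def)
qed

text \<open>Only half of the coefficient \<open>(1 - s) / 2\<close> of the energy is spent on the
  power term, so \<open>J\<close> still controls \<open>(1 - s) / 4 * E\<close>. The slope
  \<open>1 / (q * k * d)\<close> cancels against the Poincare scale \<open>k\<close> and the factor
  \<open>d\<close>.\<close>

lemma coercive:
  obtains C where "\<And>u. u \<in> X \<Longrightarrow> integrable lborel (\<lambda>x. u x powr q)"
    "\<And>u. u \<in> X \<Longrightarrow> 1 / q * (\<integral>x. u x powr q \<partial>lborel) \<le> (1 - s) / 4 * E u + C"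
proof -
  obtain c k where ck: "0 < c" "0 < k" and
    poin: "\<And>u. supported u \<Longrightarrow> ennreal c * (\<integral>\<^sup>+x. P (k * u x) \<partial>lborel) \<le> energy u"
    using poincare by blast
  define d where "d = (1 - s) / 4 * c"
  have d: "0 < d" using s ck by (simp add: d_def)
  obtain B where B: "0 \<le> B" "\<And>t. 0 \<le> t \<Longrightarrow> (1 / (q * k * d)) * t \<le> P t + B" using P_superlinear by blast
  have pt: "1 / q * t powr q \<le> 1 / q + d * (P (k * t) + B)" if t: "0 \<le> t" for t
  proof -
    have "t powr q \<le> 1 + t"
    proof (cases "t \<le> 1")
      case True
      then have "t powr q \<le> 1 powr q" using t q by (intro powr_mono2) auto
      then show ?thesis using t by simp
    next
      case False
      then have "t powr q \<le> t powr 1" using q by (intro powr_mono) auto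
      then show ?thesis using False by simp
    qed
    then have "1 / q * t powr q \<le> 1 / q * (1 + t)" using q by (intro mult_left_mono) auto
    also have "\<dots> = 1 / q + d * ((1 / (q * k * d)) * (k * t))" using q ck d s by (simp add: field_simps)
    also have "\<dots> \<le> 1 / q + d * (P (k * t) + B)"
      using B(2)[of "k * t"] t ck d by (intro add_left_mono mult_left_mono) auto
    finally show ?thesis .
  qed
  let ?C = "(1 / q + d * B) * measure lborel \<Omega>"
  have "integrable lborel (\<lambda>x. u x powr q) \<and> 1 / q * (\<integral>x. u x powr q \<partial>lborel) \<le> (1 - s) / 4 * E u + ?C" if u: "u \<in> X" for u
  proof -
    have [measurable]: "u \<in> borel_measurable borel" using u by measurable
    have eE: "energy u = ennreal (E u)"
      unfolding energy_def E_def by (rule nn_integral_eq_integral[OF X_energy_integrable[OF u]]) simp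
    have p1: "ennreal c * (\<integral>\<^sup>+x. P (k * u x) \<partial>lborel) \<le> ennreal (E u)" using poin[OF X_supported[OF u]] eE by simp
    have "ennreal c * (\<integral>\<^sup>+x. P (k * u x) \<partial>lborel) < \<infinity>" using p1 by (rule order_le_less_trans) simp
    then have fin: "(\<integral>\<^sup>+x. P (k * u x) \<partial>lborel) < \<infinity>" using ck by (auto simp: ennreal_mult_less_top)
    have iP: "integrable lborel (\<lambda>x. P (k * u x))" using fin by (intro integrableI_nonneg) auto
    have "ennreal (c * (\<integral>x. P (k * u x) \<partial>lborel)) \<le> ennreal (E u)"
      using p1 ck by (simp add: nn_integral_eq_integral[OF iP] ennreal_mult integral_nonneg_AE)
    then have p2: "c * (\<integral>x. P (k * u x) \<partial>lborel) \<le> E u" using E_nonneg by (simp add: ennreal_le_iff)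
    let ?F = "\<lambda>x. (1 / q + d * B) * indicator \<Omega> x + d * P (k * u x)"
    have iF: "integrable lborel ?F"
      using emeasure_domain by (intro Bochner_Integration.integrable_add integrable_mult_right iP) simp_all
    have le: "1 / q * u x powr q \<le> ?F x" for x
    proof (cases "x \<in> \<Omega>")
      case True
      then show ?thesis using pt[OF X_nonneg[OF u], of x] by (simp add: distrib_left)
    next
      case False
      then have "u x = 0" using X_supported[OF u] by (simp add: supported_def)
      then show ?thesis using False by simp
    qed
    have iq: "integrable lborel (\<lambda>x. 1 / q * u x powr q)"
      by (rule Bochner_Integration.integrable_bound[OF iF])
        (use le q in \<open>auto intro!: AE_I2 order_trans[OF _ abs_ge_self]\<close>)
    then have "integrable lborel (\<lambda>x. q * (1 / q * u x powr q))" by (rule integrable_mult_right)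
    then have iq': "integrable lborel (\<lambda>x. u x powr q)" using q by simp
    have "1 / q * (\<integral>x. u x powr q \<partial>lborel) = (\<integral>x. 1 / q * u x powr q \<partial>lborel)" by simp
    also have "\<dots> \<le> (\<integral>x. ?F x \<partial>lborel)" by (rule integral_mono[OF iq iF le])
    also have "\<dots> = ?C + d * (\<integral>x. P (k * u x) \<partial>lborel)"
      using emeasure_domain iP by (subst Bochner_Integration.integral_add) simp_all
    also have "\<dots> = ?C + (1 - s) / 4 * (c * (\<integral>x. P (k * u x) \<partial>lborel))" by (simp only: d_def mult.assoc)
    also have "\<dots> \<le> ?C + (1 - s) / 4 * E u" using p2 s by (intro add_left_mono mult_left_mono) auto
    finally show ?thesis using iq' by simp
  qed
  then show ?thesis using that by blast
qed

lemma X_powr_integrable: "u \<in> X \<Longrightarrow> integrable lborel (\<lambda>x. u x powr q)"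
  using coercive by blast

text \<open>The direct method, with convergence in the mean of the powers \<open>u n powr q\<close>
  in place of weak compactness and with Fatou's lemma for the lower semicontinuity of the
  energy.\<close>

lemma minimiser_exists: "\<exists>u\<in>X. \<forall>v\<in>X. J u \<le> J v"
proof -
  let ?c = "(1 - s) / 2"
  have c: "0 < ?c" using s by simp
  obtain C where C: "\<And>u. u \<in> X \<Longrightarrow> 1 / q * (\<integral>x. u x powr q \<partial>lborel) \<le> (1 - s) / 4 * E u + C" using coercive by blast
  have Jlow: "(1 - s) / 4 * E u - C \<le> J u" if "u \<in> X" for u
    using C[OF that] unfolding J_def by (simp add: field_simps)
  have "(\<lambda>x. 0) \<in> X" by (simp add: X_def supported_def energy_def D_frac_apply)
  then have ne: "J ` X \<noteq> {}" by blast
  define m where "m = Inf (J ` X)"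
  have bdd: "bdd_below (J ` X)"
  proof (rule bdd_belowI2)
    fix u assume "u \<in> X"
    then show "- C \<le> J u" using Jlow[of u] E_nonneg[of u] s by (smt (verit) divide_nonneg_pos mult_nonneg_nonneg)
  qed
  have m: "m \<le> J u" if "u \<in> X" for u unfolding m_def using bdd that by (intro cInf_lower) auto
  have "\<exists>u\<in>X. J u < m + inverse (real (Suc n))" for n
    using cInf_lessD[OF ne, of "m + inverse (real (Suc n))"] by (auto simp: m_def)
  then obtain u where u: "\<And>n. u n \<in> X" "\<And>n. J (u n) < m + inverse (real (Suc n))" by metis
  have [measurable]: "u n \<in> borel_measurable borel" for n using u(1) by measurable
  define A where "A n x = u n x powr q" for n x
  have [measurable]: "A n \<in> borel_measurable borel" for n unfolding A_def by measurable
  have iA: "integrable lborel (A n)" for n unfolding A_def by (rule X_powr_integrable[OF u(1)])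
  define Q where "Q = q * (\<bar>m\<bar> + 1 + 2 * \<bar>C\<bar>) + 1"
  have Q: "0 < Q" using q by (simp add: Q_def add_nonneg_pos)
  have AQ: "(\<integral>x. A n x \<partial>lborel) \<le> Q" for n
  proof -
    have "inverse (real (Suc n)) \<le> 1" by (simp add: field_simps)
    then have "(1 - s) / 4 * E (u n) \<le> \<bar>m\<bar> + 1 + \<bar>C\<bar>" using Jlow[OF u(1)[of n]] u(2)[of n] by linarith
    then have "1 / q * (\<integral>x. A n x \<partial>lborel) \<le> \<bar>m\<bar> + 1 + 2 * \<bar>C\<bar>" using C[OF u(1)[of n]] unfolding A_def by linarith
    then have "(\<integral>x. A n x \<partial>lborel) \<le> q * (\<bar>m\<bar> + 1 + 2 * \<bar>C\<bar>)" using q by (simp add: field_simps)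
    then show ?thesis by (simp add: Q_def)
  qed
  \<comment> \<open>The midpoint of two nearly optimal functions is again a competitor, so the
    integrated concavity gap is at most \<open>q * inverse (real (Suc N))\<close>.\<close>
  have cauchy: "\<exists>N. \<forall>i\<ge>N. \<forall>j\<ge>N. (\<integral>x. norm (A i x - A j x) \<partial>lborel) < e" if e: "0 < e" for e
  proof -
    \<comment> \<open>The two terms of \<open>powr_diff_le_gap\<close> contribute at most
      \<open>e / 2\<close> each: the second is at most \<open>d * (2 * Q)\<close>, and
      \<open>N\<close> is chosen for the first.\<close>
    define d where "d = e / (4 * Q)"
    have d: "0 < d" "d * (2 * Q) = e / 2" using e Q by (auto simp: d_def)
    define K where "K = 4 / (q * (1 - q) * d)"
    have K: "0 < K" using q d by (simp add: K_def)
    obtain N where N: "inverse (real (Suc N)) < e / (2 * (K * q))"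
      using reals_Archimedean[of "e / (2 * (K * q))", OF divide_pos_pos[OF e mult_pos_pos[OF _ mult_pos_pos[OF K q(1)]]]]
      by auto
    have "(\<integral>x. norm (A i x - A j x) \<partial>lborel) < e" if ij: "N \<le> i" "N \<le> j" for i j
    proof -
      let ?w = "\<lambda>x. (1 - 1/2) * u i x + 1/2 * u j x"
      have wX: "?w \<in> X" "E ?w \<le> (1 - 1/2) * E (u i) + 1/2 * E (u j)"
        using X_convex[OF u(1)[of i] u(1)[of j], of "1/2"] by auto
      have we: "?w x powr q = ((u i x + u j x) / 2) powr q" for x by (simp add: field_simps)
      have iw: "integrable lborel (\<lambda>x. ((u i x + u j x) / 2) powr q)" using X_powr_integrable[OF wX(1)] by (simp only: we)
      have "m \<le> J ?w" by (rule m[OF wX(1)])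
      have le: "inverse (real (Suc i)) \<le> inverse (real (Suc N))" "inverse (real (Suc j)) \<le> inverse (real (Suc N))"
        using ij by (auto intro!: le_imp_inverse_le)
      let ?G = "\<lambda>x. ((u i x + u j x) / 2) powr q - (A i x + A j x) / 2"
      have iG: "integrable lborel ?G" using iw iA by auto
      have "(\<integral>x. ?G x \<partial>lborel) = (\<integral>x. ((u i x + u j x) / 2) powr q \<partial>lborel)
        - ((\<integral>x. A i x \<partial>lborel) + (\<integral>x. A j x \<partial>lborel)) / 2"
        using iw iA by simp
      then have "1 / q * (\<integral>x. ?G x \<partial>lborel) = 1 / q * (\<integral>x. ((u i x + u j x) / 2) powr q \<partial>lborel)
        - (1 / q * (\<integral>x. A i x \<partial>lborel) + 1 / q * (\<integral>x. A j x \<partial>lborel)) / 2"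
        using q by (simp add: field_simps)
      also have "\<dots> = ?c * E ?w - J ?w - ((?c * E (u i) - J (u i)) + (?c * E (u j) - J (u j))) / 2"
        unfolding J_def A_def we by simp
      also have "\<dots> \<le> (J (u i) + J (u j)) / 2 - m"
      proof -
        have "?c * E ?w \<le> ?c * ((1 - 1/2) * E (u i) + 1/2 * E (u j))" using wX(2) c by (intro mult_left_mono) auto
        also have "\<dots> = (?c * E (u i) + ?c * E (u j)) / 2" by (simp add: algebra_simps add_divide_distrib)
        finally show ?thesis using \<open>m \<le> J ?w\<close> by (simp add: add_divide_distrib diff_divide_distrib)
      qed
      also have "\<dots> \<le> inverse (real (Suc N))"
      proof -
        have "(a + b) / 2 - m \<le> n" if "a < m + k" "b < m + l" "k \<le> n" "l \<le> n" for a b k l n :: real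
          using that by (simp add: field_simps)
        from this[OF u(2)[of i] u(2)[of j] le] show ?thesis .
      qed
      finally have "(\<integral>x. ?G x \<partial>lborel) \<le> q * inverse (real (Suc N))" using q by (simp add: field_simps)
      then have "K * (\<integral>x. ?G x \<partial>lborel) \<le> K * (q * inverse (real (Suc N)))" using K by (intro mult_left_mono) auto
      also have "\<dots> < e / 2"
      proof -
        have "inverse (real (Suc N)) * (2 * (K * q)) < e" using N K q by (subst (asm) pos_less_divide_eq) auto
        then show ?thesis by (simp add: mult_ac)
      qed
      finally have G: "K * (\<integral>x. ?G x \<partial>lborel) < e / 2" .
      have iR: "integrable lborel (\<lambda>x. K * ?G x + d * (A i x + A j x))" using iG iA by auto
      have "(\<integral>x. norm (A i x - A j x) \<partial>lborel) \<le> (\<integral>x. K * ?G x + d * (A i x + A j x) \<partial>lborel)"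
      proof (rule integral_mono[OF _ iR])
        show "integrable lborel (\<lambda>x. norm (A i x - A j x))"
          by (intro integrable_norm Bochner_Integration.integrable_diff iA)
        show "norm (A i x - A j x) \<le> K * ?G x + d * (A i x + A j x)" for x
          unfolding A_def real_norm_def K_def by (rule powr_diff_le_gap[OF q X_nonneg[OF u(1)] X_nonneg[OF u(1)] d(1)])
      qed
      also have "\<dots> = K * (\<integral>x. ?G x \<partial>lborel) + d * ((\<integral>x. A i x \<partial>lborel) + (\<integral>x. A j x \<partial>lborel))"
        using iG iA by (subst Bochner_Integration.integral_add) auto
      also have "d * ((\<integral>x. A i x \<partial>lborel) + (\<integral>x. A j x \<partial>lborel)) \<le> d * (2 * Q)"
        using AQ[of i] AQ[of j] d by (intro mult_left_mono) auto
      finally show ?thesis using G d(2) by linarith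
    qed
    then show ?thesis by blast
  qed
  obtain r where r: "strict_mono r" "AE x in lborel. Cauchy (\<lambda>i. A (r i) x)"
    using cauchy_L1_AE_cauchy_subseq[of lborel A] iA cauchy by blast
  define U where "U x = lim (\<lambda>i. A (r i) x)" for x
  have [measurable]: "U \<in> borel_measurable borel" unfolding U_def by (rule borel_measurable_lim_metric) measurable
  have AU: "AE x in lborel. (\<lambda>i. A (r i) x) \<longlonglongrightarrow> U x"
    using r(2) by eventually_elim (simp add: U_def Cauchy_convergent_iff convergent_LIMSEQ_iff)
  \<comment> \<open>The positive part makes \<open>w\<close> nonnegative everywhere, including the
    null set on which \<open>lim\<close> may be an arbitrary value.\<close>
  define w where "w x = max 0 (U x) powr (1 / q)" for x
  have wq: "w x powr q = max 0 (U x)" for x using q by (simp add: w_def powr_powr)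
  have [measurable]: "w \<in> borel_measurable borel" unfolding w_def by measurable
  have uw: "AE x in lborel. (\<lambda>i. u (r i) x) \<longlonglongrightarrow> w x \<and> 0 \<le> U x"
    using AU
  proof eventually_elim
    case (elim x)
    have U0: "0 \<le> U x" by (rule LIMSEQ_le_const[OF elim]) (simp add: A_def)
    have "(\<lambda>i. A (r i) x powr (1 / q)) \<longlonglongrightarrow> U x powr (1 / q)"
      using q by (intro tendsto_powr' elim tendsto_const) (auto simp: A_def)
    moreover have "A (r i) x powr (1 / q) = u (r i) x" for i
      using X_nonneg[OF u(1)] q by (simp add: A_def powr_powr)
    ultimately show ?case using U0 by (simp add: w_def)
  qed
  have wsupp: "supported w"
  proof -
    have "U x = 0" if "x \<notin> \<Omega>" for x
      using X_supported[OF u(1)] that by (simp add: U_def A_def supported_def)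
    then show ?thesis by (simp add: supported_def w_def)
  qed
  have iU: "integrable lborel U"
  proof (rule fatou_real(1)[of lborel "\<lambda>i. A (r i)"])
    show "\<exists>\<^sub>F n in sequentially. (\<integral>x. A (r n) x \<partial>lborel) \<le> Q"
      using AQ by (intro eventually_frequently always_eventually) auto
  qed (use iA AU in \<open>auto simp: A_def\<close>)
  \<comment> \<open>An upper bound for the power integrals is what is called for: together with
    \<open>J (u (r n))\<close> close to \<open>m\<close> it bounds the energies from above.\<close>
  have L1: "\<forall>\<^sub>F n in sequentially. (\<integral>x. A (r n) x \<partial>lborel) \<le> (\<integral>x. U x \<partial>lborel) + e" if e: "0 < e" for e
  proof -
    obtain N where N: "\<And>i j. N \<le> i \<Longrightarrow> N \<le> j \<Longrightarrow> (\<integral>x. norm (A i x - A j x) \<partial>lborel) < e" using cauchy[OF e] by blast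
    have "(\<integral>x. A (r n) x \<partial>lborel) \<le> (\<integral>x. U x \<partial>lborel) + e" if n: "N \<le> n" for n
    proof -
      have rn: "N \<le> r n" using n seq_suble[OF r(1), of n] by linarith
      have "(\<integral>x. \<bar>A (r n) x - U x\<bar> \<partial>lborel) \<le> e"
      proof (rule fatou_real(2)[of lborel "\<lambda>j x. \<bar>A (r n) x - A (r j) x\<bar>"])
        show "integrable lborel (\<lambda>x. \<bar>A (r n) x - A (r j) x\<bar>)" for j
          by (intro integrable_abs Bochner_Integration.integrable_diff iA)
        show "AE x in lborel. (\<lambda>j. \<bar>A (r n) x - A (r j) x\<bar>) \<longlonglongrightarrow> \<bar>A (r n) x - U x\<bar>"
          using AU by eventually_elim (intro tendsto_intros)
        have "\<forall>\<^sub>F j in sequentially. (\<integral>x. \<bar>A (r n) x - A (r j) x\<bar> \<partial>lborel) \<le> e"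
          unfolding eventually_sequentially
        proof (intro exI allI impI)
          fix j assume "N \<le> j"
          then have "N \<le> r j" using seq_suble[OF r(1), of j] by linarith
          then show "(\<integral>x. \<bar>A (r n) x - A (r j) x\<bar> \<partial>lborel) \<le> e" using N[OF rn, of "r j"] by simp
        qed
        then show "\<exists>\<^sub>F j in sequentially. (\<integral>x. \<bar>A (r n) x - A (r j) x\<bar> \<partial>lborel) \<le> e"
          by (rule eventually_frequently[OF sequentially_bot])
      qed auto
      moreover have "(\<integral>x. A (r n) x - U x \<partial>lborel) \<le> (\<integral>x. \<bar>A (r n) x - U x\<bar> \<partial>lborel)"
        using iA iU by (intro integral_mono integrable_abs Bochner_Integration.integrable_diff) auto
      moreover have "(\<integral>x. A (r n) x - U x \<partial>lborel) = (\<integral>x. A (r n) x \<partial>lborel) - (\<integral>x. U x \<partial>lborel)"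
        using iA iU by simp
      ultimately show ?thesis by linarith
    qed
    then show ?thesis unfolding eventually_sequentially by blast
  qed
  have wU: "(\<integral>x. w x powr q \<partial>lborel) = (\<integral>x. U x \<partial>lborel)"
  proof (rule integral_cong_AE)
    show "AE x in lborel. w x powr q = U x" using uw by eventually_elim (simp add: wq)
  qed measurable
  have Dw: "AE p in frac_lborel. (\<lambda>n. P (D_frac s (u (r n)) p)) \<longlonglongrightarrow> P (D_frac s w p)"
  proof -
    have "AE x in lborel. (\<lambda>i. u (r i) x) \<longlonglongrightarrow> w x" using uw by eventually_elim simp
    from AE_frac_lborel[OF this] show ?thesis
    proof eventually_elim
      case (elim p)
      have "(\<lambda>n. (u (r n) (fst p) - u (r n) (snd p)) * inverse (norm (fst p - snd p) powr s))
        \<longlonglongrightarrow> (w (fst p) - w (snd p)) * inverse (norm (fst p - snd p) powr s)"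
        using elim by (intro tendsto_mult_right tendsto_diff) auto
      then show ?case by (intro P_tendsto) (simp add: D_frac_apply divide_inverse)
    qed
  qed
  have bound: "integrable frac_lborel (\<lambda>p. P (D_frac s w p)) \<and> ?c * E w \<le> m + 1 / q * (\<integral>x. U x \<partial>lborel) + e" if e: "0 < e" for e
  proof -
    let ?B = "(m + 1 / q * (\<integral>x. U x \<partial>lborel) + e) / ?c"
    have "\<forall>\<^sub>F n in sequentially. inverse (real (Suc n)) < e / 2"
      using e by (intro order_tendstoD(2)[OF LIMSEQ_inverse_real_of_nat]) simp
    moreover have "\<forall>\<^sub>F n in sequentially. (\<integral>x. A (r n) x \<partial>lborel) \<le> (\<integral>x. U x \<partial>lborel) + q * (e / 2)"
      using e q by (intro L1) simp
    ultimately have ev: "\<forall>\<^sub>F n in sequentially. (\<integral>p. P (D_frac s (u (r n)) p) \<partial>frac_lborel) \<le> ?B"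
    proof eventually_elim
      case (elim n)
      have "inverse (real (Suc (r n))) \<le> inverse (real (Suc n))"
        using seq_suble[OF r(1), of n] by (auto intro!: le_imp_inverse_le)
      then have "J (u (r n)) \<le> m + e / 2" using u(2)[of "r n"] elim(1) by linarith
      moreover have "1 / q * (\<integral>x. A (r n) x \<partial>lborel) \<le> 1 / q * (\<integral>x. U x \<partial>lborel) + e / 2"
        using elim(2) q by (simp add: field_simps)
      moreover have "?c * E (u (r n)) = J (u (r n)) + 1 / q * (\<integral>x. A (r n) x \<partial>lborel)"
        unfolding J_def A_def by simp
      ultimately have "?c * E (u (r n)) \<le> m + 1 / q * (\<integral>x. U x \<partial>lborel) + e" by linarith
      then show ?case unfolding E_def using c by (simp add: pos_le_divide_eq mult.commute)
    qed
    note f = fatou_real[of frac_lborel "\<lambda>n p. P (D_frac s (u (r n)) p)", OF X_energy_integrable[OF u(1)] _ Dw _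
      eventually_frequently[OF sequentially_bot ev]]
    have "integrable frac_lborel (\<lambda>p. P (D_frac s w p))" by (rule f(1)) auto
    moreover have "E w \<le> ?B" unfolding E_def by (rule f(2)) auto
    ultimately show ?thesis using c by (simp add: pos_le_divide_eq mult.commute)
  qed
  have "energy w = ennreal (E w)"
    unfolding energy_def E_def using bound[of 1] by (intro nn_integral_eq_integral) auto
  then have wX: "w \<in> X" using wsupp by (simp add: X_def w_def)
  have "J w \<le> m + e" if "0 < e" for e using bound[OF that] unfolding J_def wU by linarith
  then have "J w \<le> m" by (rule field_le_epsilon)
  then show ?thesis using wX m by (intro bexI[of _ w]) (auto intro: order_trans)
qed

end

section \<open>The Euler-Lagrange equation\<close>

text \<open>The power is not differentiable at 0, so an endpoint 0 is treated through
  \<open>t \<le> t powr q\<close> on the unit interval and the rest through the second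
  derivative.\<close>

lemma powr_concave:
  fixes a b q e :: real
  assumes q: "0 < q" "q < 1" and ab: "0 \<le> a" "0 \<le> b" and e: "0 \<le> e" "e \<le> 1"
  shows "(1 - e) * a powr q + e * b powr q \<le> ((1 - e) * a + e * b) powr q"
proof -
  have le: "t \<le> t powr q" if "0 \<le> t" "t \<le> 1" for t :: real
    using that q powr_mono'[of q 1 t] by (cases "t = 0") auto
  consider "a = 0" | "b = 0" | "0 < a" "0 < b" using ab by linarith
  then show ?thesis
  proof cases
    case 1
    then show ?thesis using le[of e] e ab by (simp add: powr_mult mult_right_mono)
  next
    case 2
    then show ?thesis using le[of "1 - e"] e ab by (simp add: powr_mult mult_right_mono)
  next
    case 3
    have "convex_on {0<..} (\<lambda>t. - (t powr q))"
    proof (rule f''_ge0_imp_convex)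
      show "((\<lambda>t. - (t powr q)) has_real_derivative - (q * t powr (q - 1))) (at t)" if "t \<in> {0<..}" for t
        using that by (auto intro!: derivative_eq_intros)
      show "((\<lambda>t. - (q * t powr (q - 1))) has_real_derivative q * (1 - q) * t powr (q - 2)) (at t)" if "t \<in> {0<..}" for t
        using that by (auto intro!: derivative_eq_intros simp: algebra_simps)
      show "0 \<le> q * (1 - q) * t powr (q - 2)" for t using q by simp
    qed simp
    from convex_onD[OF this e, of a b] 3 show ?thesis by simp
  qed
qed

lemma powr_difference_quotient_tendsto:
  fixes a d q :: real
  assumes a: "0 < a"
  shows "(\<lambda>n. ((a + inverse (real (Suc n)) * d) powr q - a powr q) / inverse (real (Suc n))) \<longlonglongrightarrow> q * a powr (q - 1) * d"
proof -
  have "((\<lambda>e. (a + e * d) powr q) has_real_derivative q * (a + 0 * d) powr (q - 1) * d) (at 0)"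
    using a by (auto intro!: derivative_eq_intros)
  then have "((\<lambda>e. ((a + e * d) powr q - a powr q) / e) \<longlongrightarrow> q * a powr (q - 1) * d) (at 0)"
    by (simp add: DERIV_def)
  moreover have "filterlim (\<lambda>n. inverse (real (Suc n))) (at 0) sequentially"
    using LIMSEQ_inverse_real_of_nat by (auto simp: filterlim_at)
  ultimately show ?thesis by (rule filterlim_compose)
qed

locale minimiser = singular_problem P p s \<Omega> q for P p s and \<Omega> :: "'a::euclidean_space set" and q +
  fixes u :: "'a \<Rightarrow> real"
  assumes uX: "u \<in> X" and minimal: "\<And>v. v \<in> X \<Longrightarrow> J u \<le> J v"
    and lipschitz: "lipschitz_boundary \<Omega>"
begin

lemma u_measurable [measurable]: "u \<in> borel_measurable borel"
  using uX by measurable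

lemma u_nonneg: "0 \<le> u x" by (rule X_nonneg[OF uX])

section \<open>Positivity of the minimiser and the first variation\<close>

lemma zero_X: "(\<lambda>x. 0) \<in> X"
  by (simp add: X_def supported_def energy_def D_frac_apply)

lemma X_positive: obtains v where "v \<in> X" "\<And>x. x \<in> \<Omega> \<Longrightarrow> 0 < v x"
proof -
  \<comment> \<open>This function is bounded and Lipschitz, so \<open>energy_lipschitz\<close>
    applies, and it is positive exactly on \<Omega> because the complement is closed.\<close>
  let ?v = "\<lambda>x. infdist x (- \<Omega>)"
  have ne: "- \<Omega> \<noteq> {}" using bounded_domain not_bounded_UNIV by (metis double_complement Compl_empty_eq)
  have z: "?v x = 0 \<longleftrightarrow> x \<notin> \<Omega>" for x
    using in_closed_iff_infdist_zero[of "- \<Omega>" x] open_domain ne by (auto simp: closed_def)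
  have lip: "\<bar>?v x - ?v y\<bar> \<le> 1 * norm (x - y)" for x y
    using infdist_triangle_abs[of x "- \<Omega>" y] by (simp add: dist_norm)
  obtain y where y: "y \<in> - \<Omega>" using ne by blast
  obtain R where R: "\<And>x. x \<in> \<Omega> \<Longrightarrow> norm x \<le> R" using bounded_domain by (auto simp: bounded_iff)
  have B: "\<bar>?v x\<bar> \<le> \<bar>R\<bar> + norm y" for x
  proof (cases "x \<in> \<Omega>")
    case True
    have "?v x \<le> dist x y" using y by (rule infdist_le)
    also have "\<dots> \<le> norm x + norm y" unfolding dist_norm by (rule norm_triangle_ineq4)
    finally show ?thesis using R[OF True] infdist_nonneg[of x "- \<Omega>"] by linarith
  next
    case False
    then show ?thesis using z[of x] by simp
  qed
  have s: "supported ?v"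
    unfolding supported_def using z by (auto intro!: borel_measurable_continuous_onI continuous_on_infdist continuous_on_id)
  have "energy ?v < \<infinity>" by (rule energy_lipschitz[OF s lip B])
  then have "?v \<in> X" using s by (simp add: X_def infdist_nonneg)
  moreover have "0 < ?v x" if "x \<in> \<Omega>" for x using z[of x] infdist_nonneg[of x "- \<Omega>"] that by linarith
  ultimately show ?thesis using that by blast
qed

text \<open>Moving a fraction \<open>e\<close> towards a positive \<open>v\<close> costs at most a
  multiple of \<open>e\<close> in the energy and in the convexity bound for the power, but gains
  \<open>e powr q\<close> times the integral \<open>I\<close> of \<open>v powr q\<close> over the
  zero set of \<open>u\<close>. As \<open>q < 1\<close>, minimality forces
  \<open>I = 0\<close>.\<close>

lemma u_positive: "AE x in lborel. x \<in> \<Omega> \<longrightarrow> 0 < u x"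
proof -
  obtain v where v: "v \<in> X" "\<And>x. x \<in> \<Omega> \<Longrightarrow> 0 < v x" using X_positive by blast
  have [measurable]: "v \<in> borel_measurable borel" using v by measurable
  let ?Z = "\<lambda>x. indicator {x. u x = 0} x * v x powr q"
  define I where "I = (\<integral>x. ?Z x \<partial>lborel)"
  note iu = X_powr_integrable[OF uX] and iv = X_powr_integrable[OF v(1)]
  have iZ: "integrable lborel ?Z"
    by (rule Bochner_Integration.integrable_bound[OF iv]) (auto simp: indicator_def)
  \<comment> \<open>All contributions that are linear in \<open>e\<close> are collected in
    \<open>K\<close>.\<close>
  define K where "K = q * ((1 - s) / 2 * (E v - E u)) - ((\<integral>x. v x powr q \<partial>lborel) - (\<integral>x. u x powr q \<partial>lborel))"
  have key: "(e powr q - e) * I \<le> e * K" if e: "0 < e" "e \<le> 1" for e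
  proof -
    let ?w = "\<lambda>x. (1 - e) * u x + e * v x"
    have w: "?w \<in> X" "E ?w \<le> (1 - e) * E u + e * E v" using X_convex[OF uX v(1), of e] e by auto
    note iw = X_powr_integrable[OF w(1)]
    have "(\<integral>x. (1 - e) * u x powr q + e * v x powr q + (e powr q - e) * ?Z x \<partial>lborel) \<le> (\<integral>x. ?w x powr q \<partial>lborel)"
    proof (rule integral_mono[OF _ iw])
      show "integrable lborel (\<lambda>x. (1 - e) * u x powr q + e * v x powr q + (e powr q - e) * ?Z x)"
        by (intro Bochner_Integration.integrable_add integrable_mult_right iu iv iZ)
      fix x
      show "(1 - e) * u x powr q + e * v x powr q + (e powr q - e) * ?Z x \<le> ?w x powr q"
      proof (cases "u x = 0")
        case True
        then show ?thesis using e X_nonneg[OF v(1), of x] by (simp add: powr_mult algebra_simps)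
      next
        case False
        then show ?thesis using powr_concave[OF q u_nonneg X_nonneg[OF v(1)], of e x x] e by simp
      qed
    qed
    also have "(\<integral>x. (1 - e) * u x powr q + e * v x powr q + (e powr q - e) * ?Z x \<partial>lborel)
      = (1 - e) * (\<integral>x. u x powr q \<partial>lborel) + e * (\<integral>x. v x powr q \<partial>lborel) + (e powr q - e) * I"
      unfolding I_def using iu iv iZ by simp
    finally have 1: "(e powr q - e) * I + e * ((\<integral>x. v x powr q \<partial>lborel) - (\<integral>x. u x powr q \<partial>lborel))
      \<le> (\<integral>x. ?w x powr q \<partial>lborel) - (\<integral>x. u x powr q \<partial>lborel)" by (simp add: algebra_simps)
    have "1 / q * ((\<integral>x. ?w x powr q \<partial>lborel) - (\<integral>x. u x powr q \<partial>lborel)) \<le> (1 - s) / 2 * (E ?w - E u)"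
      using minimal[OF w(1)] unfolding J_def by (simp add: right_diff_distrib)
    also have "\<dots> \<le> (1 - s) / 2 * (e * (E v - E u))"
      using w(2) s by (intro mult_left_mono) (auto simp: algebra_simps)
    finally have "(\<integral>x. ?w x powr q \<partial>lborel) - (\<integral>x. u x powr q \<partial>lborel) \<le> q * ((1 - s) / 2 * (e * (E v - E u)))"
      using q(1) by (simp add: pos_divide_le_eq mult.commute)
    also have "\<dots> = e * (q * ((1 - s) / 2 * (E v - E u)))" by (simp only: mult_ac)
    finally show ?thesis using 1 by (simp only: K_def right_diff_distrib)
  qed
  have I0: "0 \<le> I" unfolding I_def by (rule integral_nonneg_AE) simp
  have "I \<le> 0"
  proof (rule ccontr)
    assume "\<not> I \<le> 0"
    then have I: "0 < I" by simp
    \<comment> \<open>This is \<open>key\<close> at \<open>e = inverse (real (Suc n))\<close>,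
      divided by \<open>e\<close> and by \<open>I\<close>; the left side is unbounded in
      \<open>n\<close>.\<close>
    have le: "real (Suc n) powr (1 - q) \<le> K / I + 1" for n
    proof -
      let ?N = "real (Suc n)"
      have "(inverse ?N powr q - inverse ?N) * I \<le> inverse ?N * K" by (rule key) (auto simp: inverse_le_1_iff)
      then have f1: "?N * ((inverse ?N powr q - inverse ?N) * I) \<le> ?N * (inverse ?N * K)" by (intro mult_left_mono) auto
      have f2: "?N * ((inverse ?N powr q - inverse ?N) * I) = (?N * inverse ?N powr q - 1) * I"
      proof -
        have "?N * inverse ?N = 1" by simp
        then show ?thesis by (simp only: right_diff_distrib left_diff_distrib mult.assoc[symmetric])
      qed
      have f3: "?N * inverse ?N powr q = ?N powr (1 - q)"
        by (simp add: inverse_powr powr_diff divide_inverse)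
      have f4: "?N * (inverse ?N * K) = K" by (simp add: field_simps)
      have "(?N powr (1 - q) - 1) * I \<le> K" using f1 unfolding f2 f3 f4 .
      then have "?N powr (1 - q) - 1 \<le> K / I" using I by (simp add: pos_le_divide_eq)
      then show ?thesis by simp
    qed
    have "filterlim (\<lambda>n. real (Suc n) powr (1 - q)) at_top sequentially"
      using q by (intro filterlim_compose[OF real_powr_at_top] filterlim_compose[OF filterlim_real_sequentially] filterlim_Suc) simp
    then have "\<forall>\<^sub>F n in sequentially. K / I + 2 \<le> real (Suc n) powr (1 - q)" by (simp add: filterlim_at_top)
    then obtain n where "K / I + 2 \<le> real (Suc n) powr (1 - q)" unfolding eventually_sequentially by blast
    then show False using le[of n] by linarith
  qed
  then have "I = 0" using I0 by simp
  then have "AE x in lborel. ?Z x = 0"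
    unfolding I_def by (subst (asm) integral_nonneg_eq_0_iff_AE[OF iZ]) auto
  then show ?thesis
  proof eventually_elim
    case (elim x)
    show ?case
    proof
      assume "x \<in> \<Omega>"
      then have "0 < v x powr q"  using v(2)[of x] by simp
      then have "u x \<noteq> 0" using elim by auto
      then show "0 < u x" using u_nonneg[of x] by simp
    qed
  qed
qed

text \<open>On the segment from \<open>u\<close> to \<open>v\<close> the gaps \<open>?F\<close> and
  \<open>?G\<close> between the difference quotients of step 1 and step \<open>e n\<close> are
  nonnegative, by convexity of \<open>P\<close> and by concavity of the power. Minimality bounds a
  positive combination of their integrals by \<open>J v - J u\<close>, so Fatou's lemma gives both
  integrabilities along with the inequality.\<close>

lemma variation:
  assumes v: "v \<in> X"
  shows "integrable frac_lborel (\<lambda>p'. p (D_frac s u p') * (D_frac s v p' - D_frac s u p'))"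
    "integrable lborel (\<lambda>x. u x powr (q - 1) * (v x - u x))"
    "(\<integral>x. u x powr (q - 1) * (v x - u x) \<partial>lborel)
      \<le> (1 - s) / 2 * (\<integral>p'. p (D_frac s u p') * (D_frac s v p' - D_frac s u p') \<partial>frac_lborel)"
proof -
  have [measurable]: "v \<in> borel_measurable borel" using v by measurable
  let ?c = "(1 - s) / 2"
  have c: "0 < ?c" using s by simp
  define e where "e n = inverse (real (Suc n))" for n
  have e: "0 < e n" "e n \<le> 1" for n by (auto simp: e_def inverse_le_1_iff)
  let ?w = "\<lambda>n x. (1 - e n) * u x + e n * v x"
  have w: "?w n \<in> X" for n using X_convex(1)[OF uX v, of "e n"] e[of n] by auto
  have [measurable]: "?w n \<in> borel_measurable borel" for n by measurable
  note iu = X_powr_integrable[OF uX] and iv = X_powr_integrable[OF v] and iw = X_powr_integrable[OF w]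
  note eu = X_energy_integrable[OF uX] and ev = X_energy_integrable[OF v] and ew = X_energy_integrable[OF w]
  let ?Du = "D_frac s u" and ?Dv = "D_frac s v"
  let ?F = "\<lambda>n p'. P (?Dv p') - P (?Du p') - (P (D_frac s (?w n) p') - P (?Du p')) / e n"
  let ?F' = "\<lambda>p'. P (?Dv p') - P (?Du p') - p (?Du p') * (?Dv p' - ?Du p')"
  let ?G = "\<lambda>n x. (?w n x powr q - u x powr q) / e n - (v x powr q - u x powr q)"
  let ?G' = "\<lambda>x. q * (u x powr (q - 1) * (v x - u x)) - (v x powr q - u x powr q)"
  have Dw: "D_frac s (?w n) p' = ?Du p' + e n * (?Dv p' - ?Du p')" for n p'
    unfolding D_frac_add D_frac_cmult by (simp add: algebra_simps)
  have F0: "0 \<le> ?F n p'" for n p'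
    unfolding Dw using P_difference_quotient[OF e(1)[of n] e(2)[of n], of "?Du p'" "?Dv p' - ?Du p'"] by simp
  have Flim: "(\<lambda>n. ?F n p') \<longlonglongrightarrow> ?F' p'" for p'
    unfolding Dw unfolding e_def by (intro tendsto_intros P_difference_quotient_tendsto)
  have G0: "0 \<le> ?G n x" for n x
  proof -
    have "(1 - e n) * u x powr q + e n * v x powr q \<le> ?w n x powr q"
      using powr_concave[OF q u_nonneg X_nonneg[OF v], of "e n" x x] e[of n] by simp
    then have "e n * (v x powr q - u x powr q) \<le> ?w n x powr q - u x powr q" by (simp add: algebra_simps)
    then show ?thesis using e(1)[of n] by (simp add: pos_le_divide_eq mult.commute)
  qed
  have Glim: "AE x in lborel. (\<lambda>n. ?G n x) \<longlonglongrightarrow> ?G' x"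
    using u_positive
  proof eventually_elim
    case (elim x)
    show ?case
    proof (cases "x \<in> \<Omega>")
      case True
      have "?w n x = u x + inverse (real (Suc n)) * (v x - u x)" for n by (simp add: e_def algebra_simps)
      then show ?thesis
        unfolding e_def mult.assoc[symmetric] using elim True
        by (simp only:) (intro tendsto_diff tendsto_const powr_difference_quotient_tendsto, simp)
    next
      case False
      then have "u x = 0" "v x = 0" using X_supported[OF uX] X_supported[OF v] by (auto simp: supported_def)
      then show ?thesis by simp
    qed
  qed
  have iF: "integrable frac_lborel (?F n)" for n using eu ev ew[of n] by (intro Bochner_Integration.integrable_diff integrable_divide)
  have iG: "integrable lborel (?G n)" for n using iu iv iw[of n] by (intro Bochner_Integration.integrable_diff integrable_divide)
  define a where "a n = (\<integral>p'. ?F n p' \<partial>frac_lborel)" for n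
  define b where "b n = (\<integral>x. ?G n x \<partial>lborel)" for n
  have a0: "0 \<le> a n" for n unfolding a_def by (intro integral_nonneg_AE always_eventually allI F0)
  have b0: "0 \<le> b n" for n unfolding b_def by (intro integral_nonneg_AE always_eventually allI G0)
  define M where "M = J v - J u"
  \<comment> \<open>The combination collapses to \<open>M\<close> minus the difference quotient of
    \<open>J\<close>, which is nonnegative at a minimiser.\<close>
  have ab: "?c * a n + 1 / q * b n \<le> M" for n
  proof -
    have a: "a n = E v - E u - (E (?w n) - E u) / e n"
      unfolding a_def E_def using eu ev ew[of n] by (simp add: Bochner_Integration.integrable_diff)
    have b: "b n = ((\<integral>x. ?w n x powr q \<partial>lborel) - (\<integral>x. u x powr q \<partial>lborel)) / e n - ((\<integral>x. v x powr q \<partial>lborel) - (\<integral>x. u x powr q \<partial>lborel))"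
      unfolding b_def using iu iv iw[of n] by (simp add: Bochner_Integration.integrable_diff)
    have "?c * a n + 1 / q * b n = M - (J (?w n) - J u) / e n"
      unfolding a b M_def J_def by (simp add: algebra_simps diff_divide_distrib add_divide_distrib)
    moreover have "0 \<le> (J (?w n) - J u) / e n" using minimal[OF w[of n]] e(1)[of n] by simp
    ultimately show ?thesis by linarith
  qed
  have aM: "a n \<le> M / ?c" for n
  proof -
    have "0 \<le> 1 / q * b n" using b0 q by simp
    then have "?c * a n \<le> M" using ab[of n] by linarith
    then show ?thesis using c by (simp add: pos_le_divide_eq mult.commute)
  qed
  have F'm: "?F' \<in> borel_measurable frac_lborel" by measurable
  have G'm: "?G' \<in> borel_measurable lborel" by measurable
  have iF': "integrable frac_lborel ?F'"
    by (rule fatou_real(1)[of frac_lborel ?F, OF iF AE_I2[OF F0] AE_I2[OF Flim] F'm])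
      (use aM in \<open>auto simp: a_def intro!: eventually_frequently always_eventually\<close>)
  show i1: "integrable frac_lborel (\<lambda>p'. p (?Du p') * (?Dv p' - ?Du p'))"
  proof -
    have "integrable frac_lborel (\<lambda>p'. P (?Dv p') - P (?Du p') - ?F' p')"
      by (intro Bochner_Integration.integrable_diff eu ev iF')
    then show ?thesis by simp
  qed
  let ?a = "\<integral>p'. ?F' p' \<partial>frac_lborel"
  \<comment> \<open>Convergence of \<open>a n\<close> and \<open>b n\<close> is not known. Fatou's
    lemma gives an eventual lower bound for \<open>a n\<close>, \<open>ab\<close> converts it into
    an upper bound for \<open>b n\<close>, and Fatou's lemma passes to the limit there.\<close>
  have bound: "integrable lborel ?G' \<and> (\<integral>x. ?G' x \<partial>lborel) \<le> q * (M - ?c * ?a + ?c * \<epsilon>)" if \<epsilon>: "0 < \<epsilon>" for \<epsilon>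
  proof -
    have "\<forall>\<^sub>F n in sequentially. ?a - \<epsilon> < a n"
    proof (rule ccontr)
      assume "\<not> ?thesis"
      then have "\<exists>\<^sub>F n in sequentially. a n \<le> ?a - \<epsilon>" by (simp add: frequently_def not_le)
      then have "?a \<le> ?a - \<epsilon>"
        unfolding a_def by (intro fatou_real(2)[of frac_lborel ?F, OF iF AE_I2[OF F0] AE_I2[OF Flim] F'm])
      then show False using \<epsilon> by simp
    qed
    then have "\<forall>\<^sub>F n in sequentially. b n \<le> q * (M - ?c * ?a + ?c * \<epsilon>)"
    proof eventually_elim
      case (elim n)
      have "?c * (?a - \<epsilon>) \<le> ?c * a n" using elim c by (intro mult_left_mono) auto
      then have "1 / q * b n \<le> M - ?c * ?a + ?c * \<epsilon>" using ab[of n] unfolding right_diff_distrib by linarith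
      then show ?case using q(1) by (simp add: pos_divide_le_eq mult.commute)
    qed
    then have fr: "\<exists>\<^sub>F n in sequentially. (\<integral>x. ?G n x \<partial>lborel) \<le> q * (M - ?c * ?a + ?c * \<epsilon>)"
      unfolding b_def by (rule eventually_frequently[OF sequentially_bot])
    show ?thesis
      using fatou_real[of lborel ?G, OF iG AE_I2[OF G0] Glim G'm fr] by simp
  qed
  have iG': "integrable lborel ?G'" using bound[of 1] by simp
  show i2: "integrable lborel (\<lambda>x. u x powr (q - 1) * (v x - u x))"
  proof -
    have "integrable lborel (\<lambda>x. 1 / q * (?G' x + (v x powr q - u x powr q)))"
      by (intro integrable_mult_right Bochner_Integration.integrable_add Bochner_Integration.integrable_diff iu iv iG')
    then show ?thesis using q by simp
  qed
  have "(\<integral>x. ?G' x \<partial>lborel) \<le> q * (M - ?c * ?a)"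
  proof (rule field_le_epsilon)
    fix \<epsilon> :: real assume \<epsilon>: "0 < \<epsilon>"
    have "0 < \<epsilon> / (q * ?c)" using \<epsilon> q c by simp
    from bound[OF this] have "(\<integral>x. ?G' x \<partial>lborel) \<le> q * (M - ?c * ?a + ?c * (\<epsilon> / (q * ?c)))" by blast
    also have "\<dots> = q * (M - ?c * ?a) + q * (?c * (\<epsilon> / (q * ?c)))" by (simp only: distrib_left)
    also have "q * (?c * (\<epsilon> / (q * ?c))) = \<epsilon>" using q c by simp
    finally show "(\<integral>x. ?G' x \<partial>lborel) \<le> q * (M - ?c * ?a) + \<epsilon>" .
  qed
  moreover have "(\<integral>x. ?G' x \<partial>lborel) = q * (\<integral>x. u x powr (q - 1) * (v x - u x) \<partial>lborel)
    - ((\<integral>x. v x powr q \<partial>lborel) - (\<integral>x. u x powr q \<partial>lborel))"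
    using i2 iu iv by (simp add: Bochner_Integration.integrable_diff)
  moreover have "?a = E v - E u - (\<integral>p'. p (?Du p') * (?Dv p' - ?Du p') \<partial>frac_lborel)"
    unfolding E_def using i1 eu ev by (simp add: Bochner_Integration.integrable_diff)
  moreover have "q * (M - ?c * ?a) = q * (?c * (\<integral>p'. p (?Du p') * (?Dv p' - ?Du p') \<partial>frac_lborel))
    - ((\<integral>x. v x powr q \<partial>lborel) - (\<integral>x. u x powr q \<partial>lborel))" if "?a = E v - E u - (\<integral>p'. p (?Du p') * (?Dv p' - ?Du p') \<partial>frac_lborel)"
    unfolding that M_def J_def using q by (simp add: algebra_simps)
  ultimately have "q * (\<integral>x. u x powr (q - 1) * (v x - u x) \<partial>lborel)
    \<le> q * (?c * (\<integral>p'. p (?Du p') * (?Dv p' - ?Du p') \<partial>frac_lborel))" by linarith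
  then show "(\<integral>x. u x powr (q - 1) * (v x - u x) \<partial>lborel)
    \<le> ?c * (\<integral>p'. p (?Du p') * (?Dv p' - ?Du p') \<partial>frac_lborel)" using q(1) by (simp only: mult_le_cancel_left_pos)
qed

end

section \<open>The residual of the weak equation\<close>

context minimiser begin

abbreviation flux :: "'a \<times> 'a \<Rightarrow> real" where "flux p' \<equiv> p (D_frac s u p')"

text \<open>The competitor \<open>0\<close> in \<open>variation\<close> makes the flux times the
  quotient of \<open>u\<close> integrable, and this product is the majorant in
  \<open>p_young\<close>.\<close>

lemma flux_pairable: "pairable frac_lborel flux"
  unfolding pairable_def
proof (intro conjI exI)
  have "integrable frac_lborel (\<lambda>p'. flux p' * (D_frac s (\<lambda>x. 0) p' - D_frac s u p'))"
    by (rule variation(1)[OF zero_X])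
  then show "integrable frac_lborel (\<lambda>p'. flux p' * D_frac s u p')"
    by (simp add: D_frac_apply[of s "\<lambda>x. 0"])
  show "AE p' in frac_lborel. \<forall>b. \<bar>flux p' * b\<bar> \<le> flux p' * D_frac s u p' + P b"
    by (intro AE_I2 allI p_young)
qed measurable

lemma flux_integrable: "v \<in> W \<Longrightarrow> integrable frac_lborel (\<lambda>p'. flux p' * D_frac s v p')"
  by (rule W_pairing_integrable(1)[OF _ flux_pairable])

lemma u_powr_mult: "u x powr (q - 1) * u x = u x powr q"
  using u_nonneg[of x] powr_add[of "u x" "q - 1" 1] by (cases "u x = 0") auto

lemma singular_integrable_X:
  assumes v: "v \<in> X" shows "integrable lborel (\<lambda>x. u x powr (q - 1) * v x)"
proof -
  have "integrable lborel (\<lambda>x. u x powr (q - 1) * (v x - u x) + u x powr q)"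
    by (intro Bochner_Integration.integrable_add variation(2)[OF v] X_powr_integrable[OF uX])
  then show ?thesis by (simp add: right_diff_distrib u_powr_mult)
qed

lemma W_nonneg_X:
  assumes v: "v \<in> W" "\<And>x. 0 \<le> v x"
  obtains l where "0 < l" "(\<lambda>x. v x / l) \<in> X"
proof -
  obtain l where l: "0 < l" "energy (\<lambda>x. v x / l) < \<infinity>" using v(1) by (auto simp: W_def)
  have "(\<lambda>x. v x / l) \<in> X" using l v(2) W_supported[OF v(1)] by (auto simp: X_def supported_def)
  then show ?thesis using that l by blast
qed

lemma singular_integrable:
  assumes v: "v \<in> W" shows "integrable lborel (\<lambda>x. u x powr (q - 1) * v x)"
proof -
  have *: "integrable lborel (\<lambda>x. u x powr (q - 1) * v x)" if v: "v \<in> W" "\<And>x. 0 \<le> v x" for v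
  proof -
    obtain l where l: "0 < l" "(\<lambda>x. v x / l) \<in> X" using W_nonneg_X[OF v] by blast
    have "integrable lborel (\<lambda>x. l * (u x powr (q - 1) * (v x / l)))"
      by (intro integrable_mult_right singular_integrable_X l)
    then show ?thesis using l(1) by simp
  qed
  have "(\<lambda>x. - v x) \<in> W" using W_cmult[OF v, of "-1"] by simp
  then have "integrable lborel (\<lambda>x. u x powr (q - 1) * max 0 (v x) - u x powr (q - 1) * max 0 (- v x))"
    by (intro Bochner_Integration.integrable_diff * W_pos_part v) auto
  moreover have "u x powr (q - 1) * max 0 (v x) - u x powr (q - 1) * max 0 (- v x) = u x powr (q - 1) * v x" for x
    by (simp add: max_def)
  ultimately show ?thesis by simp
qed

definition residual :: "('a \<Rightarrow> real) \<Rightarrow> real" where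
  "residual v = (1 - s) / 2 * (\<integral>p'. flux p' * D_frac s v p' \<partial>frac_lborel) - (\<integral>x. u x powr (q - 1) * v x \<partial>lborel)"

lemma residual_diff:
  assumes "v \<in> W" "w \<in> W" shows "residual (\<lambda>x. v x - w x) = residual v - residual w"
  using flux_integrable[OF assms(1)] flux_integrable[OF assms(2)] singular_integrable[OF assms(1)] singular_integrable[OF assms(2)]
  unfolding residual_def D_frac_diff by (simp add: right_diff_distrib)

lemma residual_add:
  assumes "v \<in> W" "w \<in> W" shows "residual (\<lambda>x. v x + w x) = residual v + residual w"
  using flux_integrable[OF assms(1)] flux_integrable[OF assms(2)] singular_integrable[OF assms(1)] singular_integrable[OF assms(2)]
  unfolding residual_def D_frac_add by (simp add: distrib_left)

lemma residual_cmult: "residual (\<lambda>x. c * v x) = c * residual v"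
proof -
  have "(\<integral>p'. flux p' * (c * D_frac s v p') \<partial>frac_lborel) = (\<integral>p'. c * (flux p' * D_frac s v p') \<partial>frac_lborel)"
    by (simp only: mult.left_commute)
  moreover have "(\<integral>x. u x powr (q - 1) * (c * v x) \<partial>lborel) = (\<integral>x. c * (u x powr (q - 1) * v x) \<partial>lborel)"
    by (simp only: mult.left_commute)
  ultimately show ?thesis unfolding residual_def D_frac_cmult by (simp add: algebra_simps)
qed

lemma residual_ge: assumes v: "v \<in> X" shows "residual u \<le> residual v"
proof -
  have "residual (\<lambda>x. v x - u x) = residual v - residual u" by (rule residual_diff[OF X_W[OF v] X_W[OF uX]])
  moreover have "0 \<le> residual (\<lambda>x. v x - u x)"
    unfolding residual_def D_frac_diff using variation(3)[OF v] by simp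
  ultimately show ?thesis by simp
qed

text \<open>All positive multiples of \<open>f\<close> are competitors, and a linear functional that
  is bounded below on a ray is nonnegative on it.\<close>

lemma residual_test:
  assumes f: "f \<in> test_functions \<Omega>" "\<And>x. 0 \<le> f x" shows "0 \<le> residual f"
proof (rule ccontr)
  assume "\<not> ?thesis"
  then have neg: "residual f < 0" by simp
  define c where "c = (\<bar>residual u\<bar> + 1) / (- residual f)"
  have c: "0 < c" unfolding c_def using neg by (intro divide_pos_pos) auto
  have "(\<lambda>x. c * f x) \<in> X"
    using test_function_energy[OF f(1), of c] W_supported[OF test_function_W[OF f(1)]] f(2) c
    by (auto simp: X_def supported_def)
  from residual_ge[OF this] have "residual u \<le> c * residual f" by (simp add: residual_cmult)
  moreover have "c * residual f = - (\<bar>residual u\<bar> + 1)" using neg by (simp add: c_def)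
  ultimately show False by linarith
qed

text \<open>Without a \<open>\<Delta>\<^sub>2\<close>-condition \<open>u + t * w\<close> need not have finite energy, so nonnegativity of the
  residual is first obtained on test functions and then passed to the limit.\<close>

lemma residual_nonneg:
  assumes w: "w \<in> W" "\<And>x. 0 \<le> w x" shows "0 \<le> residual w"
proof -
  obtain f where f: "\<And>n. f n \<in> test_functions \<Omega>" "\<And>n x. 0 \<le> f n x" "AE x in lborel. (\<lambda>n. f n x) \<longlonglongrightarrow> w x"
    "(\<lambda>n. \<integral>p'. flux p' * D_frac s (f n) p' \<partial>frac_lborel) \<longlonglongrightarrow> (\<integral>p'. flux p' * D_frac s w p' \<partial>frac_lborel)"
    using W_approximable[OF lipschitz w] flux_pairable unfolding approximable_def by blast
  have [measurable]: "w \<in> borel_measurable borel" using w by measurable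
  let ?c = "(1 - s) / 2"
  let ?I = "?c * (\<integral>p'. flux p' * D_frac s w p' \<partial>frac_lborel)"
  have lim: "(\<lambda>n. ?c * (\<integral>p'. flux p' * D_frac s (f n) p' \<partial>frac_lborel)) \<longlonglongrightarrow> ?I"
    by (intro tendsto_mult_left f(4))
  have "(\<integral>x. u x powr (q - 1) * w x \<partial>lborel) \<le> ?I + e" if e: "0 < e" for e
  proof (rule fatou_real(2)[of lborel "\<lambda>n x. u x powr (q - 1) * f n x"])
    show "integrable lborel (\<lambda>x. u x powr (q - 1) * f n x)" for n by (rule singular_integrable[OF test_function_W[OF f(1)]])
    show "AE x in lborel. 0 \<le> u x powr (q - 1) * f n x" for n using f(2) by (intro AE_I2) simp
    show "AE x in lborel. (\<lambda>n. u x powr (q - 1) * f n x) \<longlonglongrightarrow> u x powr (q - 1) * w x"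
      using f(3) by eventually_elim (intro tendsto_mult_left)
    have "\<forall>\<^sub>F n in sequentially. ?c * (\<integral>p'. flux p' * D_frac s (f n) p' \<partial>frac_lborel) < ?I + e"
      using e by (intro order_tendstoD(2)[OF lim]) simp
    then have "\<forall>\<^sub>F n in sequentially. (\<integral>x. u x powr (q - 1) * f n x \<partial>lborel) \<le> ?I + e"
    proof eventually_elim
      case (elim n)
      then show ?case using residual_test[OF f(1,2), of n] unfolding residual_def by linarith
    qed
    then show "\<exists>\<^sub>F n in sequentially. (\<integral>x. u x powr (q - 1) * f n x \<partial>lborel) \<le> ?I + e"
      by (rule eventually_frequently[OF sequentially_bot])
  qed measurable
  then have "(\<integral>x. u x powr (q - 1) * w x \<partial>lborel) \<le> ?I" by (rule field_le_epsilon)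
  then show ?thesis unfolding residual_def by simp
qed

lemma residual_u: "residual u = 0"
proof (rule antisym)
  have "residual (\<lambda>x. 0 * u x) = 0" unfolding residual_cmult by simp
  then show "residual u \<le> 0" using residual_ge[OF zero_X] by simp
  show "0 \<le> residual u" by (rule residual_nonneg[OF X_W[OF uX] u_nonneg])
qed

text \<open>For \<open>v \<ge> 0\<close> the function \<open>min v (k * u)\<close> lies below a multiple of \<open>u\<close>, so its residual is
  nonpositive; the remainder \<open>max 0 (v - k * u)\<close> vanishes as \<open>k\<close> grows.\<close>

lemma residual_nonpos:
  assumes v: "v \<in> W" "\<And>x. 0 \<le> v x" shows "residual v \<le> 0"
proof -
  have [measurable]: "v \<in> borel_measurable borel" using v by measurable
  let ?c = "(1 - s) / 2"
  have c: "0 < ?c" using s by simp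
  define t where "t k x = max 0 (v x - real k * u x)" for k x
  have uW: "u \<in> W" by (rule X_W[OF uX])
  have kW: "(\<lambda>x. real k * u x) \<in> W" for k by (rule W_cmult[OF uW])
  have tW: "t k \<in> W" for k unfolding t_def by (intro W_pos_part W_diff v kW)
  have [measurable]: "t k \<in> borel_measurable borel" for k using tW by measurable
  \<comment> \<open>Here \<open>v = t k + k * u - r\<close> with \<open>r\<close> nonnegative. The
    residual of \<open>k * u\<close> is zero and that of \<open>r\<close> nonnegative, so
    \<open>residual v \<le> residual (t k)\<close>; the nonnegative singular integral of
    \<open>t k\<close> is then discarded.\<close>
  have le: "residual v \<le> ?c * (\<integral>p'. flux p' * D_frac s (t k) p' \<partial>frac_lborel)" for k
  proof -
    define r where "r x = max 0 (real k * u x - v x)" for x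
    have rW: "r \<in> W" unfolding r_def by (intro W_pos_part W_diff v kW)
    have e: "v = (\<lambda>x. (t k x + real k * u x) - r x)" by (rule ext) (simp add: t_def r_def max_def)
    have "residual v = residual (t k) + real k * residual u - residual r"
      by (subst e) (simp add: residual_diff[OF W_add[OF tW kW] rW] residual_add[OF tW kW] residual_cmult)
    also have "\<dots> \<le> residual (t k)" using residual_nonneg[OF rW] by (simp add: residual_u r_def)
    also have "\<dots> \<le> ?c * (\<integral>p'. flux p' * D_frac s (t k) p' \<partial>frac_lborel)"
    proof -
      have "0 \<le> (\<integral>x. u x powr (q - 1) * t k x \<partial>lborel)" by (rule integral_nonneg_AE) (simp add: t_def)
      then show ?thesis unfolding residual_def by simp
    qed
    finally show ?thesis .
  qed
  let ?A = "\<lambda>p'. \<bar>flux p' * D_frac s v p'\<bar>"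
  let ?g = "\<lambda>k p'. ?A p' - flux p' * D_frac s (t k) p'"
  have iA: "integrable frac_lborel ?A" by (intro integrable_abs flux_integrable v)
  have it: "integrable frac_lborel (\<lambda>p'. flux p' * D_frac s (t k) p')" for k by (rule flux_integrable[OF tW])
  \<comment> \<open>The flux has the sign of the increment of \<open>u\<close>, and in that
    direction subtracting \<open>k * u\<close> can only lower the increment of \<open>t k\<close>.
    The flux term of \<open>t k\<close> is thus bounded above by the modulus of that of
    \<open>v\<close>, independently of \<open>k\<close>, which permits a reversed Fatou
    argument.\<close>
  have g0: "0 \<le> ?g k p'" for k p'
  proof -
    obtain x y where p': "p' = (x, y)" by (cases p')
    let ?n = "norm (x - y) powr s"
    have "flux p' * D_frac s (t k) p' \<le> \<bar>flux p'\<bar> * \<bar>D_frac s v p'\<bar>"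
    proof (cases "u y \<le> u x")
      case True
      then have "0 \<le> real k * (u x - u y)" by simp
      then have "t k x - t k y \<le> \<bar>v x - v y\<bar>" unfolding t_def right_diff_distrib by (auto simp: max_def)
      then have "D_frac s (t k) p' \<le> \<bar>D_frac s v p'\<bar>" by (simp add: p' D_frac_def abs_divide divide_right_mono)
      moreover have "0 \<le> flux p'" using True by (intro p_nonneg) (simp add: p' D_frac_def)
      ultimately show ?thesis by (simp add: mult_left_mono)
    next
      case False
      then have "0 \<le> real k * (u y - u x)" by simp
      then have "t k y - t k x \<le> \<bar>v x - v y\<bar>" unfolding t_def right_diff_distrib by (auto simp: max_def)
      then have "(t k y - t k x) / ?n \<le> \<bar>v x - v y\<bar> / ?n" by (intro divide_right_mono) auto
      then have D: "- D_frac s (t k) p' \<le> \<bar>D_frac s v p'\<bar>"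
        by (simp add: p' D_frac_def abs_divide minus_divide_left)
      have "0 \<le> p (- D_frac s u p')" using False by (intro p_nonneg) (simp add: p' D_frac_def divide_nonpos_nonneg)
      then have f: "0 \<le> - flux p'" by (simp add: p_odd)
      have "(- flux p') * (- D_frac s (t k) p') \<le> (- flux p') * \<bar>D_frac s v p'\<bar>" using D f by (intro mult_left_mono)
      then show ?thesis using f by simp
    qed
    then show ?thesis by (simp add: abs_mult)
  qed
  \<comment> \<open>As \<open>u\<close> is positive almost everywhere in \<Omega>, at almost every
    point \<open>k * u\<close> overtakes \<open>v\<close> and \<open>t k\<close> is eventually
    zero.\<close>
  have glim: "AE p' in frac_lborel. (\<lambda>k. ?g k p') \<longlonglongrightarrow> ?A p'"
    using AE_frac_lborel[OF u_positive]
  proof eventually_elim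
    case (elim p')
    have ev: "\<forall>\<^sub>F k in sequentially. t k x = 0" if x: "x \<in> \<Omega> \<longrightarrow> 0 < u x" for x
    proof (cases "x \<in> \<Omega>")
      case True
      then obtain N where N: "v x < real N * u x" using reals_Archimedean3 x by blast
      have "t k x = 0" if "N \<le> k" for k
      proof -
        have "real N * u x \<le> real k * u x" using that u_nonneg by (intro mult_right_mono) auto
        then show ?thesis using N by (simp add: t_def)
      qed
      then show ?thesis unfolding eventually_sequentially by blast
    next
      case False
      then have "u x = 0" "v x = 0" using W_supported[OF uW] W_supported[OF v(1)] by (auto simp: supported_def)
      then show ?thesis by (simp add: t_def)
    qed
    have "\<forall>\<^sub>F k in sequentially. t k (fst p') = 0" "\<forall>\<^sub>F k in sequentially. t k (snd p') = 0"
      using ev elim by auto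
    then have "\<forall>\<^sub>F k in sequentially. ?A p' = ?g k p'" by eventually_elim (simp add: D_frac_apply)
    then show ?case by (rule Lim_transform_eventually[OF tendsto_const])
  qed
  have "(\<integral>p'. ?A p' \<partial>frac_lborel) \<le> (\<integral>p'. ?A p' \<partial>frac_lborel) - residual v / ?c"
  proof (rule fatou_real(2)[of frac_lborel ?g])
    show "integrable frac_lborel (?g k)" for k by (intro Bochner_Integration.integrable_diff iA it)
    show "AE p' in frac_lborel. 0 \<le> ?g k p'" for k by (rule AE_I2) (rule g0)
    show "AE p' in frac_lborel. (\<lambda>k. ?g k p') \<longlonglongrightarrow> ?A p'" by (rule glim)
    have "(\<integral>p'. ?g k p' \<partial>frac_lborel) \<le> (\<integral>p'. ?A p' \<partial>frac_lborel) - residual v / ?c" for k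
    proof -
      have "(\<integral>p'. ?g k p' \<partial>frac_lborel) = (\<integral>p'. ?A p' \<partial>frac_lborel) - (\<integral>p'. flux p' * D_frac s (t k) p' \<partial>frac_lborel)"
        by (rule Bochner_Integration.integral_diff[OF iA it])
      moreover have "residual v / ?c \<le> (\<integral>p'. flux p' * D_frac s (t k) p' \<partial>frac_lborel)"
        using le[of k] c by (simp add: pos_divide_le_eq mult.commute)
      ultimately show ?thesis by linarith
    qed
    then show "\<exists>\<^sub>F k in sequentially. (\<integral>p'. ?g k p' \<partial>frac_lborel) \<le> (\<integral>p'. ?A p' \<partial>frac_lborel) - residual v / ?c"
      by (intro eventually_frequently always_eventually) auto
  qed measurable
  then have "residual v / ?c \<le> 0" by linarith
  then show ?thesis using c by (simp add: divide_le_0_iff)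
qed

lemma residual_zero: assumes v: "v \<in> W" shows "residual v = 0"
proof -
  have *: "residual w = 0" if "w \<in> W" "\<And>x. 0 \<le> w x" for w
    using residual_nonneg[OF that] residual_nonpos[OF that] by simp
  have n: "(\<lambda>x. - v x) \<in> W" using W_cmult[OF v, of "-1"] by simp
  have e: "v = (\<lambda>x. max 0 (v x) - max 0 (- v x))" by (rule ext) (simp add: max_def)
  show ?thesis
    by (subst e) (simp add: residual_diff[OF W_pos_part[OF v] W_pos_part[OF n]] *[OF W_pos_part[OF v]] *[OF W_pos_part[OF n]])
qed

end

context singular_problem begin

lemma weak_solution_exists:
  assumes lip: "lipschitz_boundary \<Omega>"
  obtains u where "u \<in> W" "\<And>x. 0 \<le> u x" "AE x in lborel. x \<in> \<Omega> \<longrightarrow> 0 < u x"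
    "\<And>v. v \<in> W \<Longrightarrow> integrable frac_lborel (\<lambda>p'. p (D_frac s u p') * D_frac s v p')"
    "\<And>v. v \<in> W \<Longrightarrow> integrable lborel (\<lambda>x. u x powr (q - 1) * v x)"
    "\<And>v. v \<in> W \<Longrightarrow> (1 - s) / 2 * (\<integral>p'. p (D_frac s u p') * D_frac s v p' \<partial>frac_lborel)
      = (\<integral>x. u x powr (q - 1) * v x \<partial>lborel)"
proof -
  obtain u where u: "u \<in> X" "\<And>v. v \<in> X \<Longrightarrow> J u \<le> J v" using minimiser_exists by blast
  interpret minimiser P p s \<Omega> q u by unfold_locales (use u lip in auto)
  show ?thesis
    using that[of u] X_W[OF u(1)] u_nonneg u_positive flux_integrable singular_integrable residual_zero
    unfolding residual_def by simp
qed

end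

section \<open>Lebesgue measurable representatives and weak* density\<close>

lemma frac_measure_density:
  "frac_measure = density lebesgue (\<lambda>p::'a::euclidean_space \<times> 'a. ennreal (1 / norm (fst p - snd p) ^ DIM('a)))"
  "frac_lborel = density lborel (\<lambda>p::'a::euclidean_space \<times> 'a. ennreal (1 / norm (fst p - snd p) ^ DIM('a)))"
  by (simp_all add: frac_measure_def frac_lborel_def split_beta')

lemma sets_frac_measure [measurable_cong]: "sets frac_measure = sets lebesgue"
  by (simp add: frac_measure_def)

lemma AE_frac_measure: "(AE p in frac_measure. Q p) \<longleftrightarrow> (AE p in frac_lborel. Q p)"
proof -
  have m: "(\<lambda>p::'a \<times> 'a. ennreal (1 / norm (fst p - snd p) ^ DIM('a))) \<in> borel_measurable lborel" by measurable
  show ?thesis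
    unfolding frac_measure_density AE_density[OF measurable_completion[OF m]] AE_density[OF m] AE_completion_iff ..
qed

lemma nn_integral_frac_measure:
  fixes f :: "'a::euclidean_space \<times> 'a \<Rightarrow> ennreal"
  assumes m: "f \<in> borel_measurable borel" and eq: "AE p in frac_lborel. g p = f p"
  shows "(\<integral>\<^sup>+p. g p \<partial>frac_measure) = (\<integral>\<^sup>+p. f p \<partial>frac_lborel)"
proof -
  have k: "(\<lambda>p::'a \<times> 'a. ennreal (1 / norm (fst p - snd p) ^ DIM('a))) \<in> borel_measurable lborel" by measurable
  have m': "f \<in> borel_measurable lborel" using m by simp
  have "(\<integral>\<^sup>+p. g p \<partial>frac_measure) = (\<integral>\<^sup>+p. f p \<partial>frac_measure)"
    using eq unfolding AE_frac_measure[symmetric] by (rule nn_integral_cong_AE)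
  also have "\<dots> = (\<integral>\<^sup>+p. f p \<partial>frac_lborel)"
    unfolding frac_measure_density nn_integral_density[OF measurable_completion[OF k] measurable_completion[OF m']]
      nn_integral_density[OF k m'] nn_integral_completion ..
  finally show ?thesis .
qed

lemma
  fixes f :: "'a::euclidean_space \<times> 'a \<Rightarrow> real"
  assumes m: "f \<in> borel_measurable borel" and g: "g \<in> borel_measurable frac_measure"
    and eq: "AE p in frac_lborel. g p = f p"
  shows integrable_frac_measure: "integrable frac_measure g \<longleftrightarrow> integrable frac_lborel f"
    and integral_frac_measure: "(\<integral>p. g p \<partial>frac_measure) = (\<integral>p. f p \<partial>frac_lborel)"
proof -
  let ?k = "\<lambda>p::'a \<times> 'a. 1 / norm (fst p - snd p) ^ DIM('a)"
  have k: "?k \<in> borel_measurable lborel" by measurable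
  have m': "f \<in> borel_measurable lborel" using m by simp
  have km: "(\<lambda>p. ?k p *\<^sub>R f p) \<in> borel_measurable lborel" using k m' by measurable
  have nn: "AE p in lborel. 0 \<le> ?k p" "AE p in lebesgue. 0 \<le> ?k p" by auto
  have fm: "f \<in> borel_measurable frac_measure"
    using measurable_completion[OF m'] by (simp cong: measurable_cong_sets add: sets_frac_measure)
  have eq': "AE p in frac_measure. g p = f p" using eq by (simp add: AE_frac_measure)
  show "integrable frac_measure g \<longleftrightarrow> integrable frac_lborel f"
    unfolding integrable_cong_AE[OF g fm eq'] unfolding frac_measure_density
      integrable_density[OF measurable_completion[OF m'] measurable_completion[OF k] nn(2)]
      integrable_density[OF m' k nn(1)] integrable_completion[OF km] ..
  show "(\<integral>p. g p \<partial>frac_measure) = (\<integral>p. f p \<partial>frac_lborel)"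
    unfolding integral_cong_AE[OF g fm eq'] unfolding frac_measure_density
      integral_density[OF measurable_completion[OF m'] measurable_completion[OF k] nn(2)]
      integral_density[OF m' k nn(1)] integral_completion[OF km] ..
qed

lemma
  fixes f :: "'a::euclidean_space \<Rightarrow> real"
  assumes S: "S \<in> sets borel" and m: "f \<in> borel_measurable borel" and z: "\<And>x. x \<notin> S \<Longrightarrow> f x = 0"
    and g: "g \<in> borel_measurable (lebesgue_on S)" and eq: "AE x in lborel. x \<in> S \<longrightarrow> g x = f x"
  shows integrable_lebesgue_on: "integrable (lebesgue_on S) g \<longleftrightarrow> integrable lborel f"
    and integral_lebesgue_on: "(\<integral>x. g x \<partial>lebesgue_on S) = (\<integral>x. f x \<partial>lborel)"
proof -
  have S': "S \<inter> space lebesgue \<in> sets lebesgue" using S by simp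
  have m': "f \<in> borel_measurable lborel" using m by simp
  have fm: "f \<in> borel_measurable (lebesgue_on S)"
    by (rule measurable_restrict_space1[OF measurable_completion[OF m']])
  have eq': "AE x in lebesgue_on S. g x = f x"
    unfolding AE_restrict_space_iff[OF S'] AE_completion_iff using eq .
  have e: "indicator S x *\<^sub>R f x = f x" for x using z by (cases "x \<in> S") auto
  show "integrable (lebesgue_on S) g \<longleftrightarrow> integrable lborel f"
    unfolding integrable_cong_AE[OF g fm eq'] unfolding integrable_restrict_space[OF S'] e integrable_completion[OF m'] ..
  show "(\<integral>x. g x \<partial>lebesgue_on S) = (\<integral>x. f x \<partial>lborel)"
    unfolding integral_cong_AE[OF g fm eq'] unfolding integral_restrict_space[OF S'] e integral_completion[OF m'] ..
qed

section \<open>The conjugate function and the predual\<close>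

context convex_pair begin

text \<open>Superlinearity is what makes the real supremum in \<open>conjugate_fun\<close> a genuine
  one.\<close>

lemma conjugate_bdd: "bdd_above ((\<lambda>t. r * t - P t) ` {0<..})"
proof -
  obtain B where B: "0 \<le> B" "\<And>t. 0 \<le> t \<Longrightarrow> r * t \<le> P t + B" using P_superlinear by blast
  show ?thesis
  proof (rule bdd_aboveI2)
    show "r * t - P t \<le> B" if "t \<in> {0<..}" for t using B(2)[of t] that by simp
  qed
qed

lemma conjugate_upper: "0 < t \<Longrightarrow> r * t - P t \<le> conjugate_fun P r"
  unfolding conjugate_fun_def by (rule cSUP_upper[OF _ conjugate_bdd]) simp

lemma conjugate_mono: "mono (conjugate_fun P)"
proof (rule monoI)
  fix r r' :: real assume "r \<le> r'"
  then show "conjugate_fun P r \<le> conjugate_fun P r'"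
    unfolding conjugate_fun_def
    by (intro cSUP_mono[OF _ conjugate_bdd]) (auto intro!: bexI mult_right_mono diff_right_mono)
qed

text \<open>The supremum runs over \<open>t > 0\<close>, so the value 0 at \<open>t = 0\<close> has
  to be approached: a small \<open>t = l\<close> gives at least
  \<open>- P l \<ge> - (l * P 1)\<close>.\<close>

lemma conjugate_nonneg: assumes "0 \<le> r" shows "0 \<le> conjugate_fun P r"
proof (rule ccontr)
  assume neg: "\<not> ?thesis"
  define l where "l = min 1 (- conjugate_fun P r / (2 * (P 1 + 1)))"
  have P1: "0 < P 1 + 1" using P_nonneg[of 1] by linarith
  have "0 < - conjugate_fun P r / (2 * (P 1 + 1))" using neg P1 by (intro divide_pos_pos) auto
  then have l: "0 < l" "l \<le> 1" by (auto simp: l_def)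
  have "- P (l * 1) \<le> r * (l * 1) - P (l * 1)" using assms l by simp
  also have "\<dots> \<le> conjugate_fun P r" using l by (intro conjugate_upper) simp
  finally have "- conjugate_fun P r \<le> l * P 1" using P_scale[of l 1] l by linarith
  also have "\<dots> \<le> l * (P 1 + 1)" using l by simp
  also have "\<dots> \<le> - conjugate_fun P r / (2 * (P 1 + 1)) * (P 1 + 1)"
    using P1 by (intro mult_right_mono) (auto simp: l_def)
  also have "\<dots> = - conjugate_fun P r / 2"
  proof -
    have "a / (2 * y) * y = a / 2" if "0 < y" for a y :: real using that by simp
    from this[OF P1] show ?thesis .
  qed
  finally show False using neg by simp
qed

lemma conjugate_young: "\<bar>r * t\<bar> \<le> conjugate_fun P \<bar>r\<bar> + P t"
proof (cases "t = 0")
  case False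
  then have "\<bar>r\<bar> * \<bar>t\<bar> - P \<bar>t\<bar> \<le> conjugate_fun P \<bar>r\<bar>" by (intro conjugate_upper) simp
  then show ?thesis by (simp add: abs_mult)
qed (simp add: conjugate_nonneg)

lemma conjugate_measurable [measurable]: "conjugate_fun P \<in> borel_measurable borel"
  by (rule borel_measurable_mono[OF conjugate_mono])

lemma P_abs_div: "0 < l \<Longrightarrow> P (\<bar>t\<bar> / l) = P (t / l)"
  using P_abs[of "t / l"] by simp

text \<open>Membership in the predual is used at scale 1, where Young's inequality makes the
  conjugate of \<open>\<bar>z'\<bar>\<close> an admissible majorant for a Borel
  representative.\<close>

lemma orlicz_E_frac_pairable:
  fixes z :: "'a::euclidean_space \<times> 'a \<Rightarrow> real"
  assumes z: "z \<in> orlicz_E (conjugate_fun P) frac_measure"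
  obtains z' where "pairable frac_lborel z'" "z' \<in> borel_measurable borel" "AE p in frac_lborel. z p = z' p"
proof -
  have "z \<in> borel_measurable frac_measure" using z by (simp add: orlicz_E_def)
  then have "z \<in> borel_measurable lebesgue" by (simp cong: measurable_cong_sets add: sets_frac_measure)
  then obtain z' where z': "z' \<in> borel_measurable lborel" "AE p in lborel. z p = z' p"
    using completion_ex_borel_measurable_real by blast
  have [measurable]: "z' \<in> borel_measurable borel" using z'(1) by simp
  have k: "(\<lambda>p::'a \<times> 'a. ennreal (1 / norm (fst p - snd p) ^ DIM('a))) \<in> borel_measurable lborel" by measurable
  have eq: "AE p in frac_lborel. z p = z' p"
    unfolding frac_measure_density(2) AE_density[OF k] using z'(2) by eventually_elim simp
  let ?h = "\<lambda>p. conjugate_fun P \<bar>z' p\<bar>"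
  have "(\<integral>\<^sup>+p. ennreal (conjugate_fun P (\<bar>z p\<bar> / 1)) \<partial>frac_measure) < \<infinity>"
    using z unfolding orlicz_E_def by (simp only: mem_Collect_eq zero_less_one)
  also have "(\<integral>\<^sup>+p. ennreal (conjugate_fun P (\<bar>z p\<bar> / 1)) \<partial>frac_measure) = (\<integral>\<^sup>+p. ennreal (?h p) \<partial>frac_lborel)"
    by (rule nn_integral_frac_measure) (use eq in \<open>auto elim: eventually_mono\<close>)
  finally have "integrable frac_lborel ?h"
    by (intro integrableI_nonneg) (auto simp: conjugate_nonneg)
  then have "pairable frac_lborel z'"
    unfolding pairable_def by (intro conjI exI[of _ ?h] AE_I2 allI conjugate_young) auto
  then show ?thesis using that eq by simp
qed

lemma orlicz_E_lebesgue_pairable: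
  fixes z :: "'a::euclidean_space \<Rightarrow> real"
  assumes S [measurable]: "S \<in> sets borel" and z: "z \<in> orlicz_E (conjugate_fun P) (lebesgue_on S)"
  obtains z' where "pairable lborel z'" "z' \<in> borel_measurable borel" "AE x in lborel. x \<in> S \<longrightarrow> z x = z' x"
proof -
  have zm: "z \<in> borel_measurable (lebesgue_on S)" using z by (simp add: orlicz_E_def)
  have S': "S \<inter> space lebesgue \<in> sets lebesgue" using S by simp
  have "(\<lambda>x. if x \<in> S then z x else 0) \<in> borel_measurable lebesgue"
    by (rule borel_measurable_if_I[OF zm]) (use S in simp)
  then obtain y where y: "y \<in> borel_measurable lborel" "AE x in lborel. (if x \<in> S then z x else 0) = y x"
    using completion_ex_borel_measurable_real by blast
  have [measurable]: "y \<in> borel_measurable borel" using y(1) by simp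
  define z' where "z' x = indicator S x * y x" for x
  have [measurable]: "z' \<in> borel_measurable borel" unfolding z'_def by measurable
  have eq: "AE x in lborel. x \<in> S \<longrightarrow> z x = z' x"
    using y(2) by eventually_elim (auto simp: z'_def split: if_splits)
  \<comment> \<open>The modular is known on \<open>S\<close> only, so the majorant is cut off there;
    outside \<open>S\<close> the representative \<open>z'\<close> is zero.\<close>
  let ?h = "\<lambda>x. conjugate_fun P \<bar>z' x\<bar> * indicator S x"
  have "(\<integral>\<^sup>+x. ennreal (conjugate_fun P (\<bar>z x\<bar> / 1)) \<partial>lebesgue_on S) < \<infinity>"
    using z unfolding orlicz_E_def by (simp only: mem_Collect_eq zero_less_one)
  also have "(\<integral>\<^sup>+x. ennreal (conjugate_fun P (\<bar>z x\<bar> / 1)) \<partial>lebesgue_on S) = (\<integral>\<^sup>+x. ennreal (?h x) \<partial>lborel)"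
    unfolding nn_integral_restrict_space[OF S'] nn_integral_completion
    by (rule nn_integral_cong_AE) (use eq in \<open>eventually_elim, simp add: indicator_def\<close>)
  finally have "integrable lborel ?h"
    by (intro integrableI_nonneg) (auto simp: conjugate_nonneg)
  moreover have "\<bar>z' x * b\<bar> \<le> ?h x + P b" for x b
    using conjugate_young[of "z' x" b] by (cases "x \<in> S") (auto simp: z'_def)
  ultimately have "pairable lborel z'"
    unfolding pairable_def by (intro conjI exI[of _ ?h] AE_I2 allI) auto
  then show ?thesis using that eq by simp
qed

end

section \<open>Borel representatives and the weak* closure of the test functions\<close>

context frac_setting begin

lemma frac_W_measurable:
  assumes "u \<in> frac_W P s \<Omega>"
  shows "u \<in> borel_measurable (lebesgue_on \<Omega>)" "D_frac s u \<in> borel_measurable frac_measure"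
  using assms by (simp_all add: frac_W_def orlicz_L_def)

text \<open>Changing \<open>u\<close> on a null set changes its difference quotient only on a null
  set of the product, so the energy of the Borel version is that of \<open>u\<close>.\<close>

lemma frac_W_representative:
  assumes u: "u \<in> frac_W P s \<Omega>"
  obtains w where "w \<in> W" "AE x in lborel. u x = w x" "AE p in frac_lborel. D_frac s u p = D_frac s w p"
proof -
  have zero: "\<And>x. x \<notin> \<Omega> \<Longrightarrow> u x = 0" using u by (simp add: frac_W_def)
  have "(\<lambda>x. if x \<in> \<Omega> then u x else 0) \<in> borel_measurable lebesgue"
    by (rule borel_measurable_if_I[OF frac_W_measurable(1)[OF u]]) simp
  then obtain y where y: "y \<in> borel_measurable lborel" "AE x in lborel. (if x \<in> \<Omega> then u x else 0) = y x"
    using completion_ex_borel_measurable_real by blast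
  have [measurable]: "y \<in> borel_measurable borel" using y(1) by simp
  define w where "w x = indicator \<Omega> x * y x" for x
  have [measurable]: "w \<in> borel_measurable borel" unfolding w_def by measurable
  have eq: "AE x in lborel. u x = w x"
    using y(2) by eventually_elim (auto simp: w_def zero indicator_def)
  have Deq: "AE p in frac_lborel. D_frac s u p = D_frac s w p"
    using AE_frac_lborel[OF eq] by eventually_elim (simp add: D_frac_apply)
  obtain l where l: "0 < l" "(\<integral>\<^sup>+p. ennreal (P (\<bar>D_frac s u p\<bar> / l)) \<partial>frac_measure) < \<infinity>"
    using u by (auto simp: frac_W_def orlicz_L_def)
  have "(\<integral>\<^sup>+p. ennreal (P (\<bar>D_frac s u p\<bar> / l)) \<partial>frac_measure) = (\<integral>\<^sup>+p. ennreal (P (D_frac s w p / l)) \<partial>frac_lborel)"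
  proof (rule nn_integral_frac_measure)
    show "AE p in frac_lborel. ennreal (P (\<bar>D_frac s u p\<bar> / l)) = ennreal (P (D_frac s w p / l))"
      using Deq by eventually_elim (simp add: P_abs_div[OF l(1)])
  qed measurable
  then have "energy (\<lambda>x. w x / l) < \<infinity>" using l(2) by (simp add: energy_def D_frac_cdiv)
  moreover have "supported w" by (simp add: supported_def w_def)
  ultimately have "w \<in> W" using l(1) by (auto simp: W_def)
  then show ?thesis using that eq Deq by blast
qed

lemma W_frac_W:
  assumes w: "w \<in> W" shows "w \<in> frac_W P s \<Omega>"
proof -
  have wm [measurable]: "w \<in> borel_measurable borel" using w by measurable
  have wl: "w \<in> borel_measurable lborel" by simp
  have Dl: "D_frac s w \<in> borel_measurable lborel" by simp
  obtain l where l: "0 < l" "(\<integral>\<^sup>+x. P (w x / l) \<partial>lborel) < \<infinity>" "energy (\<lambda>x. w x / l) < \<infinity>"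
    using W_modular[OF w] by blast
  have "(\<integral>\<^sup>+x. ennreal (P (\<bar>w x\<bar> / l)) \<partial>lebesgue_on \<Omega>) = (\<integral>\<^sup>+x. ennreal (P (\<bar>w x\<bar> / l)) * indicator \<Omega> x \<partial>lborel)"
    by (subst nn_integral_restrict_space) (simp_all add: nn_integral_completion)
  also have "\<dots> \<le> (\<integral>\<^sup>+x. P (w x / l) \<partial>lborel)"
    by (intro nn_integral_mono) (simp add: P_abs_div[OF l(1)] indicator_def)
  finally have 1: "(\<integral>\<^sup>+x. ennreal (P (\<bar>w x\<bar> / l)) \<partial>lebesgue_on \<Omega>) < \<infinity>" using l(2) by (rule order_le_less_trans)
  have "(\<integral>\<^sup>+p. ennreal (P (\<bar>D_frac s w p\<bar> / l)) \<partial>frac_measure) = (\<integral>\<^sup>+p. ennreal (P (D_frac s w p / l)) \<partial>frac_lborel)"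
    by (rule nn_integral_frac_measure) (auto simp: P_abs_div[OF l(1)])
  then have 2: "(\<integral>\<^sup>+p. ennreal (P (\<bar>D_frac s w p\<bar> / l)) \<partial>frac_measure) < \<infinity>"
    using l(3) by (simp add: energy_def D_frac_cdiv)
  have "w \<in> borel_measurable (lebesgue_on \<Omega>)"
    by (rule measurable_restrict_space1[OF measurable_completion[OF wl]])
  moreover have "D_frac s w \<in> borel_measurable frac_measure"
    using measurable_completion[OF Dl] by (simp cong: measurable_cong_sets add: sets_frac_measure)
  ultimately show ?thesis
    using 1 2 l(1) W_supported[OF w] unfolding frac_W_def orlicz_L_def supported_def by blast
qed

text \<open>Since \<open>W_approximable\<close> concerns nonnegative functions, the positive and the
  negative part are approximated separately and the test functions subtracted.\<close>

lemma W_test_approximation: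
  assumes lip: "lipschitz_boundary \<Omega>" and w: "w \<in> W"
  obtains f where "\<And>n. f n \<in> test_functions \<Omega>"
    "\<And>z. pairable frac_lborel z \<Longrightarrow>
      (\<lambda>n. \<integral>p. z p * D_frac s (f n) p \<partial>frac_lborel) \<longlonglongrightarrow> (\<integral>p. z p * D_frac s w p \<partial>frac_lborel)"
    "\<And>z. pairable lborel z \<Longrightarrow> (\<lambda>n. \<integral>x. z x * f n x \<partial>lborel) \<longlonglongrightarrow> (\<integral>x. z x * w x \<partial>lborel)"
proof -
  have n: "(\<lambda>x. - w x) \<in> W" using W_cmult[OF w, of "-1"] by simp
  define a where "a x = max 0 (w x)" for x
  define b where "b x = max 0 (- w x)" for x
  have aW: "a \<in> W" and bW: "b \<in> W" unfolding a_def b_def by (intro W_pos_part w n)+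
  have aA: "approximable a" and bA: "approximable b"
    by (intro W_approximable[OF lip] aW bW, simp add: a_def b_def)+
  obtain f where f: "\<And>n. f n \<in> test_functions \<Omega>"
    "\<And>z. pairable frac_lborel z \<Longrightarrow> (\<lambda>n. \<integral>p. z p * D_frac s (f n) p \<partial>frac_lborel) \<longlonglongrightarrow> (\<integral>p. z p * D_frac s a p \<partial>frac_lborel)"
    "\<And>z. pairable lborel z \<Longrightarrow> (\<lambda>n. \<integral>x. z x * f n x \<partial>lborel) \<longlonglongrightarrow> (\<integral>x. z x * a x \<partial>lborel)"
    using aA unfolding approximable_def by blast
  obtain g where g: "\<And>n. g n \<in> test_functions \<Omega>"
    "\<And>z. pairable frac_lborel z \<Longrightarrow> (\<lambda>n. \<integral>p. z p * D_frac s (g n) p \<partial>frac_lborel) \<longlonglongrightarrow> (\<integral>p. z p * D_frac s b p \<partial>frac_lborel)"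
    "\<And>z. pairable lborel z \<Longrightarrow> (\<lambda>n. \<integral>x. z x * g n x \<partial>lborel) \<longlonglongrightarrow> (\<integral>x. z x * b x \<partial>lborel)"
    using bA unfolding approximable_def by blast
  have w_eq: "w = (\<lambda>x. a x - b x)" by (rule ext) (simp add: a_def b_def max_def)
  have D: "(\<integral>p. z p * D_frac s (\<lambda>x. c x - d x) p \<partial>frac_lborel)
    = (\<integral>p. z p * D_frac s c p \<partial>frac_lborel) - (\<integral>p. z p * D_frac s d p \<partial>frac_lborel)"
    if "pairable frac_lborel z" "c \<in> W" "d \<in> W" for c d z
    unfolding D_frac_diff right_diff_distrib using that
    by (intro Bochner_Integration.integral_diff W_pairing_integrable)
  have E: "(\<integral>x. z x * (c x - d x) \<partial>lborel) = (\<integral>x. z x * c x \<partial>lborel) - (\<integral>x. z x * d x \<partial>lborel)"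
    if "pairable lborel z" "c \<in> W" "d \<in> W" for c d z
    unfolding right_diff_distrib using that
    by (intro Bochner_Integration.integral_diff W_pairing_integrable)
  note tw = test_function_W[OF f(1)] test_function_W[OF g(1)]
  show ?thesis
  proof (rule that[of "\<lambda>n x. f n x - g n x"])
    show "(\<lambda>x. f n x - g n x) \<in> test_functions \<Omega>" for n
      using test_functions_add[OF f(1) test_functions_minus[OF g(1)]] by simp
    show "(\<lambda>n. \<integral>p. z p * D_frac s (\<lambda>x. f n x - g n x) p \<partial>frac_lborel) \<longlonglongrightarrow> (\<integral>p. z p * D_frac s w p \<partial>frac_lborel)"
      if "pairable frac_lborel z" for z
      unfolding D[OF that tw] w_eq D[OF that aW bW] by (intro tendsto_diff f(2) g(2) that)
    show "(\<lambda>n. \<integral>x. z x * (f n x - g n x) \<partial>lborel) \<longlonglongrightarrow> (\<integral>x. z x * w x \<partial>lborel)"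
      if "pairable lborel z" for z
      unfolding E[OF that tw] w_eq E[OF that aW bW] by (intro tendsto_diff f(3) g(3) that)
  qed
qed

lemma pairing_representative:
  assumes v: "v \<in> frac_W P s \<Omega>" "v' \<in> W" "AE x in lborel. v x = v' x" "AE p in frac_lborel. D_frac s v p = D_frac s v' p"
    and z: "z \<in> borel_measurable frac_measure" "z' \<in> borel_measurable borel" "AE p in frac_lborel. z p = z' p"
  shows "(\<integral>p. D_frac s v p * z p \<partial>frac_measure) = (\<integral>p. z' p * D_frac s v' p \<partial>frac_lborel)"
proof (rule integral_frac_measure)
  have [measurable]: "v' \<in> borel_measurable borel" using v(2) by measurable
  show "(\<lambda>p. z' p * D_frac s v' p) \<in> borel_measurable borel" using z(2) by measurable
  show "(\<lambda>p. D_frac s v p * z p) \<in> borel_measurable frac_measure"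
    using frac_W_measurable(2)[OF v(1)] z(1) by (rule borel_measurable_times)
  show "AE p in frac_lborel. D_frac s v p * z p = z' p * D_frac s v' p"
    using v(4) z(3) by eventually_elim simp
qed

lemma pairing_representative_lebesgue:
  assumes v: "v \<in> frac_W P s \<Omega>" "v' \<in> W" "AE x in lborel. v x = v' x"
    and z: "z \<in> borel_measurable (lebesgue_on \<Omega>)" "z' \<in> borel_measurable borel" "AE x in lborel. x \<in> \<Omega> \<longrightarrow> z x = z' x"
  shows "(\<integral>x. v x * z x \<partial>lebesgue_on \<Omega>) = (\<integral>x. z' x * v' x \<partial>lborel)"
proof (rule integral_lebesgue_on)
  have [measurable]: "v' \<in> borel_measurable borel" using v(2) by measurable
  show "(\<lambda>x. z' x * v' x) \<in> borel_measurable borel" using z(2) by measurable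
  show "(\<lambda>x. v x * z x) \<in> borel_measurable (lebesgue_on \<Omega>)"
    using frac_W_measurable(1)[OF v(1)] z(1) by (rule borel_measurable_times)
  show "AE x in lborel. x \<in> \<Omega> \<longrightarrow> v x * z x = z' x * v' x"
    using v(3) z(3) by eventually_elim simp
  show "z' x * v' x = 0" if "x \<notin> \<Omega>" for x using W_supported[OF v(2)] that by (simp add: supported_def)
qed simp

text \<open>The topology is the initial one for the pairings with the predual, so a sequence all of
  whose pairings converge enters every neighbourhood of its limit. A sequence therefore suffices,
  whether or not the topology is metrisable.\<close>

lemma frac_W_subset_frac_W0:
  assumes lip: "lipschitz_boundary \<Omega>"
  shows "frac_W P s \<Omega> \<subseteq> frac_W0 P s \<Omega>"
proof
  fix u assume u: "u \<in> frac_W P s \<Omega>"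
  obtain w where w: "w \<in> W" "AE x in lborel. u x = w x" "AE p in frac_lborel. D_frac s u p = D_frac s w p"
    using frac_W_representative[OF u] by blast
  obtain f where f: "\<And>n. f n \<in> test_functions \<Omega>"
    "\<And>z. pairable frac_lborel z \<Longrightarrow>
      (\<lambda>n. \<integral>p. z p * D_frac s (f n) p \<partial>frac_lborel) \<longlonglongrightarrow> (\<integral>p. z p * D_frac s w p \<partial>frac_lborel)"
    "\<And>z. pairable lborel z \<Longrightarrow> (\<lambda>n. \<integral>x. z x * f n x \<partial>lborel) \<longlonglongrightarrow> (\<integral>x. z x * w x \<partial>lborel)"
    using W_test_approximation[OF lip w(1)] by blast
  note fW = test_function_W[OF f(1)] and ffW = W_frac_W[OF test_function_W[OF f(1)]]
  define E where "E = orlicz_E (conjugate_fun P) (lebesgue_on \<Omega>) \<times> orlicz_E (conjugate_fun P) (frac_measure :: ('a \<times> 'a) measure)"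
  define A where "A = orlicz_L P (lebesgue_on \<Omega>) \<times> orlicz_L P (frac_measure :: ('a \<times> 'a) measure)"
  define B where "B = (\<lambda>(f, g). \<lambda>(w, z)\<in>E. (\<integral>x. f x * w x \<partial>lebesgue_on \<Omega>) + (\<integral>p. g p * z p \<partial>(frac_measure :: ('a \<times> 'a) measure)))"
  have ws: "orlicz_weak_star P (lebesgue_on \<Omega>) frac_measure = pullback_topology A B (powertop_real E)"
    by (simp add: orlicz_weak_star_def A_def B_def E_def Let_def)
  have inA: "(v, D_frac s v) \<in> A" if "v \<in> frac_W P s \<Omega>" for v
    using that by (simp add: A_def frac_W_def)
  have ext: "B v \<in> extensional E" for v by (simp add: B_def split_beta)
  have lim: "limitin (powertop_real E) (\<lambda>n. B (f n, D_frac s (f n))) (B (u, D_frac s u)) sequentially"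
    unfolding limitin_componentwise
  proof (intro conjI ballI)
    show "\<forall>\<^sub>F n in sequentially. B (f n, D_frac s (f n)) \<in> topspace (powertop_real E)"
      by (intro always_eventually allI) (simp add: PiE_iff ext)
    fix e assume e: "e \<in> E"
    obtain a z where az: "e = (a, z)" by (cases e)
    have aE: "a \<in> orlicz_E (conjugate_fun P) (lebesgue_on \<Omega>)" and zE: "z \<in> orlicz_E (conjugate_fun P) frac_measure"
      using e by (auto simp: az E_def)
    have am: "a \<in> borel_measurable (lebesgue_on \<Omega>)" and zm: "z \<in> borel_measurable frac_measure"
      using aE zE by (auto simp: orlicz_E_def)
    obtain a' where a': "pairable lborel a'" "a' \<in> borel_measurable borel" "AE x in lborel. x \<in> \<Omega> \<longrightarrow> a x = a' x"
      using orlicz_E_lebesgue_pairable[OF domain_measurable aE] by blast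
    obtain z' where z': "pairable frac_lborel z'" "z' \<in> borel_measurable borel" "AE p in frac_lborel. z p = z' p"
      using orlicz_E_frac_pairable[OF zE] by blast
    \<comment> \<open>The pairing defined with Lebesgue measurable functions is expressed through
      Borel representatives, for which the convergence of the pairings was proved.\<close>
    have Bv: "B (v, D_frac s v) e = (\<integral>x. a' x * v' x \<partial>lborel) + (\<integral>p. z' p * D_frac s v' p \<partial>frac_lborel)"
      if "v \<in> frac_W P s \<Omega>" "v' \<in> W" "AE x in lborel. v x = v' x" "AE p in frac_lborel. D_frac s v p = D_frac s v' p" for v v'
      using e pairing_representative[OF that zm z'(2,3)] pairing_representative_lebesgue[OF that(1-3) am a'(2,3)]
      by (simp add: B_def az)
    have "(\<lambda>n. B (f n, D_frac s (f n)) e) \<longlonglongrightarrow> B (u, D_frac s u) e"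
      unfolding Bv[OF u w] Bv[OF ffW fW AE_I2[OF refl] AE_I2[OF refl]]
      by (intro tendsto_add f(2) f(3) a' z')
    then show "limitin euclideanreal (\<lambda>n. B (f n, D_frac s (f n)) e) (B (u, D_frac s u) e) sequentially"
      by simp
  qed (rule ext)
  show "u \<in> frac_W0 P s \<Omega>"
    unfolding frac_W0_def in_closure_of
  proof (intro conjI allI impI)
    show "u \<in> topspace (frac_W_weak_star P s \<Omega>)"
      using u inA[OF u] ext by (simp add: frac_W_weak_star_def ws topspace_pullback_topology PiE_iff)
    fix T assume T: "u \<in> T \<and> openin (frac_W_weak_star P s \<Omega>) T"
    then obtain V where V: "openin (powertop_real E) V" "T = (\<lambda>u. (u, D_frac s u)) -` (B -` V \<inter> A) \<inter> frac_W P s \<Omega>"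
      unfolding frac_W_weak_star_def ws openin_pullback_topology by blast
    have "B (u, D_frac s u) \<in> V" using T V(2) by auto
    then have "\<forall>\<^sub>F n in sequentially. B (f n, D_frac s (f n)) \<in> V"
      using lim V(1) unfolding limitin_def by blast
    then obtain n where "B (f n, D_frac s (f n)) \<in> V" unfolding eventually_sequentially by blast
    then have "f n \<in> T" unfolding V(2) using ffW[of n] inA[OF ffW[of n]] by auto
    then show "\<exists>y. y \<in> test_functions \<Omega> \<and> y \<in> T" using f(1) by blast
  qed
qed

text \<open>With this the weak equation can be tested with every function of \<open>frac_W\<close>,
  and the closure disappears from the problem.\<close>

lemma frac_W0_eq_frac_W:
  assumes lip: "lipschitz_boundary \<Omega>"
  shows "frac_W0 P s \<Omega> = frac_W P s \<Omega>"
proof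
  show "frac_W0 P s \<Omega> \<subseteq> frac_W P s \<Omega>"
    unfolding frac_W0_def using closure_of_subset_topspace[of "frac_W_weak_star P s \<Omega>"]
    by (auto simp: frac_W_weak_star_def topspace_pullback_topology)
qed (rule frac_W_subset_frac_W0[OF lip])

end

section \<open>Existence and uniqueness\<close>

text \<open>At \<open>t = 0\<close> the factor \<open>t\<close> makes the derivative vanish whatever
  the value of \<open>\<phi>\<close> there; monotonicity on the positive half-line extends to the
  whole line by oddness.\<close>

lemma convex_pair_Phi_of:
  assumes pos: "\<And>t. t > 0 \<Longrightarrow> \<phi> t > 0"
    and mono: "mono_on {0<..} (\<lambda>t. t * \<phi> t)"
    and top: "filterlim (\<lambda>t. t * \<phi> t) at_top at_top"
    and deriv: "\<And>t. (Phi_of \<phi> has_real_derivative \<phi> \<bar>t\<bar> * t) (at t)"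
  shows "convex_pair (Phi_of \<phi>) (\<lambda>t. \<phi> \<bar>t\<bar> * t)"
proof
  have nn: "0 \<le> \<phi> t * t" if "0 \<le> t" for t
    using pos[of t] that by (cases "t = 0") auto
  have m: "\<phi> x * x \<le> \<phi> y * y" if "0 \<le> x" "x \<le> y" for x y
  proof (cases "x = 0")
    case True
    then show ?thesis using nn[of y] that by simp
  next
    case False
    then show ?thesis using mono_onD[OF mono, of x y] that by (simp add: mult.commute)
  qed
  show "mono (\<lambda>t. \<phi> \<bar>t\<bar> * t)"
  proof (rule monoI)
    fix x y :: real assume xy: "x \<le> y"
    consider "0 \<le> x" | "x < 0" "0 \<le> y" | "y < 0" by linarith
    then show "\<phi> \<bar>x\<bar> * x \<le> \<phi> \<bar>y\<bar> * y"
    proof cases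
      case 1
      then show ?thesis using m xy by simp
    next
      case 2
      then show ?thesis using nn[of "- x"] nn[of y] by simp
    next
      case 3
      then show ?thesis using m[of "- y" "- x"] xy by simp
    qed
  qed
  have "\<forall>\<^sub>F t in at_top. t * \<phi> t = \<phi> \<bar>t\<bar> * t"
    using eventually_ge_at_top[of "0::real"] by eventually_elim simp
  then show "filterlim (\<lambda>t. \<phi> \<bar>t\<bar> * t) at_top at_top"
    using top filterlim_cong[OF refl refl] by metis
qed (use deriv in \<open>auto simp: Phi_of_def\<close>)

text \<open>Testing with the difference of two solutions, monotonicity makes the left-hand side
  nonnegative, while the right-hand side is nonpositive and strictly so where they differ.\<close>

lemma (in frac_setting) weak_solution_unique:
  assumes \<gamma>: "0 < \<gamma>"
    and u: "supported u" "AE x in lborel. x \<in> \<Omega> \<longrightarrow> 0 < u x"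
    and v: "supported v" "AE x in lborel. x \<in> \<Omega> \<longrightarrow> 0 < v x"
    and iu: "integrable frac_lborel (\<lambda>p'. p (D_frac s u p') * (D_frac s u p' - D_frac s v p'))"
      "integrable lborel (\<lambda>x. u x powr (- \<gamma>) * (u x - v x))"
    and iv: "integrable frac_lborel (\<lambda>p'. p (D_frac s v p') * (D_frac s u p' - D_frac s v p'))"
      "integrable lborel (\<lambda>x. v x powr (- \<gamma>) * (u x - v x))"
    and eu: "(1 - s) / 2 * (\<integral>p'. p (D_frac s u p') * (D_frac s u p' - D_frac s v p') \<partial>frac_lborel)
      = (\<integral>x. u x powr (- \<gamma>) * (u x - v x) \<partial>lborel)"
    and ev: "(1 - s) / 2 * (\<integral>p'. p (D_frac s v p') * (D_frac s u p' - D_frac s v p') \<partial>frac_lborel)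
      = (\<integral>x. v x powr (- \<gamma>) * (u x - v x) \<partial>lborel)"
  shows "AE x in lborel. v x = u x"
proof -
  let ?g = "\<lambda>x. (v x powr (- \<gamma>) - u x powr (- \<gamma>)) * (u x - v x)"
  have ig: "integrable lborel ?g"
    unfolding left_diff_distrib by (rule Bochner_Integration.integrable_diff[OF iv(2) iu(2)])
  have less: "a powr (- \<gamma>) < b powr (- \<gamma>)" if "0 < b" "b < a" for a b
    using that \<gamma> by (intro powr_less_mono2_neg) auto
  have g0: "AE x in lborel. 0 \<le> ?g x \<and> (?g x = 0 \<longrightarrow> v x = u x)"
    using u(2) v(2)
  proof eventually_elim
    case (elim x)
    show ?case
    proof (cases "x \<in> \<Omega>")
      case True
      consider "u x = v x" | "u x < v x" | "v x < u x" by linarith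
      then show ?thesis
      proof cases
        case 2
        then have "0 < ?g x" using less[of "u x" "v x"] elim True by (intro mult_neg_neg) auto
        then show ?thesis by (metis less_imp_le less_irrefl)
      next
        case 3
        then have "0 < ?g x" using less[of "v x" "u x"] elim True by (intro mult_pos_pos) auto
        then show ?thesis by (metis less_imp_le less_irrefl)
      qed simp
    next
      case False
      then show ?thesis using u(1) v(1) by (simp add: supported_def)
    qed
  qed
  have "0 \<le> (\<integral>p'. (p (D_frac s u p') - p (D_frac s v p')) * (D_frac s u p' - D_frac s v p') \<partial>frac_lborel)"
  proof (rule integral_nonneg_AE, rule AE_I2)
    fix p'
    have "0 \<le> (p a - p b) * (a - b)" for a b
      using monoD[OF p_mono, of a b] monoD[OF p_mono, of b a] by (cases "a \<le> b") (auto intro: mult_nonpos_nonpos)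
    then show "0 \<le> (p (D_frac s u p') - p (D_frac s v p')) * (D_frac s u p' - D_frac s v p')" .
  qed
  also have "\<dots> = (\<integral>p'. p (D_frac s u p') * (D_frac s u p' - D_frac s v p') \<partial>frac_lborel)
    - (\<integral>p'. p (D_frac s v p') * (D_frac s u p' - D_frac s v p') \<partial>frac_lborel)"
    unfolding left_diff_distrib by (rule Bochner_Integration.integral_diff[OF iu(1) iv(1)])
  finally have "0 \<le> (1 - s) / 2 * ((\<integral>p'. p (D_frac s u p') * (D_frac s u p' - D_frac s v p') \<partial>frac_lborel)
    - (\<integral>p'. p (D_frac s v p') * (D_frac s u p' - D_frac s v p') \<partial>frac_lborel))"
    using s by (intro mult_nonneg_nonneg) auto
  moreover have "(\<integral>x. ?g x \<partial>lborel) = (\<integral>x. v x powr (- \<gamma>) * (u x - v x) \<partial>lborel) - (\<integral>x. u x powr (- \<gamma>) * (u x - v x) \<partial>lborel)"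
    unfolding left_diff_distrib by (rule Bochner_Integration.integral_diff[OF iv(2) iu(2)])
  moreover have "c * (a - b) = c * a - c * b" for a b c :: real by (rule right_diff_distrib)
  ultimately have "(\<integral>x. ?g x \<partial>lborel) \<le> 0" using eu ev by simp
  moreover have nn: "AE x in lborel. 0 \<le> ?g x" using g0 by eventually_elim simp
  ultimately have "(\<integral>x. ?g x \<partial>lborel) = 0" using integral_nonneg_AE[OF nn] by linarith
  then have "AE x in lborel. ?g x = 0" using integral_nonneg_eq_0_iff_AE[OF ig nn] by simp
  with g0 show ?thesis by eventually_elim simp
qed

theorem theorem1p3:
  fixes \<Omega> :: "'a::euclidean_space set"
    and s \<gamma> :: real
    and \<phi> :: "real \<Rightarrow> real"
  assumes "open \<Omega>" and "connected \<Omega>" and "\<Omega> \<noteq> {}" and "bounded \<Omega>"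
    and "lipschitz_boundary \<Omega>"
    and "0 < s" and "s < 1" and "0 < \<gamma>" and "\<gamma> < 1"
    and "\<And>t. t > 0 \<Longrightarrow> \<phi> t > 0"
    and "mono_on {0<..} (\<lambda>t. t * \<phi> t)"
    and "((\<lambda>t. t * \<phi> t) \<longlongrightarrow> 0) (at_right 0)"
    and "filterlim (\<lambda>t. t * \<phi> t) at_top at_top"
    and "\<And>t. (Phi_of \<phi> has_real_derivative \<phi> \<bar>t\<bar> * t) (at t)"
  shows "\<exists>u. positive_weak_solution \<phi> s \<gamma> \<Omega> u \<and>
           (\<forall>v. positive_weak_solution \<phi> s \<gamma> \<Omega> v \<longrightarrow> (AE x in lebesgue_on \<Omega>. v x = u x))"
proof -
  interpret singular_problem "Phi_of \<phi>" "\<lambda>t. \<phi> \<bar>t\<bar> * t" s \<Omega> "1 - \<gamma>"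
    using convex_pair_Phi_of[of \<phi>] assms
    by (auto intro!: singular_problem.intro frac_setting.intro frac_setting_axioms.intro singular_problem_axioms.intro)
  have W0: "frac_W0 (Phi_of \<phi>) s \<Omega> = frac_W (Phi_of \<phi>) s \<Omega>" by (rule frac_W0_eq_frac_W[OF assms(5)])
  have on_iff: "(AE x in lebesgue_on \<Omega>. Q x) \<longleftrightarrow> (AE x in lborel. x \<in> \<Omega> \<longrightarrow> Q x)" for Q
    by (subst AE_restrict_space_iff) (simp_all add: AE_completion_iff)
  \<comment> \<open>Both sides of the weak equation are transferred from the Lebesgue measurable
    functions \<open>u\<close>, \<open>v\<close> to Borel functions \<open>u'\<close>,
    \<open>v'\<close> that agree with them almost everywhere.\<close>
  have flux: "integrable frac_measure (\<lambda>p. \<phi> \<bar>D_frac s u p\<bar> * D_frac s u p * D_frac s v p)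
        \<longleftrightarrow> integrable frac_lborel (\<lambda>p. \<phi> \<bar>D_frac s u' p\<bar> * D_frac s u' p * D_frac s v' p)"
      "(\<integral>p. \<phi> \<bar>D_frac s u p\<bar> * D_frac s u p * D_frac s v p \<partial>frac_measure)
        = (\<integral>p. \<phi> \<bar>D_frac s u' p\<bar> * D_frac s u' p * D_frac s v' p \<partial>frac_lborel)"
    and rhs: "integrable (lebesgue_on \<Omega>) (\<lambda>x. u x powr (- \<gamma>) * v x) \<longleftrightarrow> integrable lborel (\<lambda>x. u' x powr (- \<gamma>) * v' x)"
      "(\<integral>x. u x powr (- \<gamma>) * v x \<partial>lebesgue_on \<Omega>) = (\<integral>x. u' x powr (- \<gamma>) * v' x \<partial>lborel)"
    if u: "u \<in> frac_W (Phi_of \<phi>) s \<Omega>" "u' \<in> W" "AE x in lborel. u x = u' x" "AE p in frac_lborel. D_frac s u p = D_frac s u' p"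
      and v: "v \<in> frac_W (Phi_of \<phi>) s \<Omega>" "v' \<in> W" "AE x in lborel. v x = v' x" "AE p in frac_lborel. D_frac s v p = D_frac s v' p"
    for u u' v v'
  proof -
    have [measurable]: "u' \<in> borel_measurable borel" "v' \<in> borel_measurable borel" using u(2) v(2) by measurable
    have bm: "(\<lambda>p. \<phi> \<bar>D_frac s u' p\<bar> * D_frac s u' p * D_frac s v' p) \<in> borel_measurable borel"
      by (rule borel_measurable_times[OF measurable_compose[OF D_frac_measurable p_measurable] D_frac_measurable]) measurable
    have fm: "(\<lambda>p. \<phi> \<bar>D_frac s u p\<bar> * D_frac s u p * D_frac s v p) \<in> borel_measurable frac_measure"
      by (rule borel_measurable_times[OF measurable_compose[OF frac_W_measurable(2)[OF u(1)] p_measurable] frac_W_measurable(2)[OF v(1)]])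
    have eq: "AE p in frac_lborel. \<phi> \<bar>D_frac s u p\<bar> * D_frac s u p * D_frac s v p = \<phi> \<bar>D_frac s u' p\<bar> * D_frac s u' p * D_frac s v' p"
      using u(4) v(4) by eventually_elim simp
    show "integrable frac_measure (\<lambda>p. \<phi> \<bar>D_frac s u p\<bar> * D_frac s u p * D_frac s v p)
        \<longleftrightarrow> integrable frac_lborel (\<lambda>p. \<phi> \<bar>D_frac s u' p\<bar> * D_frac s u' p * D_frac s v' p)"
      by (rule integrable_frac_measure[OF bm fm eq])
    show "(\<integral>p. \<phi> \<bar>D_frac s u p\<bar> * D_frac s u p * D_frac s v p \<partial>frac_measure)
        = (\<integral>p. \<phi> \<bar>D_frac s u' p\<bar> * D_frac s u' p * D_frac s v' p \<partial>frac_lborel)"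
      by (rule integral_frac_measure[OF bm fm eq])
    have bm': "(\<lambda>x. u' x powr (- \<gamma>) * v' x) \<in> borel_measurable borel" by measurable
    have z': "u' x powr (- \<gamma>) * v' x = 0" if "x \<notin> \<Omega>" for x using W_supported[OF v(2)] that by (simp add: supported_def)
    have [measurable]: "u \<in> borel_measurable (lebesgue_on \<Omega>)" "v \<in> borel_measurable (lebesgue_on \<Omega>)"
      by (rule frac_W_measurable(1), fact)+
    have fm': "(\<lambda>x. u x powr (- \<gamma>) * v x) \<in> borel_measurable (lebesgue_on \<Omega>)" by measurable
    have eq': "AE x in lborel. x \<in> \<Omega> \<longrightarrow> u x powr (- \<gamma>) * v x = u' x powr (- \<gamma>) * v' x"
      using u(3) v(3) by eventually_elim simp
    show "integrable (lebesgue_on \<Omega>) (\<lambda>x. u x powr (- \<gamma>) * v x) \<longleftrightarrow> integrable lborel (\<lambda>x. u' x powr (- \<gamma>) * v' x)"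
      by (rule integrable_lebesgue_on[OF domain_measurable bm' z' fm' eq'])
    show "(\<integral>x. u x powr (- \<gamma>) * v x \<partial>lebesgue_on \<Omega>) = (\<integral>x. u' x powr (- \<gamma>) * v' x \<partial>lborel)"
      by (rule integral_lebesgue_on[OF domain_measurable bm' z' fm' eq'])
  qed
  have g: "1 - \<gamma> - 1 = - \<gamma>" by simp
  obtain u where uW: "u \<in> W" and "\<And>x. 0 \<le> u x" and u0: "AE x in lborel. x \<in> \<Omega> \<longrightarrow> 0 < u x"
    and iu: "\<And>v. v \<in> W \<Longrightarrow> integrable frac_lborel (\<lambda>p. \<phi> \<bar>D_frac s u p\<bar> * D_frac s u p * D_frac s v p)"
      "\<And>v. v \<in> W \<Longrightarrow> integrable lborel (\<lambda>x. u x powr (- \<gamma>) * v x)"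
    and eu: "\<And>v. v \<in> W \<Longrightarrow> (1 - s) / 2 * (\<integral>p. \<phi> \<bar>D_frac s u p\<bar> * D_frac s u p * D_frac s v p \<partial>frac_lborel)
      = (\<integral>x. u x powr (- \<gamma>) * v x \<partial>lborel)"
    by (rule weak_solution_exists[OF assms(5), unfolded g]) (rule that, assumption+)
  note uF = W_frac_W[OF uW]
  have sol: "positive_weak_solution \<phi> s \<gamma> \<Omega> u"
    unfolding positive_weak_solution_def weak_solution_def W0 on_iff
  proof (intro conjI ballI uF u0)
    fix v assume vF: "v \<in> frac_W (Phi_of \<phi>) s \<Omega>"
    obtain v' where v': "v' \<in> W" "AE x in lborel. v x = v' x" "AE p in frac_lborel. D_frac s v p = D_frac s v' p"
      using frac_W_representative[OF vF] by blast
    note t = flux[OF uF uW AE_I2[OF refl] AE_I2[OF refl] vF v'] rhs[OF uF uW AE_I2[OF refl] AE_I2[OF refl] vF v']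
    show "integrable frac_measure (\<lambda>p. \<phi> \<bar>D_frac s u p\<bar> * D_frac s u p * D_frac s v p)"
      unfolding t by (rule iu[OF v'(1)])
    show "integrable (lebesgue_on \<Omega>) (\<lambda>x. u x powr (- \<gamma>) * v x)"
      unfolding t by (rule iu[OF v'(1)])
    show "(1 - s) / 2 * (\<integral>p. \<phi> \<bar>D_frac s u p\<bar> * D_frac s u p * D_frac s v p \<partial>frac_measure)
      = (\<integral>x. u x powr (- \<gamma>) * v x \<partial>lebesgue_on \<Omega>)"
      unfolding t by (rule eu[OF v'(1)])
  qed
  have "AE x in lebesgue_on \<Omega>. v x = u x" if v: "positive_weak_solution \<phi> s \<gamma> \<Omega> v" for v
  proof -
    have vF: "v \<in> frac_W (Phi_of \<phi>) s \<Omega>" and v0: "AE x in lborel. x \<in> \<Omega> \<longrightarrow> 0 < v x"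
      using v unfolding positive_weak_solution_def weak_solution_def W0 on_iff by auto
    obtain v' where v': "v' \<in> W" "AE x in lborel. v x = v' x" "AE p in frac_lborel. D_frac s v p = D_frac s v' p"
      using frac_W_representative[OF vF] by blast
    \<comment> \<open>The difference is taken with the Borel representative of the second solution,
      which makes it an admissible test function in both equations.\<close>
    define d where "d x = u x - v' x" for x
    have dW: "d \<in> W" unfolding d_def by (rule W_diff[OF uW v'(1)])
    note dF = W_frac_W[OF dW]
    note t = flux[OF vF v' dF dW AE_I2[OF refl] AE_I2[OF refl]] rhs[OF vF v' dF dW AE_I2[OF refl] AE_I2[OF refl]]
    have vd: "integrable frac_lborel (\<lambda>p. \<phi> \<bar>D_frac s v' p\<bar> * D_frac s v' p * D_frac s d p)"
      "integrable lborel (\<lambda>x. v' x powr (- \<gamma>) * d x)"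
      "(1 - s) / 2 * (\<integral>p. \<phi> \<bar>D_frac s v' p\<bar> * D_frac s v' p * D_frac s d p \<partial>frac_lborel)
        = (\<integral>x. v' x powr (- \<gamma>) * d x \<partial>lborel)"
      using v dF unfolding positive_weak_solution_def weak_solution_def W0 t[symmetric] by blast+
    have v'0: "AE x in lborel. x \<in> \<Omega> \<longrightarrow> 0 < v' x" using v0 v'(2) by eventually_elim auto
    have Dd: "D_frac s d p = D_frac s u p - D_frac s v' p" for p unfolding d_def by (rule D_frac_diff)
    have "AE x in lborel. v' x = u x"
      by (rule weak_solution_unique[OF assms(8) W_supported[OF uW] u0 W_supported[OF v'(1)] v'0])
        (use iu[OF dW] eu[OF dW] vd in \<open>simp_all only: Dd d_def\<close>)
    then show ?thesis unfolding on_iff using v'(2) by eventually_elim simp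
  qed
  with sol show ?thesis by blast
qed

end
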